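(* Let $x_0\in[0,1]$ be an irrational number with continued fraction expansion $x_0=[\,i_0,i_1,\dots]$ and let $\{t_n\}$ be a non-decreasing sequence of natural numbers. Let $\widetilde W$ be the set of points $x=[\,m_0,m_1,\dots]\in[0,1]$ such that $$m_n=i_0,\ m_{n+1}=i_1,\ \dots,\ m_{n+t_n}=i_{t_n}\qquad\text{for infinitely many }n.$$ Let $\lambda$ be Lebesgue measure. Then: (1) $\lambda(\widetilde W)=1$ if $\displaystyle\sum_n\frac1{(i_0+1)^2\cdots(i_{t_n}+1)^2}=\infty$. (2) $\lambda(\widetilde W)=0$ if $\displaystyle\sum_n\frac1{i_0^2\cdots i_{t_n}^2}<\infty$. (3) In any case, if $\log i_n=o(n)$ as $n\to\infty$, then $$\mathrm{Dim}(\widetilde W)\ge\frac{\pi^2}{\pi^2+6\log2\ \limsup_{n\to\infty}\frac1n\log\left[(i_0+1)^2\cdots(i_{t_n}+1)^2\right]}.$$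
   Context: For irrational $x\in(0,1)$ the continued fraction expansion is written $x=[\,n_0,n_1,n_2,\dots]$, meaning $x=\cfrac1{n_0+\cfrac1{n_1+\cdots}}$ with $n_j\in\{1,2,\dots\}$; equivalently $n_j=[1/\phi^j(x)]$ where $\phi(x)=1/x-[1/x]$ is the Gauss map and $[\cdot]$ is the integer part. $\mathrm{Dim}$ is the usual Hausdorff dimension. *)

theory Defs
  imports "HOL-Analysis.Analysis" "HOL-Library.Landau_Symbols"
begin

section \<open>Continued fractions\<close>

definition gauss_map :: "real \<Rightarrow> real" where
  "gauss_map x = 1 / x - of_int \<lfloor>1 / x\<rfloor>"

text \<open>
  The digits \<open>n\<^sub>0, n\<^sub>1, \<dots>\<close> of \<open>x = 1/(n\<^sub>0 + 1/(n\<^sub>1 + \<dots>))\<close>. They are meaningful only for irrational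
  \<open>x\<close> in the unit interval.
\<close>

definition cf_digit :: "real \<Rightarrow> nat \<Rightarrow> nat" where
  "cf_digit x j = nat \<lfloor>1 / (gauss_map ^^ j) x\<rfloor>"

lemma gauss_map_irrational:
  assumes "x \<in> {0<..<1}" "x \<notin> \<rat>"
  shows "gauss_map x \<in> {0<..<1}" "gauss_map x \<notin> \<rat>"
proof -
  have "1 / x \<notin> \<rat>"
    using assms(2) Rats_inverse[of "1 / x"] by auto
  then show irr: "gauss_map x \<notin> \<rat>"
    using Rats_add[of "gauss_map x" "of_int \<lfloor>1 / x\<rfloor>"] by (auto simp: gauss_map_def)
  have "gauss_map x \<noteq> 0"
    using irr by auto
  moreover have "0 \<le> gauss_map x" "gauss_map x < 1"
    unfolding gauss_map_def by linarith+
  ultimately show "gauss_map x \<in> {0<..<1}"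
    by simp
qed

lemma cf_digit_step:
  assumes "x \<in> {0<..<1}" "x \<notin> \<rat>"
  shows "(gauss_map ^^ j) x = 1 / (real (cf_digit x j) + (gauss_map ^^ Suc j) x)"
    and "cf_digit x j \<ge> 1"
proof -
  define y where "y = (gauss_map ^^ j) x"
  have "y \<in> {0<..<1} \<and> y \<notin> \<rat>"
    unfolding y_def by (induction j) (use assms gauss_map_irrational in auto)
  then have y: "0 < y" "y < 1"
    by auto
  then have "1 \<le> 1 / y"
    by simp
  then have floor: "1 \<le> \<lfloor>1 / y\<rfloor>"
    by linarith
  then show "cf_digit x j \<ge> 1"
    unfolding cf_digit_def y_def[symmetric] by linarith
  have "real (nat \<lfloor>1 / y\<rfloor>) = of_int \<lfloor>1 / y\<rfloor>"
    by (rule of_nat_nat) (use floor in linarith)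
  then have "real (cf_digit x j) + (gauss_map ^^ Suc j) x = 1 / y"
    by (simp add: cf_digit_def y_def[symmetric] gauss_map_def)
  then show "(gauss_map ^^ j) x = 1 / (real (cf_digit x j) + (gauss_map ^^ Suc j) x)"
    by (simp add: y_def)
qed

definition recurrent_block_set :: "(nat \<Rightarrow> nat) \<Rightarrow> (nat \<Rightarrow> nat) \<Rightarrow> real set" where
  "recurrent_block_set i t =
     {x \<in> {0..1}. x \<notin> \<rat> \<and> (\<exists>\<^sub>\<infinity>n. \<forall>k\<le>t n. cf_digit x (n + k) = i k)}"

section \<open>Hausdorff dimension\<close>

text \<open>
  The cases for the empty set and for \<open>s = 0\<close> are explicit because \<open>0 powr 0 = 0\<close>; with them the
  zero-dimensional measure is the counting measure.
\<close>

definition diam_powr :: "real \<Rightarrow> 'a::metric_space set \<Rightarrow> ennreal" where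
  "diam_powr s U = (if U = {} then 0 else if s = 0 then 1 else ennreal (diameter U powr s))"

text \<open>
  Boundedness of the covering sets is required explicitly because \<open>diameter\<close> is a supremum of reals,
  which is unspecified on unbounded sets. Finite covers are included by padding with empty sets.
\<close>

definition hausdorff_premeasure :: "real \<Rightarrow> real \<Rightarrow> 'a::metric_space set \<Rightarrow> ennreal" where
  "hausdorff_premeasure s \<delta> A =
     Inf {(\<Sum>k. diam_powr s (U k)) | U :: nat \<Rightarrow> 'a set.
            A \<subseteq> (\<Union>k. U k) \<and> (\<forall>k. bounded (U k) \<and> diameter (U k) \<le> \<delta>)}"

definition hausdorff_measure :: "real \<Rightarrow> 'a::metric_space set \<Rightarrow> ennreal" where
  "hausdorff_measure s A = (SUP \<delta>\<in>{0<..}. hausdorff_premeasure s \<delta> A)"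

definition hausdorff_dim :: "'a::metric_space set \<Rightarrow> ereal" where
  "hausdorff_dim A = Inf {ereal s | s. 0 \<le> s \<and> hausdorff_measure s A = 0}"

end

theory Submission
  imports Defs "HOL-Probability.Probability" "HOL-Real_Asymp.Real_Asymp"
begin

text \<open>
  On a cylinder of order \<open>n\<close> the \<open>n\<close>-th iterate of the Gauss map \<open>\<phi>\<close> is a Moebius map of bounded
  distortion. Hence a set that contains a definite proportion of every cylinder has full measure, and
  the events \<open>A\<^sub>n\<close> that the block \<open>i\<^sub>0, \<dots>, i\<^bsub>t n\<^esub>\<close> occurs at position \<open>n\<close> are quasi-independent. The
  convergence case is the Borel--Cantelli lemma. In the divergence case the second moment method bounds
  the measure of \<open>limsup A\<^sub>n\<close> below by a constant that does not change when \<open>t\<close> is shifted, so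
  \<open>limsup A\<^sub>n\<close> contains a definite proportion of every cylinder.

  For the dimension, Birkhoff's theorem for \<open>- ln\<close> and the invariant Gauss measure shows that on a set
  \<open>G\<close> of positive measure all late denominators \<open>q\<^sub>n\<close> grow at least like \<open>exp (\<beta> n)\<close>, for any
  \<open>\<beta> < \<pi>\<^sup>2 / (12 ln 2)\<close>. Inserting the required blocks into the expansions of the points of \<open>G\<close> at
  sparse positions maps \<open>G\<close> into the recurrent set, and the inverse of this map is Hoelder continuous
  because the length of a block is paid for by the growth of \<open>q\<^sub>n\<close> before it.
\<close>

section \<open>Words and cylinders\<close>

text \<open>The role of ergodicity is played by \<open>eventually_positive_full\<close>: bounded
  distortion turns a uniform lower bound for events in the tails into full measure. Its events may
  depend on the position, as they must for the recurrent set, where the block length does; with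
  constant events it also drives the lower bound on Birkhoff averages. The exponent arises as
  follows. If q_n is at least exp(\<beta> n), points that share m digits are at distance at most
  exp(-2 \<beta> m). Insertion enlarges denominators by a factor E, so it shrinks distances by E^2
  up to constants, and E can be kept below exp(\<beta> (1/s - 1) m) once \<alpha> < \<beta> (1/s -
  1), where \<alpha> exceeds half the limsup L. Letting \<alpha> tend to L/2 and \<beta> to pi^2/(12
  ln 2), the critical s is 1/(1 + \<alpha>/\<beta>) = pi^2/(pi^2 + 6 ln 2 L). The obstacle is the
  tail behind the first differing digit: a block inserted right there changes it completely. All
  blocks begin with the same two digits, and those determine up to constants how near the new tail
  is to 0 and to 1, so the damage is a fixed factor.\<close>

definition irr :: "real set" where
  "irr = {0<..<1} - \<rat>"

lemma gauss_map_irr: "x \<in> irr \<Longrightarrow> gauss_map x \<in> irr"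
  using gauss_map_irrational by (auto simp: irr_def)

lemma gauss_map_funpow_irr: "x \<in> irr \<Longrightarrow> (gauss_map ^^ n) x \<in> irr"
  by (induction n) (auto intro: gauss_map_irr)

lemma cf_digit_add: "cf_digit x (n + k) = cf_digit ((gauss_map ^^ n) x) k"
  by (simp add: cf_digit_def add.commute[of n] funpow_add)

lemma cf_digit_Suc: "cf_digit x (Suc k) = cf_digit (gauss_map x) k"
  using cf_digit_add[of x 1 k] by simp

lemma cf_digit_pos: "x \<in> irr \<Longrightarrow> 1 \<le> cf_digit x k"
  using cf_digit_step(2) by (auto simp: irr_def)

lemma gauss_map_eq: "x \<in> irr \<Longrightarrow> x = 1 / (real (cf_digit x 0) + gauss_map x)"
  using cf_digit_step(1)[of x 0] by (auto simp: irr_def)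

lemma gauss_branch:
  assumes "a \<ge> 1" "0 < y" "y < 1"
  shows "gauss_map (1 / (real a + y)) = y" "cf_digit (1 / (real a + y)) 0 = a"
proof -
  have "\<lfloor>real a + y\<rfloor> = int a"
    using assms by linarith
  then show "gauss_map (1 / (real a + y)) = y" "cf_digit (1 / (real a + y)) 0 = a"
    by (simp_all add: gauss_map_def cf_digit_def)
qed

lemma gauss_branch_irr:
  assumes "a \<ge> 1" "y \<in> irr"
  shows "1 / (real a + y) \<in> irr"
proof -
  have "real a + y \<notin> \<rat>"
    using assms(2) Rats_diff[of "real a + y" "real a"] by (auto simp: irr_def)
  then have "1 / (real a + y) \<notin> \<rat>"
    using Rats_inverse[of "1 / (real a + y)"] by auto
  then show ?thesis
    using assms by (auto simp: irr_def field_simps)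
qed

section \<open>Inverse branches of the iterates and their cylinders\<close>

fun cf_map :: "nat list \<Rightarrow> real \<Rightarrow> real" where
  "cf_map [] y = y"
| "cf_map (a # w) y = 1 / (real a + cf_map w y)"

text \<open>The Moebius map \<open>cf_map w\<close> has derivative \<open>\<plusminus>1 / (cf_den w y)\<^sup>2\<close>.\<close>

fun cf_den :: "nat list \<Rightarrow> real \<Rightarrow> real" where
  "cf_den [] y = 1"
| "cf_den (a # w) y = (real a + cf_map w y) * cf_den w y"

definition cylinder :: "nat list \<Rightarrow> real set" where
  "cylinder w = {x \<in> irr. \<forall>j<length w. cf_digit x j = w ! j}"

definition cf_prefix :: "real \<Rightarrow> nat \<Rightarrow> nat list" where
  "cf_prefix x n = map (cf_digit x) [0..<n]"

lemma length_cf_prefix [simp]: "length (cf_prefix x n) = n"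
  by (simp add: cf_prefix_def)

lemma cf_prefix_nth [simp]: "j < n \<Longrightarrow> cf_prefix x n ! j = cf_digit x j"
  by (simp add: cf_prefix_def)

lemma cf_prefix_0 [simp]: "cf_prefix x 0 = []"
  by (simp add: cf_prefix_def)

lemma cf_prefix_pos: "x \<in> irr \<Longrightarrow> 0 \<notin> set (cf_prefix x n)"
  using cf_digit_pos[of x] by (metis imageE less_numeral_extra(1) linorder_not_less list.set_map cf_prefix_def)

lemma cf_prefix_add: "cf_prefix x (m + n) = cf_prefix x m @ cf_prefix ((gauss_map ^^ m) x) n"
  by (rule nth_equalityI) (auto simp: nth_append cf_digit_add[symmetric])

lemma cf_prefix_Suc: "cf_prefix x (Suc n) = cf_digit x 0 # cf_prefix (gauss_map x) n"
  using cf_prefix_add[of x 1 n] by (simp add: cf_prefix_def)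

lemma cylinder_iff: "x \<in> cylinder w \<longleftrightarrow> x \<in> irr \<and> cf_prefix x (length w) = w"
  by (auto simp: cylinder_def intro!: nth_equalityI) (metis cf_prefix_nth)

lemma cylinder_Nil [simp]: "cylinder [] = irr"
  by (auto simp: cylinder_def)

lemma cylinder_Cons:
  "x \<in> cylinder (a # w) \<longleftrightarrow> x \<in> irr \<and> cf_digit x 0 = a \<and> gauss_map x \<in> cylinder w"
  using gauss_map_irr by (auto simp: cylinder_iff cf_prefix_Suc)

lemma cf_map_append: "cf_map (v @ w) y = cf_map v (cf_map w y)"
  by (induction v) auto

lemma cf_den_append: "cf_den (v @ w) y = cf_den v (cf_map w y) * cf_den w y"
  by (induction v) (auto simp: cf_map_append)

lemma cf_map_irr: "0 \<notin> set w \<Longrightarrow> y \<in> irr \<Longrightarrow> cf_map w y \<in> irr"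
  by (induction w) (auto intro!: gauss_branch_irr)

lemma funpow_cf_map: "0 \<notin> set w \<Longrightarrow> y \<in> irr \<Longrightarrow> (gauss_map ^^ length w) (cf_map w y) = y"
proof (induction w)
  case (Cons a w)
  have "cf_map w y \<in> irr"
    using Cons.prems by (intro cf_map_irr) auto
  then have "gauss_map (cf_map (a # w) y) = cf_map w y"
    using Cons.prems gauss_branch(1)[of a "cf_map w y"] by (auto simp: irr_def)
  then show ?case
    using Cons by (simp add: funpow_Suc_right del: funpow.simps cf_map.simps)
qed auto

lemma cf_map_prefix: "x \<in> irr \<Longrightarrow> cf_map (cf_prefix x n) ((gauss_map ^^ n) x) = x"
proof (induction n arbitrary: x)
  case (Suc n)
  then show ?case
    using gauss_map_irr[of x] gauss_map_eq[of x]
    by (simp add: funpow_Suc_right cf_prefix_Suc del: funpow.simps)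
qed auto

lemma cf_map_unit: "0 \<notin> set w \<Longrightarrow> y \<in> {0..1} \<Longrightarrow> cf_map w y \<in> {0..1}"
  by (induction w) (auto simp: field_simps)

lemma cf_den_pos: "0 \<notin> set w \<Longrightarrow> y \<in> {0..1} \<Longrightarrow> 1 \<le> cf_den w y"
proof (induction w)
  case (Cons a w)
  then have "0 \<le> cf_map w y"
    using cf_map_unit[of w y] by auto
  then have "1 * 1 \<le> (real a + cf_map w y) * cf_den w y"
    using Cons by (intro mult_mono) auto
  then show ?case by simp
qed auto

lemma cf_den_ge_prod: "0 \<notin> set w \<Longrightarrow> y \<in> {0..1} \<Longrightarrow> (\<Prod>a\<leftarrow>w. real a) \<le> cf_den w y"
proof (induction w)
  case (Cons a w)
  then show ?case
    using cf_map_unit[of w y] by (auto intro!: mult_mono prod_list_nonneg)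
qed auto

lemma cf_den_le_prod: "0 \<notin> set w \<Longrightarrow> y \<in> {0..1} \<Longrightarrow> cf_den w y \<le> (\<Prod>a\<leftarrow>w. real a + 1)"
proof (induction w)
  case (Cons a w)
  then show ?case
    using cf_map_unit[of w y] cf_den_pos[of w y] by (auto intro!: mult_mono)
qed auto

section \<open>Distortion and growth of the denominators\<close>

lemma cf_den_affine:
  assumes "0 \<notin> set w"
  shows "\<exists>q q'. 0 \<le> q' \<and> q' \<le> q \<and> (\<forall>y\<in>{0..1}. cf_den w y = q + q' * y)"
proof -
  \<comment> \<open>\<open>p + p' * y\<close> and \<open>q + q' * y\<close> are numerator and
    denominator of the Moebius map \<open>cf_map w\<close>. Prepending a digit a turns (p, q) into
    (q, p + a q), so \<open>q' \<le> q\<close> is passed on only with the help of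
    \<open>p' + q' \<le> p + q\<close> and a \<ge> 1; the simpler \<open>p' \<le> p\<close> already
    fails for the empty word.\<close>
  have "\<exists>p p' q q'. 0 \<le> p \<and> 0 \<le> p' \<and> 0 \<le> q' \<and> q' \<le> q \<and> p' + q' \<le> p + q \<and>
      (\<forall>y\<in>{0..1}. cf_den w y = q + q' * y \<and> cf_map w y * cf_den w y = p + p' * y)"
    using assms
  proof (induction w)
    case Nil
    show ?case by (rule exI[of _ 0], rule exI[of _ 1], rule exI[of _ 1], rule exI[of _ 0]) auto
  next
    case (Cons a w)
    have "0 \<notin> set w" using Cons.prems by auto
    from Cons.IH[OF this] obtain p p' q q'
      where *: "0 \<le> p" "0 \<le> p'" "0 \<le> q'" "q' \<le> q" "p' + q' \<le> p + q"
      "\<And>y. y \<in> {0..1} \<Longrightarrow> cf_den w y = q + q' * y \<and> cf_map w y * cf_den w y = p + p' * y"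
      by blast
    have a: "real a \<ge> 1" using Cons.prems by auto
    have "(real a - 1) * q' \<le> (real a - 1) * q"
      using * a by (intro mult_left_mono) auto
    then have le: "p' + real a * q' \<le> p + real a * q"
      using *(5) by (simp add: algebra_simps)
    show ?case
    proof (rule exI[of _ q], rule exI[of _ q'], rule exI[of _ "p + real a * q"],
        rule exI[of _ "p' + real a * q'"], intro conjI ballI)
      fix y :: real assume y: "y \<in> {0..1}"
      have pos: "0 < real a + cf_map w y"
        using a cf_map_unit[of w y] Cons.prems y by auto
      show "cf_den (a # w) y = p + real a * q + (p' + real a * q') * y"
      proof -
        have "cf_den (a # w) y = real a * cf_den w y + cf_map w y * cf_den w y"
          by (simp add: algebra_simps)
        also have "\<dots> = real a * (q + q' * y) + (p + p' * y)"
          using *(6)[OF y] by metis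
        finally show ?thesis by (simp add: algebra_simps)
      qed
      show "cf_map (a # w) y * cf_den (a # w) y = q + q' * y"
        using *(6)[OF y] pos by simp
    qed (use * le a in auto)
  qed
  then show ?thesis by blast
qed

text \<open>The denominator is q + q' y with 0 \<le> q' \<le> q, hence between q and 2 q on the unit
  interval. The 4 in \<open>measure_cylinder_preimage\<close> is the square of this 2.\<close>

lemma cf_den_distortion:
  assumes "0 \<notin> set w" "u \<in> {0..1}" "v \<in> {0..1}"
  shows "cf_den w u \<le> 2 * cf_den w v"
proof -
  obtain q q' where *: "0 \<le> q'" "q' \<le> q" "\<And>y. y \<in> {0..1} \<Longrightarrow> cf_den w y = q + q' * y"
    using cf_den_affine[OF assms(1)] by auto
  have "q' * u \<le> q' * 1" using * assms by (intro mult_left_mono) auto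
  moreover have "0 \<le> q' * v" using * assms by auto
  moreover have "0 \<le> q" using * by linarith
  ultimately show ?thesis using *(2) *(3)[OF assms(2)] *(3)[OF assms(3)] by linarith
qed

text \<open>An exact form of the mean value theorem: a Moebius map of determinant 1 or -1 divides a
  difference by the denominators at both ends.\<close>

lemma cf_map_diff:
  assumes "0 \<notin> set w" "u \<in> {0..1}" "v \<in> {0..1}"
  shows "\<bar>cf_map w u - cf_map w v\<bar> = \<bar>u - v\<bar> / (cf_den w u * cf_den w v)"
  using assms(1)
proof (induction w)
  case (Cons a w)
  have u: "0 < real a + cf_map w u" and v: "0 < real a + cf_map w v"
    using cf_map_unit[of w u] cf_map_unit[of w v] Cons.prems assms by auto
  then have "1 / (real a + cf_map w u) - 1 / (real a + cf_map w v) =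
      (cf_map w v - cf_map w u) / ((real a + cf_map w u) * (real a + cf_map w v))"
    by (simp add: field_simps)
  then have "\<bar>1 / (real a + cf_map w u) - 1 / (real a + cf_map w v)\<bar> =
      \<bar>cf_map w u - cf_map w v\<bar> / ((real a + cf_map w u) * (real a + cf_map w v))"
    using u v by (simp add: abs_mult abs_minus_commute)
  then show ?case
    using Cons by (simp add: mult_ac)
qed auto

text \<open>The induction takes two digits at a time: a single digit 1 before a small tail
  contributes a factor close to 1, but two digits a, b contribute (a + 1/s) s = a s + 1 \<ge> 2 with
  s = b + \<open>cf_map w y\<close>.\<close>

lemma cf_den_growth: "0 \<notin> set w \<Longrightarrow> y \<in> {0..1} \<Longrightarrow> 2 ^ (length w div 2) \<le> cf_den w y"
proof (induction w rule: induct_list012)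
  case (2 a)
  then show ?case by auto
next
  case (3 a b w)
  let ?s = "real b + cf_map w y"
  have s: "1 \<le> ?s" and a: "1 \<le> real a"
    using cf_map_unit[of w y] 3 by auto
  have "1 * 1 \<le> real a * ?s"
    using s a by (intro mult_mono) auto
  then have "2 * 2 ^ (length w div 2) \<le> (real a * ?s + 1) * cf_den w y"
    using 3 by (intro mult_mono) auto
  moreover have "(real a * ?s + 1) = (real a + 1 / ?s) * ?s"
    using s by (simp add: field_simps)
  ultimately show ?case
    by (simp add: mult.assoc)
qed auto

text \<open>The factor 2 makes up for the rounding in \<open>length w div 2\<close> at odd
  lengths.\<close>

lemma cf_den_sq_growth:
  assumes "0 \<notin> set w" "u \<in> {0..1}" "v \<in> {0..1}"
  shows "2 ^ length w \<le> 2 * (cf_den w u * cf_den w v)"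
proof -
  have "(2::real) ^ length w \<le> 2 ^ (1 + (length w div 2 + length w div 2))"
    by (intro power_increasing) auto
  also have "\<dots> = 2 * (2 ^ (length w div 2) * 2 ^ (length w div 2))"
    by (simp add: power_add)
  also have "\<dots> \<le> 2 * (cf_den w u * cf_den w v)"
    using assms cf_den_pos[of w] by (intro mult_left_mono mult_mono cf_den_growth order.trans[OF _ cf_den_pos[of w u]]) auto
  finally show ?thesis .
qed

lemma cf_map_contract:
  assumes "0 \<notin> set w" "u \<in> {0..1}" "v \<in> {0..1}"
  shows "\<bar>cf_map w u - cf_map w v\<bar> \<le> 2 * (1 / 2) ^ length w"
proof -
  have pos: "0 < cf_den w u * cf_den w v"
    using assms cf_den_pos[of w u] cf_den_pos[of w v] by auto
  have "\<bar>u - v\<bar> / (cf_den w u * cf_den w v) \<le> 1 / (cf_den w u * cf_den w v)"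
    using pos assms by (intro divide_right_mono) auto
  also have "\<dots> \<le> 1 / (2 ^ length w / 2)"
    using cf_den_sq_growth[OF assms] pos by (intro divide_left_mono) auto
  finally show ?thesis
    using assms by (simp add: cf_map_diff power_divide)
qed

lemma irr_unit: "x \<in> irr \<Longrightarrow> x \<in> {0..1}"
  by (auto simp: irr_def)

lemma cf_prefix_eq_imp_close:
  assumes "x \<in> irr" "y \<in> irr" "cf_prefix x n = cf_prefix y n"
  shows "\<bar>x - y\<bar> \<le> 2 * (1 / 2) ^ n"
  using cf_map_contract[OF cf_prefix_pos[OF assms(1), of n]
      irr_unit[OF gauss_map_funpow_irr[OF assms(1), of n]]
      irr_unit[OF gauss_map_funpow_irr[OF assms(2), of n]]]
    cf_map_prefix[OF assms(1), of n] cf_map_prefix[OF assms(2), of n]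
  by (simp add: assms(3))

section \<open>Lebesgue and Gauss measure\<close>

text \<open>Restriction to \<open>irr\<close> makes the laws for digits hold almost everywhere. As a
  measure on the whole line it has \<open>UNIV\<close> as its space, so preimages under
  \<open>gauss_map\<close> are taken as they are.\<close>

definition unit_lborel :: "real measure" where
  "unit_lborel = density lborel (indicator irr)"

lemma irr_borel [measurable]: "irr \<in> sets borel"
proof -
  have "(\<rat> :: real set) \<in> sets borel"
    using null_setsD2[OF countable_imp_null_set_lborel[OF countable_rat]] by simp
  then show ?thesis by (simp add: irr_def)
qed

lemma space_unit_lborel [simp]: "space unit_lborel = UNIV"
  by (simp add: unit_lborel_def)

lemma sets_unit_lborel [simp, measurable_cong]: "sets unit_lborel = sets borel"
  by (simp add: unit_lborel_def)

lemma AE_irr: "AE x in unit_lborel. x \<in> irr"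
  unfolding unit_lborel_def by (subst AE_density) (auto intro!: AE_I2 simp: indicator_def split: if_splits)

lemma nn_integral_unit_lborel:
  assumes [measurable]: "f \<in> borel_measurable borel"
  shows "(\<integral>\<^sup>+x. f x \<partial>unit_lborel) = (\<integral>\<^sup>+x. f x * indicator {0..1} x \<partial>lborel)"
proof -
  have "countable (\<rat> \<union> {0, 1} :: real set)"
    using countable_rat by auto
  then have null: "(\<rat> \<union> {0, 1} :: real set) \<in> null_sets lborel"
    by (rule countable_imp_null_set_lborel)
  have "(\<integral>\<^sup>+x. f x \<partial>unit_lborel) = (\<integral>\<^sup>+x. indicator irr x * f x \<partial>lborel)"
    unfolding unit_lborel_def by (subst nn_integral_density) auto
  also have "\<dots> = (\<integral>\<^sup>+x. f x * indicator {0..1} x \<partial>lborel)"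
    by (rule nn_integral_cong_AE, rule AE_I'[OF null])
       (auto simp: irr_def split: split_indicator)
  finally show ?thesis .
qed

lemma emeasure_unit_lborel:
  "A \<in> sets borel \<Longrightarrow> emeasure unit_lborel A = emeasure lborel (irr \<inter> A)"
  unfolding unit_lborel_def by (subst emeasure_density) (auto simp: indicator_inter_arith[symmetric])

lemma emeasure_unit_lborel_UNIV: "emeasure unit_lborel UNIV = 1"
  using nn_integral_unit_lborel[of "\<lambda>_. 1"] by simp

interpretation unit: prob_space unit_lborel
  by standard (simp add: emeasure_unit_lborel_UNIV)

lemma emeasure_unit_interval:
  assumes "u \<le> v"
  shows "emeasure unit_lborel {u..v} \<le> ennreal (v - u)"
proof -
  have "emeasure unit_lborel {u..v} \<le> emeasure lborel {u..v}"
    by (subst emeasure_unit_lborel) (auto intro!: emeasure_mono)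
  then show ?thesis using assms by simp
qed

lemma gauss_map_measurable [measurable]: "gauss_map \<in> borel_measurable borel"
  unfolding gauss_map_def[abs_def] by measurable

lemma funpow_gauss_measurable [measurable]: "gauss_map ^^ n \<in> borel_measurable borel"
  by (induction n) (auto simp: id_def comp_def)

lemma cf_digit_measurable [measurable]: "(\<lambda>x. cf_digit x n) \<in> measurable borel (count_space UNIV)"
  unfolding cf_digit_def[abs_def] by measurable

lemma cylinder_borel [measurable]: "cylinder w \<in> sets borel"
proof -
  have "cylinder w = irr \<inter> {x\<in>space borel. \<forall>j<length w. cf_digit x j = w ! j}"
    by (auto simp: cylinder_def)
  also have "\<dots> \<in> sets borel" by measurable
  finally show ?thesis .
qed

lemma cf_map_measurable [measurable]: "cf_map w \<in> borel_measurable borel"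
proof (induction w)
  case (Cons a w)
  have "cf_map (a # w) = (\<lambda>y. 1 / (real a + cf_map w y))" by auto
  then show ?case using Cons by simp
next
  case Nil
  have "cf_map [] = (\<lambda>y. y)" by auto
  then show ?case by simp
qed

lemma cf_den_measurable [measurable]: "cf_den w \<in> borel_measurable borel"
proof (induction w)
  case (Cons a w)
  have "cf_den (a # w) = (\<lambda>y. (real a + cf_map w y) * cf_den w y)" by auto
  then show ?case using Cons by simp
next
  case Nil
  have "cf_den [] = (\<lambda>y. 1)" by auto
  then show ?case by simp
qed

section \<open>Change of variables along inverse branches, and quasi-independence\<close>

lemma cf_digit_0_iff:
  assumes "0 < x" "a \<ge> 1"
  shows "cf_digit x 0 = a \<longleftrightarrow> 1 / (real a + 1) < x \<and> x \<le> 1 / real a"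
proof -
  have "cf_digit x 0 = a \<longleftrightarrow> \<lfloor>1 / x\<rfloor> = int a"
    using assms by (auto simp: cf_digit_def)
  also have "\<dots> \<longleftrightarrow> real a \<le> 1 / x \<and> 1 / x < real a + 1"
    by (auto simp: floor_eq_iff)
  also have "\<dots> \<longleftrightarrow> 1 / (real a + 1) < x \<and> x \<le> 1 / real a"
    using assms by (auto simp: field_simps)
  finally show ?thesis .
qed

lemma nn_integral_branch:
  fixes f :: "real \<Rightarrow> ennreal"
  assumes [measurable]: "f \<in> borel_measurable borel" and a: "a \<ge> 1"
  shows "(\<integral>\<^sup>+x. f x * indicator {x. cf_digit x 0 = a} x \<partial>unit_lborel) =
    (\<integral>\<^sup>+y. f (1 / (real a + y)) * ennreal (1 / (real a + y)\<^sup>2) \<partial>unit_lborel)"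
proof -
  \<comment> \<open>\<open>g\<close> is the branch 1 / (a + y) with y replaced by 1 - y: the
    substitution is made with an increasing map, and the reflection is undone afterwards.\<close>
  define g where "g = (\<lambda>y. 1 / (real a + 1 - y))"
  define g' where "g' = (\<lambda>y. 1 / (real a + 1 - y)\<^sup>2)"
  have [measurable]: "{x. cf_digit x 0 = a} \<in> sets borel"
    using measurable_sets[OF cf_digit_measurable, of "{a}" 0] by (simp add: vimage_def)
  have [simp]: "1 / real a \<le> 1"
    using a by simp
  \<comment> \<open>At 1 / (a + 1), an endpoint of the closed interval from \<open>g 0\<close> to
    \<open>g 1\<close>, the first digit is a + 1; the point 0 is outside the scope of
    \<open>cf_digit_0_iff\<close>.\<close>
  have null: "{0, 1 / (real a + 1)} \<in> null_sets lborel"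
    by (intro countable_imp_null_set_lborel) auto
  have "(\<integral>\<^sup>+x. f x * indicator {x. cf_digit x 0 = a} x \<partial>unit_lborel) =
      (\<integral>\<^sup>+x. f x * indicator {x. cf_digit x 0 = a} x * indicator {0..1} x \<partial>lborel)"
    by (rule nn_integral_unit_lborel) measurable
  also have "\<dots> = (\<integral>\<^sup>+x. f x * indicator {g 0..g 1} x \<partial>lborel)"
  proof (rule nn_integral_cong_AE, rule AE_I'[OF null], rule subsetI)
    fix x assume "x \<in> {x \<in> space lborel. \<not> f x * indicator {x. cf_digit x 0 = a} x * indicator {0..1} x
      = f x * indicator {g 0..g 1} x}"
    then have ne: "f x * indicator {x. cf_digit x 0 = a} x * indicator {0..1} x
      \<noteq> f x * indicator {g 0..g 1} x" by simp
    show "x \<in> {0, 1 / (real a + 1)}"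
    proof (rule ccontr)
      assume "x \<notin> {0, 1 / (real a + 1)}"
      then have "x \<noteq> 0" and x: "x \<noteq> 1 / (real a + 1)" by auto
      have "x \<in> {g 0..g 1} \<longleftrightarrow> 1 / (real a + 1) < x \<and> x \<le> 1 / real a"
        using x by (auto simp: g_def)
      moreover have "0 < 1 / (real a + 1)" by simp
      moreover have "x \<le> 1 / real a \<Longrightarrow> x \<le> 1"
        using \<open>1 / real a \<le> 1\<close> by linarith
      ultimately have "x \<in> {g 0..g 1} \<longleftrightarrow> x \<in> {x. cf_digit x 0 = a} \<and> x \<in> {0..1}"
        using cf_digit_0_iff[OF _ a, of x] \<open>x \<noteq> 0\<close> by (cases "x > 0") auto
      then show False using ne by (auto split: split_indicator_asm)
    qed
  qed
  also have "\<dots> = (\<integral>\<^sup>+y. f (g y) * g' y * indicator {0..1} y \<partial>lborel)"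
  proof (rule nn_integral_substitution_aux)
    fix y :: real assume "y \<in> {0..1}"
    then show "(g has_real_derivative g' y) (at y)"
      unfolding g_def g'_def using a
      by (auto intro!: derivative_eq_intros simp: power2_eq_square field_simps)
  qed (use a in \<open>auto simp: g'_def intro!: continuous_intros\<close>)
  also have "\<dots> = (\<integral>\<^sup>+y. f (g (1 + (-1) * y)) * g' (1 + (-1) * y) * indicator {0..1} (1 + (-1) * y) \<partial>lborel)"
    unfolding g_def g'_def by (subst nn_integral_real_affine[of _ "-1" 1]) auto
  also have "\<dots> = (\<integral>\<^sup>+y. f (1 / (real a + y)) * ennreal (1 / (real a + y)\<^sup>2) * indicator {0..1} y \<partial>lborel)"
    by (intro nn_integral_cong) (auto simp: g_def g'_def split: split_indicator)
  also have "\<dots> = (\<integral>\<^sup>+y. f (1 / (real a + y)) * ennreal (1 / (real a + y)\<^sup>2) \<partial>unit_lborel)"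
    by (rule nn_integral_unit_lborel[symmetric]) measurable
  finally show ?thesis .
qed

text \<open>One change of variables per digit; the recursion of \<open>cf_den\<close> is the chain
  rule for the resulting product of Jacobians.\<close>

lemma nn_integral_cylinder:
  fixes f :: "real \<Rightarrow> ennreal"
  assumes "f \<in> borel_measurable borel" and "0 \<notin> set w"
  shows "(\<integral>\<^sup>+x. f x * indicator (cylinder w) x \<partial>unit_lborel) =
    (\<integral>\<^sup>+y. f (cf_map w y) * ennreal (1 / (cf_den w y)\<^sup>2) \<partial>unit_lborel)"
  using assms
proof (induction w arbitrary: f)
  case Nil
  show ?case
    by (rule nn_integral_cong_AE) (use AE_irr in eventually_elim, auto)
next
  case (Cons a w)
  note [measurable] = Cons.prems(1)
  have a: "a \<ge> 1" using Cons.prems by auto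
  have "(\<integral>\<^sup>+x. f x * indicator (cylinder (a # w)) x \<partial>unit_lborel) =
      (\<integral>\<^sup>+x. f x * indicator (cylinder w) (gauss_map x) * indicator {x. cf_digit x 0 = a} x \<partial>unit_lborel)"
    by (rule nn_integral_cong_AE)
       (use AE_irr in eventually_elim, auto simp: cylinder_Cons split: split_indicator)
  also have "\<dots> = (\<integral>\<^sup>+y. f (1 / (real a + y)) * indicator (cylinder w) (gauss_map (1 / (real a + y)))
      * ennreal (1 / (real a + y)\<^sup>2) \<partial>unit_lborel)"
    by (rule nn_integral_branch) (use a in measurable)
  also have "\<dots> = (\<integral>\<^sup>+y. (f (1 / (real a + y)) * ennreal (1 / (real a + y)\<^sup>2)) * indicator (cylinder w) y \<partial>unit_lborel)"
    by (rule nn_integral_cong_AE, use AE_irr in eventually_elim)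
       (use a in \<open>auto simp: gauss_branch(1) irr_def mult_ac\<close>)
  also have "\<dots> = (\<integral>\<^sup>+y. f (1 / (real a + cf_map w y)) * ennreal (1 / (real a + cf_map w y)\<^sup>2)
      * ennreal (1 / (cf_den w y)\<^sup>2) \<partial>unit_lborel)"
    using Cons.prems by (intro Cons.IH) auto
  also have "\<dots> = (\<integral>\<^sup>+y. f (cf_map (a # w) y) * ennreal (1 / (cf_den (a # w) y)\<^sup>2) \<partial>unit_lborel)"
    by (intro nn_integral_cong) (simp add: mult.assoc ennreal_mult[symmetric] power_mult_distrib)
  finally show ?case .
qed

lemma emeasure_cylinder_preimage:
  assumes [measurable]: "E \<in> sets borel" and w: "0 \<notin> set w"
  shows "emeasure unit_lborel (cylinder w \<inter> (gauss_map ^^ length w) -` E) =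
    (\<integral>\<^sup>+y. ennreal (1 / (cf_den w y)\<^sup>2) * indicator E y \<partial>unit_lborel)"
proof -
  let ?n = "length w"
  have "(gauss_map ^^ ?n) -` E \<in> sets borel"
    using measurable_sets[OF funpow_gauss_measurable \<open>E \<in> sets borel\<close>, of ?n] by simp
  then have "emeasure unit_lborel (cylinder w \<inter> (gauss_map ^^ ?n) -` E) =
      (\<integral>\<^sup>+x. indicator (cylinder w \<inter> (gauss_map ^^ ?n) -` E) x \<partial>unit_lborel)"
    by (intro nn_integral_indicator[symmetric]) simp
  also have "\<dots> = (\<integral>\<^sup>+x. indicator E ((gauss_map ^^ ?n) x) * indicator (cylinder w) x \<partial>unit_lborel)"
    by (intro nn_integral_cong) (auto split: split_indicator)
  also have "\<dots> = (\<integral>\<^sup>+y. indicator E ((gauss_map ^^ ?n) (cf_map w y)) * ennreal (1 / (cf_den w y)\<^sup>2) \<partial>unit_lborel)"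
    by (rule nn_integral_cylinder) (use w in measurable)
  also have "\<dots> = (\<integral>\<^sup>+y. ennreal (1 / (cf_den w y)\<^sup>2) * indicator E y \<partial>unit_lborel)"
    by (rule nn_integral_cong_AE, use AE_irr in eventually_elim)
       (use w in \<open>auto simp: funpow_cf_map split: split_indicator\<close>)
  finally show ?thesis .
qed

lemma funpow_gauss_vimage [measurable]:
  "E \<in> sets borel \<Longrightarrow> (gauss_map ^^ n) -` E \<in> sets borel"
  using measurable_sets[OF funpow_gauss_measurable, of E n] by simp

lemma measure_cylinder_preimage_bounds:
  assumes [measurable]: "E \<in> sets borel" and w: "0 \<notin> set w"
    and lo: "\<And>y. y \<in> {0..1} \<Longrightarrow> l \<le> 1 / (cf_den w y)\<^sup>2"
    and up: "\<And>y. y \<in> {0..1} \<Longrightarrow> 1 / (cf_den w y)\<^sup>2 \<le> b" and l: "0 \<le> l"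
  shows "l * measure unit_lborel E \<le> measure unit_lborel (cylinder w \<inter> (gauss_map ^^ length w) -` E)"
    and "measure unit_lborel (cylinder w \<inter> (gauss_map ^^ length w) -` E) \<le> b * measure unit_lborel E"
proof -
  have b: "0 \<le> b"
    using lo[of 0] up[of 0] l by auto
  have AE_unit: "AE y in unit_lborel. y \<in> {0..1}"
    using AE_irr by eventually_elim (rule irr_unit)
  have "(\<integral>\<^sup>+y. ennreal l * indicator E y \<partial>unit_lborel) \<le>
      emeasure unit_lborel (cylinder w \<inter> (gauss_map ^^ length w) -` E)"
    unfolding emeasure_cylinder_preimage[OF assms(1) w]
    by (rule nn_integral_mono_AE, use AE_unit in eventually_elim)
       (auto intro!: mult_right_mono ennreal_leI lo)
  then have "ennreal (l * measure unit_lborel E) \<le>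
      ennreal (measure unit_lborel (cylinder w \<inter> (gauss_map ^^ length w) -` E))"
    using l by (simp add: unit.emeasure_eq_measure ennreal_mult nn_integral_cmult_indicator)
  then show "l * measure unit_lborel E \<le> measure unit_lborel (cylinder w \<inter> (gauss_map ^^ length w) -` E)"
    by (simp add: ennreal_le_iff)
  have "emeasure unit_lborel (cylinder w \<inter> (gauss_map ^^ length w) -` E) \<le>
      (\<integral>\<^sup>+y. ennreal b * indicator E y \<partial>unit_lborel)"
    unfolding emeasure_cylinder_preimage[OF assms(1) w]
    by (rule nn_integral_mono_AE, use AE_unit in eventually_elim)
       (auto intro!: mult_right_mono ennreal_leI up)
  then have "ennreal (measure unit_lborel (cylinder w \<inter> (gauss_map ^^ length w) -` E)) \<le>
      ennreal (b * measure unit_lborel E)"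
    using b by (simp add: unit.emeasure_eq_measure ennreal_mult nn_integral_cmult_indicator)
  then show "measure unit_lborel (cylinder w \<inter> (gauss_map ^^ length w) -` E) \<le> b * measure unit_lborel E"
    using b by (simp add: ennreal_le_iff)
qed

lemma measure_cylinder_bounds:
  assumes w: "0 \<notin> set w"
    and lo: "\<And>y. y \<in> {0..1} \<Longrightarrow> l \<le> 1 / (cf_den w y)\<^sup>2"
    and up: "\<And>y. y \<in> {0..1} \<Longrightarrow> 1 / (cf_den w y)\<^sup>2 \<le> b" and l: "0 \<le> l"
  shows "l \<le> measure unit_lborel (cylinder w)" "measure unit_lborel (cylinder w) \<le> b"
  using measure_cylinder_preimage_bounds[of UNIV w l b, OF _ w lo up l] unit.prob_space by simp_all

lemma measure_cylinder_le_power: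
  assumes w: "0 \<notin> set w"
  shows "measure unit_lborel (cylinder w) \<le> 2 * (1 / 2) ^ length w"
proof (rule measure_cylinder_bounds(2)[OF w, of 0])
  fix y :: real assume y: "y \<in> {0..1}"
  have "2 ^ length w / 2 \<le> (cf_den w y)\<^sup>2"
    using cf_den_sq_growth[OF w y y] by (simp add: power2_eq_square)
  then have "1 / (cf_den w y)\<^sup>2 \<le> 1 / (2 ^ length w / 2)"
    using cf_den_pos[OF w y] by (intro divide_left_mono) auto
  then show "1 / (cf_den w y)\<^sup>2 \<le> 2 * (1 / 2) ^ length w"
    by (simp add: power_divide)
qed auto

lemma prod_list_pos_nat: "0 \<notin> set w \<Longrightarrow> 0 < (\<Prod>a\<leftarrow>w. real a)"
  by (induction w) auto

lemma measure_cylinder_le_prod: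
  assumes w: "0 \<notin> set w"
  shows "measure unit_lborel (cylinder w) \<le> 1 / (\<Prod>a\<leftarrow>w. real a)\<^sup>2"
proof (rule measure_cylinder_bounds(2)[OF w, of 0])
  fix y :: real assume y: "y \<in> {0..1}"
  show "1 / (cf_den w y)\<^sup>2 \<le> 1 / (\<Prod>a\<leftarrow>w. real a)\<^sup>2"
    using cf_den_ge_prod[OF w y] prod_list_pos_nat[OF w] cf_den_pos[OF w y]
    by (intro divide_left_mono power_mono) auto
qed auto

lemma measure_cylinder_ge_prod:
  assumes w: "0 \<notin> set w"
  shows "1 / (\<Prod>a\<leftarrow>w. real a + 1)\<^sup>2 \<le> measure unit_lborel (cylinder w)"
proof (rule measure_cylinder_bounds(1)[OF w, of _ 1])
  fix y :: real assume y: "y \<in> {0..1}"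
  show "1 / (\<Prod>a\<leftarrow>w. real a + 1)\<^sup>2 \<le> 1 / (cf_den w y)\<^sup>2"
    using cf_den_le_prod[OF w y] cf_den_pos[OF w y]
    by (intro divide_left_mono power_mono) auto
  show "1 / (cf_den w y)\<^sup>2 \<le> 1"
    using cf_den_pos[OF w y] by (simp add: divide_le_eq_1 one_le_power)
qed auto

text \<open>Up to normalisation the tail of a random point of the cylinder has density 1 /
  \<open>(cf_den w y)\<^sup>2\<close>. By \<open>cf_den_distortion\<close> its values differ by at
  most the factor 4, hence also from its mean, which is the measure of the cylinder. So prefix and
  tail are independent up to a factor 4.\<close>

lemma measure_cylinder_preimage:
  assumes [measurable]: "E \<in> sets borel" and w: "0 \<notin> set w"
  shows "measure unit_lborel (cylinder w) * measure unit_lborel E / 4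
      \<le> measure unit_lborel (cylinder w \<inter> (gauss_map ^^ length w) -` E)"
    and "measure unit_lborel (cylinder w \<inter> (gauss_map ^^ length w) -` E)
      \<le> 4 * measure unit_lborel (cylinder w) * measure unit_lborel E"
proof -
  let ?c = "measure unit_lborel (cylinder w)"
  define r where "r y = 1 / (cf_den w y)\<^sup>2" for y
  have sq: "r y \<le> 4 * r z" if "y \<in> {0..1}" "z \<in> {0..1}" for y z
  proof -
    have "(cf_den w z)\<^sup>2 \<le> (2 * cf_den w y)\<^sup>2"
      using cf_den_distortion[OF w that(2) that(1)] cf_den_pos[OF w that(2)] by (intro power_mono) auto
    then have "4 / (2 * cf_den w y)\<^sup>2 \<le> 4 / (cf_den w z)\<^sup>2"
      using cf_den_pos[OF w that(1)] cf_den_pos[OF w that(2)] by (intro divide_left_mono) auto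
    then show ?thesis by (simp add: power_mult_distrib r_def)
  qed
  have up: "?c / 4 \<le> r z" if "z \<in> {0..1}" for z
  proof -
    have "?c \<le> 4 * r z"
    proof (rule measure_cylinder_bounds(2)[OF w, of 0])
      fix y :: real assume y: "y \<in> {0..1}"
      show "1 / (cf_den w y)\<^sup>2 \<le> 4 * r z"
        using sq[OF y that] unfolding r_def[of y] .
    qed auto
    then show ?thesis by linarith
  qed
  have lo: "r z \<le> 4 * ?c" if "z \<in> {0..1}" for z
  proof -
    have "r z / 4 \<le> ?c"
    proof (rule measure_cylinder_bounds(1)[OF w, of _ "4 * r z"])
      fix y :: real assume y: "y \<in> {0..1}"
      show "r z / 4 \<le> 1 / (cf_den w y)\<^sup>2" "1 / (cf_den w y)\<^sup>2 \<le> 4 * r z"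
        using sq[OF that y] sq[OF y that] unfolding r_def[of y, symmetric] by linarith+
    next
      show "0 \<le> r z / 4" by (simp add: r_def)
    qed
    then show ?thesis by linarith
  qed
  note bounds = measure_cylinder_preimage_bounds[OF assms, of "?c / 4" "4 * ?c",
      OF up[unfolded r_def] lo[unfolded r_def]]
  have "?c / 4 * measure unit_lborel E \<le> measure unit_lborel (cylinder w \<inter> (gauss_map ^^ length w) -` E)"
    by (rule bounds(1)) auto
  moreover have "measure unit_lborel (cylinder w \<inter> (gauss_map ^^ length w) -` E) \<le> (4 * ?c) * measure unit_lborel E"
    by (rule bounds(2)) auto
  ultimately show "?c * measure unit_lborel E / 4
      \<le> measure unit_lborel (cylinder w \<inter> (gauss_map ^^ length w) -` E)"
    and "measure unit_lborel (cylinder w \<inter> (gauss_map ^^ length w) -` E) \<le> 4 * ?c * measure unit_lborel E"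
    by (simp_all add: mult_ac)
qed

text \<open>Total mass \<open>ln 2\<close> instead of \<open>1\<close>.\<close>

definition gauss_measure :: "real measure" where
  "gauss_measure = density unit_lborel (\<lambda>x. ennreal (1 / (1 + x)))"

lemma space_gauss_measure [simp]: "space gauss_measure = UNIV"
  by (simp add: gauss_measure_def)

lemma sets_gauss_measure [simp, measurable_cong]: "sets gauss_measure = sets borel"
  by (simp add: gauss_measure_def)

lemma nn_integral_gauss_measure:
  assumes [measurable]: "f \<in> borel_measurable borel"
  shows "(\<integral>\<^sup>+x. f x \<partial>gauss_measure) = (\<integral>\<^sup>+x. ennreal (1 / (1 + x)) * f x \<partial>unit_lborel)"
  unfolding gauss_measure_def by (subst nn_integral_density) auto

text \<open>On the branch x = 1 / (a + y) the density 1 / (1 + x) times the Jacobian 1 / (a + y)^2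
  equals 1 / ((a + y) (a + y + 1)), and the sum of these over a \<ge> 1 telescopes to 1 / (1 +
  y).\<close>

lemma gauss_measure_invariant:
  fixes f :: "real \<Rightarrow> ennreal"
  assumes [measurable]: "f \<in> borel_measurable borel"
  shows "(\<integral>\<^sup>+x. f (gauss_map x) \<partial>gauss_measure) = (\<integral>\<^sup>+x. f x \<partial>gauss_measure)"
proof -
  have [measurable]: "{x. cf_digit x 0 = a} \<in> sets borel" for a
    using measurable_sets[OF cf_digit_measurable, of "{a}" 0] by (simp add: vimage_def)
  let ?r = "\<lambda>x::real. ennreal (1 / (1 + x))"
  have one: "(\<Sum>a. indicator {x. cf_digit x 0 = Suc a} x) = (1::ennreal)" if x: "x \<in> irr" for x
  proof -
    obtain a where a: "cf_digit x 0 = Suc a"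
      using cf_digit_pos[OF x, of 0] by (cases "cf_digit x 0") auto
    have "(\<Sum>a. indicator {x. cf_digit x 0 = Suc a} x) = (\<Sum>b\<in>{a}. indicator {x. cf_digit x 0 = Suc b} x :: ennreal)"
      by (rule suminf_finite) (auto simp: a)
    then show ?thesis by (simp add: a)
  qed
  have tele: "(\<Sum>a. ennreal (1 / ((real (Suc a) + y) * (real (Suc a) + y + 1)))) = ?r y" if "y \<in> irr" for y
  proof -
    have y: "0 < y" using that by (auto simp: irr_def)
    have "(\<lambda>a. 1 / (real a + (1 + y))) \<longlonglongrightarrow> 0"
      by real_asymp
    then have "(\<lambda>a. 1 / (real a + (1 + y)) - 1 / (real (Suc a) + (1 + y))) sums (1 / (real 0 + (1 + y)) - 0)"
      by (rule telescope_sums')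
    moreover have "1 / (real a + (1 + y)) - 1 / (real (Suc a) + (1 + y)) =
        1 / ((real (Suc a) + y) * (real (Suc a) + y + 1))" for a
      using y by (simp add: field_simps)
    ultimately show ?thesis
      using y by (intro suminf_ennreal_eq) auto
  qed
  have "(\<integral>\<^sup>+x. f (gauss_map x) \<partial>gauss_measure) = (\<integral>\<^sup>+x. ?r x * f (gauss_map x) \<partial>unit_lborel)"
    by (rule nn_integral_gauss_measure) measurable
  also have "\<dots> = (\<integral>\<^sup>+x. (\<Sum>a. ?r x * f (gauss_map x) * indicator {x. cf_digit x 0 = Suc a} x) \<partial>unit_lborel)"
    by (rule nn_integral_cong_AE, use AE_irr in eventually_elim) (simp add: one)
  also have "\<dots> = (\<Sum>a. \<integral>\<^sup>+x. ?r x * f (gauss_map x) * indicator {x. cf_digit x 0 = Suc a} x \<partial>unit_lborel)"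
    by (rule nn_integral_suminf) measurable
  also have "\<dots> = (\<Sum>a. \<integral>\<^sup>+y. ennreal (1 / ((real (Suc a) + y) * (real (Suc a) + y + 1))) * f y \<partial>unit_lborel)"
  proof (rule suminf_cong)
    fix a
    have "(\<integral>\<^sup>+x. ?r x * f (gauss_map x) * indicator {x. cf_digit x 0 = Suc a} x \<partial>unit_lborel) =
      (\<integral>\<^sup>+y. ?r (1 / (real (Suc a) + y)) * f (gauss_map (1 / (real (Suc a) + y))) * ennreal (1 / (real (Suc a) + y)\<^sup>2) \<partial>unit_lborel)"
      by (rule nn_integral_branch) measurable
    also have "\<dots> = (\<integral>\<^sup>+y. ennreal (1 / ((real (Suc a) + y) * (real (Suc a) + y + 1))) * f y \<partial>unit_lborel)"
    proof (rule nn_integral_cong_AE, use AE_irr in eventually_elim)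
      case (elim y)
      then have y: "0 < y" "y < 1" by (auto simp: irr_def)
      have "1 / (1 + 1 / (real (Suc a) + y)) * (1 / (real (Suc a) + y)\<^sup>2) =
          1 / ((real (Suc a) + y) * (real (Suc a) + y + 1))"
      proof -
        define s where "s = real (Suc a) + y"
        have "0 < s" using y by (simp add: s_def)
        then have "1 / (1 + 1 / s) * (1 / s\<^sup>2) = 1 / (s * (s + 1))"
          by (simp add: field_simps power2_eq_square)
        then show ?thesis by (simp add: s_def)
      qed
      then have r: "?r (1 / (real (Suc a) + y)) * ennreal (1 / (real (Suc a) + y)\<^sup>2) =
          ennreal (1 / ((real (Suc a) + y) * (real (Suc a) + y + 1)))"
        using y by (subst ennreal_mult[symmetric]) auto
      have g: "gauss_map (1 / (real (Suc a) + y)) = y"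
        using y by (intro gauss_branch) auto
      have swap: "A * B * C = A * C * B" for A B C :: ennreal
        by (simp add: mult_ac)
      show ?case
        unfolding g by (subst swap) (simp only: r)
    qed
    finally show "(\<integral>\<^sup>+x. ?r x * f (gauss_map x) * indicator {x. cf_digit x 0 = Suc a} x \<partial>unit_lborel) =
      (\<integral>\<^sup>+y. ennreal (1 / ((real (Suc a) + y) * (real (Suc a) + y + 1))) * f y \<partial>unit_lborel)" .
  qed
  also have "\<dots> = (\<integral>\<^sup>+y. (\<Sum>a. ennreal (1 / ((real (Suc a) + y) * (real (Suc a) + y + 1))) * f y) \<partial>unit_lborel)"
    by (rule nn_integral_suminf[symmetric]) measurable
  also have "\<dots> = (\<integral>\<^sup>+y. ?r y * f y \<partial>unit_lborel)"
    by (rule nn_integral_cong_AE, use AE_irr in eventually_elim)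
       (simp only: ennreal_suminf_multc tele)
  also have "\<dots> = (\<integral>\<^sup>+x. f x \<partial>gauss_measure)"
    by (rule nn_integral_gauss_measure[symmetric]) measurable
  finally show ?thesis .
qed

lemma gauss_measure_invariant_funpow:
  fixes f :: "real \<Rightarrow> ennreal"
  assumes "f \<in> borel_measurable borel"
  shows "(\<integral>\<^sup>+x. f ((gauss_map ^^ n) x) \<partial>gauss_measure) = (\<integral>\<^sup>+x. f x \<partial>gauss_measure)"
  using assms
proof (induction n arbitrary: f)
  case (Suc n)
  then show ?case
    using Suc.IH[of "\<lambda>x. f (gauss_map x)"] gauss_measure_invariant[of f] by simp
qed simp

lemma emeasure_gauss_measure_le:
  assumes [measurable]: "E \<in> sets borel"
  shows "emeasure gauss_measure E \<le> emeasure unit_lborel E"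
    and "emeasure unit_lborel E \<le> 2 * emeasure gauss_measure E"
proof -
  have eq: "emeasure gauss_measure E = (\<integral>\<^sup>+x. ennreal (1 / (1 + x)) * indicator E x \<partial>unit_lborel)"
    using nn_integral_gauss_measure[of "indicator E"] by simp
  have "(\<integral>\<^sup>+x. ennreal (1 / (1 + x)) * indicator E x \<partial>unit_lborel) \<le> (\<integral>\<^sup>+x. indicator E x \<partial>unit_lborel)"
    by (rule nn_integral_mono_AE, use AE_irr in eventually_elim)
       (auto simp: irr_def split: split_indicator)
  then show "emeasure gauss_measure E \<le> emeasure unit_lborel E"
    using eq by simp
  have "(\<integral>\<^sup>+x. indicator E x \<partial>unit_lborel) \<le> (\<integral>\<^sup>+x. 2 * (ennreal (1 / (1 + x)) * indicator E x) \<partial>unit_lborel)"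
  proof (rule nn_integral_mono_AE, use AE_irr in eventually_elim)
    case (elim x)
    then have "1 \<le> 2 * (1 / (1 + x))" by (auto simp: irr_def field_simps)
    then have "ennreal 1 \<le> ennreal (2 * (1 / (1 + x)))" by (rule ennreal_leI)
    also have "\<dots> = 2 * ennreal (1 / (1 + x))"
      using elim by (subst ennreal_mult) (auto simp: irr_def)
    finally show ?case by (auto split: split_indicator)
  qed
  then show "emeasure unit_lborel E \<le> 2 * emeasure gauss_measure E"
    using eq by (simp add: nn_integral_cmult)
qed

text \<open>The Gauss density lies between 1/2 and 1 on the unit interval, so invariance of
  \<open>gauss_measure\<close> carries over to Lebesgue measure at the price of a factor 2 that is
  uniform in \<open>n\<close>.\<close>

lemma measure_funpow_vimage:
  assumes [measurable]: "E \<in> sets borel"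
  shows "measure unit_lborel ((gauss_map ^^ n) -` E) \<le> 2 * measure unit_lborel E"
    and "measure unit_lborel E / 2 \<le> measure unit_lborel ((gauss_map ^^ n) -` E)"
proof -
  have inv: "emeasure gauss_measure ((gauss_map ^^ n) -` E) = emeasure gauss_measure E"
    using gauss_measure_invariant_funpow[of "indicator E" n]
    by (simp add: indicator_vimage[unfolded comp_def, symmetric] nn_integral_indicator)
  have "emeasure unit_lborel ((gauss_map ^^ n) -` E) \<le> 2 * emeasure gauss_measure ((gauss_map ^^ n) -` E)"
    by (rule emeasure_gauss_measure_le) measurable
  also have "\<dots> \<le> 2 * emeasure unit_lborel E"
    unfolding inv by (intro mult_left_mono emeasure_gauss_measure_le) auto
  finally have "ennreal (measure unit_lborel ((gauss_map ^^ n) -` E)) \<le> ennreal (2 * measure unit_lborel E)"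
    by (simp add: unit.emeasure_eq_measure ennreal_mult nn_integral_cmult_indicator)
  then show "measure unit_lborel ((gauss_map ^^ n) -` E) \<le> 2 * measure unit_lborel E"
    by (simp add: ennreal_le_iff)
  have "emeasure unit_lborel E \<le> 2 * emeasure gauss_measure ((gauss_map ^^ n) -` E)"
    unfolding inv by (rule emeasure_gauss_measure_le) measurable
  also have "\<dots> \<le> 2 * emeasure unit_lborel ((gauss_map ^^ n) -` E)"
    by (intro mult_left_mono emeasure_gauss_measure_le) auto
  finally have "ennreal (measure unit_lborel E) \<le> ennreal (2 * measure unit_lborel ((gauss_map ^^ n) -` E))"
    by (simp add: unit.emeasure_eq_measure ennreal_mult nn_integral_cmult_indicator)
  then show "measure unit_lborel E / 2 \<le> measure unit_lborel ((gauss_map ^^ n) -` E)"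
    by (simp add: ennreal_le_iff)
qed

section \<open>A zero-one law\<close>

text \<open>Within \<open>irr\<close> an open set is the increasing union of the sets
  \<open>V n\<close>, each a countable disjoint union of cylinders of order \<open>n\<close>,
  because the cylinders around a point shrink to it.\<close>

lemma cylinder_dense_open:
  assumes [measurable]: "W \<in> sets borel" and c: "0 \<le> c"
    and dens: "\<And>w. 0 \<notin> set w \<Longrightarrow>
      c * measure unit_lborel (cylinder w) \<le> measure unit_lborel (cylinder w \<inter> W)"
    and G: "open G"
  shows "c * measure unit_lborel G \<le> measure unit_lborel (G \<inter> W)"
proof -
  define S where "S n = {w. length w = n \<and> 0 \<notin> set w \<and> cylinder w \<subseteq> G}" for n
  define V where "V n = (\<Union>w\<in>S n. cylinder w)" for n
  have [measurable]: "G \<in> sets borel" using G by simp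
  have V_iff: "x \<in> V n \<longleftrightarrow> x \<in> irr \<and> cylinder (cf_prefix x n) \<subseteq> G" for x n
    by (auto simp: V_def S_def cylinder_iff cf_prefix_pos intro!: exI[of _ "cf_prefix x n"])
  have [measurable]: "V n \<in> sets borel" for n
    unfolding V_def by (intro sets.countable_UN') auto
  have disj: "disjoint_family_on cylinder (S n)" for n
    by (auto simp: disjoint_family_on_def S_def cylinder_iff)
  have le: "c * measure unit_lborel (V n) \<le> measure unit_lborel (V n \<inter> W)" for n
  proof -
    have "ennreal c * emeasure unit_lborel (V n) =
        (\<integral>\<^sup>+w. ennreal c * emeasure unit_lborel (cylinder w) \<partial>count_space (S n))"
      unfolding V_def using disj by (subst emeasure_UN_countable) (auto simp: nn_integral_cmult)
    also have "\<dots> \<le> (\<integral>\<^sup>+w. emeasure unit_lborel (cylinder w \<inter> W) \<partial>count_space (S n))"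
    proof (rule nn_integral_mono)
      fix w assume "w \<in> space (count_space (S n))"
      then have "0 \<notin> set w" by (auto simp: S_def)
      from ennreal_leI[OF dens[OF this]]
      show "ennreal c * emeasure unit_lborel (cylinder w) \<le> emeasure unit_lborel (cylinder w \<inter> W)"
        using c by (simp add: unit.emeasure_eq_measure ennreal_mult)
    qed
    also have "\<dots> = emeasure unit_lborel (\<Union>w\<in>S n. cylinder w \<inter> W)"
      using disj by (intro emeasure_UN_countable[symmetric]) (auto simp: disjoint_family_on_def)
    also have "(\<Union>w\<in>S n. cylinder w \<inter> W) = V n \<inter> W"
      by (auto simp: V_def)
    finally have "ennreal (c * measure unit_lborel (V n)) \<le> ennreal (measure unit_lborel (V n \<inter> W))"
      using c by (simp add: unit.emeasure_eq_measure ennreal_mult)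
    then show ?thesis by (simp add: ennreal_le_iff)
  qed
  have inc: "incseq V"
  proof (rule incseq_SucI, rule subsetI)
    fix n x assume "x \<in> V n"
    moreover have "cylinder (cf_prefix x (Suc n)) \<subseteq> cylinder (cf_prefix x n)"
      by (auto simp: cylinder_def)
    ultimately show "x \<in> V (Suc n)" by (auto simp: V_iff)
  qed
  have un: "(\<Union>n. V n) = irr \<inter> G"
  proof (intro equalityI subsetI)
    fix x assume x: "x \<in> irr \<inter> G"
    then obtain e where e: "e > 0" "ball x e \<subseteq> G"
      using G by (meson IntD2 open_contains_ball)
    obtain n where n: "(1 / 2 :: real) ^ n < e / 2"
      using real_arch_pow_inv[of "e / 2" "1 / 2"] e by auto
    have "cylinder (cf_prefix x n) \<subseteq> ball x e"
    proof
      fix y assume y: "y \<in> cylinder (cf_prefix x n)"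
      then have "\<bar>x - y\<bar> \<le> 2 * (1 / 2) ^ n"
        using x by (intro cf_prefix_eq_imp_close) (auto simp: cylinder_iff)
      then show "y \<in> ball x e" using n by (simp add: dist_real_def)
    qed
    then show "x \<in> (\<Union>n. V n)" using x e by (auto simp: V_iff)
  next
    fix x assume "x \<in> (\<Union>n. V n)"
    then obtain n where "x \<in> irr" "cylinder (cf_prefix x n) \<subseteq> G" by (auto simp: V_iff)
    moreover have "x \<in> cylinder (cf_prefix x n)"
      using \<open>x \<in> irr\<close> by (auto simp: cylinder_iff)
    ultimately show "x \<in> irr \<inter> G" by auto
  qed
  have "(\<lambda>n. c * measure unit_lborel (V n)) \<longlonglongrightarrow> c * measure unit_lborel (irr \<inter> G)"
    unfolding un[symmetric]
    by (intro tendsto_mult_left unit.finite_Lim_measure_incseq inc) auto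
  moreover have "(\<lambda>n. measure unit_lborel (V n \<inter> W)) \<longlonglongrightarrow> measure unit_lborel (\<Union>n. V n \<inter> W)"
    using inc by (intro unit.finite_Lim_measure_incseq) (auto simp: incseq_def)
  ultimately have "c * measure unit_lborel (irr \<inter> G) \<le> measure unit_lborel (\<Union>n. V n \<inter> W)"
    by (rule LIMSEQ_le) (intro exI[of _ 0] allI impI le)
  also have "(\<Union>n. V n \<inter> W) = irr \<inter> (G \<inter> W)"
    unfolding Int_assoc[symmetric] un[symmetric] by auto
  also have "measure unit_lborel (irr \<inter> (G \<inter> W)) = measure unit_lborel (G \<inter> W)"
    by (rule measure_eq_AE, use AE_irr in eventually_elim) auto
  also have "measure unit_lborel (irr \<inter> G) = measure unit_lborel G"
    by (rule measure_eq_AE, use AE_irr in eventually_elim) auto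
  finally show ?thesis .
qed

text \<open>Takes the place of the density theorem. If the complement of \<open>W\<close> had
  measure m > 0, outer regularity would give an open \<open>V\<close> around it with excess less
  than c m; but the excess is \<open>V \<inter> W\<close>, which has measure at least c times that
  of \<open>V\<close>, hence at least c m.\<close>

lemma cylinder_dense_full:
  assumes [measurable]: "W \<in> sets borel" and c: "0 < c"
    and dens: "\<And>w. 0 \<notin> set w \<Longrightarrow>
      c * measure unit_lborel (cylinder w) \<le> measure unit_lborel (cylinder w \<inter> W)"
  shows "measure unit_lborel W = 1"
proof -
  let ?m = "measure unit_lborel (- W)"
  have W: "- W \<in> sets borel" by measurable
  have "?m \<le> 0"
  proof (rule ccontr)
    assume "\<not> ?m \<le> 0"
    then have pos: "0 < c * ?m" using c by (intro mult_pos_pos) linarith+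
    have "emeasure unit_lborel (- W) < ennreal (?m + c * ?m)"
      using pos unfolding unit.emeasure_eq_measure ennreal_less_iff[OF measure_nonneg] by linarith
    moreover have "emeasure unit_lborel (- W) = (INF U \<in> {U. - W \<subseteq> U \<and> open U}. emeasure unit_lborel U)"
      by (rule outer_regular) (use W in auto)
    ultimately obtain V where V: "- W \<subseteq> V" "open V" "emeasure unit_lborel V < ennreal (?m + c * ?m)"
      by (auto simp: INF_less_iff)
    have [measurable]: "V \<in> sets borel" using V by simp
    have less: "measure unit_lborel V < ?m + c * ?m"
      using V(3) by (simp only: unit.emeasure_eq_measure ennreal_less_iff[OF measure_nonneg])
    have "c * ?m \<le> c * measure unit_lborel V"
      using c V by (intro mult_left_mono unit.finite_measure_mono) auto
    also have "\<dots> \<le> measure unit_lborel (V \<inter> W)"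
      by (rule cylinder_dense_open[OF assms(1) _ dens V(2)]) (use c in auto)
    also have "V \<inter> W = V - (- W)" by auto
    also have "measure unit_lborel (V - (- W)) = measure unit_lborel V - ?m"
      using V W by (intro unit.finite_measure_Diff) auto
    finally show False using less by linarith
  qed
  moreover have "?m = 1 - measure unit_lborel W"
    using unit.prob_compl[of W] by (simp add: Compl_eq_Diff_UNIV)
  ultimately show ?thesis
    using unit.prob_le_1[of W] by linarith
qed

text \<open>Whatever the first \<open>n\<close> digits are, the tail lies in \<open>E n\<close> with
  conditional probability at least \<open>\<delta> / 4\<close>, so \<open>W\<close> occupies that
  proportion of every cylinder.\<close>

lemma eventually_positive_full:
  assumes W: "W \<in> sets borel" and \<delta>: "0 < \<delta>"
    and E: "\<And>n. E n \<in> sets borel" "\<And>n. \<delta> \<le> measure unit_lborel (E n)"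
      "\<And>n x. x \<in> irr \<Longrightarrow> (gauss_map ^^ n) x \<in> E n \<Longrightarrow> x \<in> W"
  shows "measure unit_lborel W = 1"
proof (rule cylinder_dense_full[OF W, of "\<delta> / 4"])
  fix w :: "nat list" assume w: "0 \<notin> set w"
  let ?n = "length w"
  have "\<delta> / 4 * measure unit_lborel (cylinder w) \<le>
      measure unit_lborel (cylinder w) * measure unit_lborel (E ?n) / 4"
    using mult_left_mono[OF E(2)[of ?n] measure_nonneg[of unit_lborel "cylinder w"]] by (simp add: mult.commute)
  also have "\<dots> \<le> measure unit_lborel (cylinder w \<inter> (gauss_map ^^ ?n) -` E ?n)"
    by (rule measure_cylinder_preimage(1)[OF E(1) w])
  also have "\<dots> \<le> measure unit_lborel (cylinder w \<inter> W)"
    using E(3)[of _ ?n] W by (intro unit.finite_measure_mono) (auto simp: cylinder_iff)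
  finally show "\<delta> / 4 * measure unit_lborel (cylinder w) \<le> measure unit_lborel (cylinder w \<inter> W)" .
qed (use \<delta> in auto)

section \<open>The measure of the recurrent set\<close>

text \<open>Integrates \<open>2 c X - c\<^sup>2 X\<^sup>2 \<le> 1\<^bsub>X > 0\<^esub>\<close> for \<open>X = \<Sum>n\<in>I. 1\<^bsub>A n\<^esub>\<close> and \<open>c = 1 / (2 K S)\<close>.\<close>

lemma (in prob_space) prob_UN_ge_second_moment:
  assumes I: "finite I" and A: "\<And>n. n \<in> I \<Longrightarrow> A n \<in> events"
    and K: "0 < K" and S: "0 < S"
    and first: "S / 2 \<le> (\<Sum>n\<in>I. prob (A n))"
    and second: "(\<Sum>n\<in>I. \<Sum>m\<in>I. prob (A n \<inter> A m)) \<le> K * S\<^sup>2"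
  shows "1 / (4 * K) \<le> prob (\<Union>n\<in>I. A n)"
proof -
  define c where "c = 1 / (2 * K * S)"
  define X where "X x = (\<Sum>n\<in>I. indicator (A n) x :: real)" for x
  have c: "0 < c" using K S by (simp add: c_def)
  have sq: "(X x)\<^sup>2 = (\<Sum>n\<in>I. \<Sum>m\<in>I. indicator (A n \<inter> A m) x)" for x
    by (simp add: X_def power2_eq_square sum_product indicator_inter_arith)
  have int: "integrable M X"
    unfolding X_def using A by (intro Bochner_Integration.integrable_sum integrable_real_indicator) (auto simp: emeasure_eq_measure)
  have int2: "integrable M (\<lambda>x. (X x)\<^sup>2)"
    unfolding sq using A by (intro Bochner_Integration.integrable_sum integrable_real_indicator) (auto simp: emeasure_eq_measure)
  have EX: "expectation X = (\<Sum>n\<in>I. prob (A n))"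
    unfolding X_def using A
    by (subst Bochner_Integration.integral_sum) (auto intro!: integrable_real_indicator sum.cong simp: emeasure_eq_measure)
  have EX2: "expectation (\<lambda>x. (X x)\<^sup>2) = (\<Sum>n\<in>I. \<Sum>m\<in>I. prob (A n \<inter> A m))"
    unfolding sq using A
    by (subst Bochner_Integration.integral_sum, force intro!: Bochner_Integration.integrable_sum integrable_real_indicator simp: emeasure_eq_measure,
        intro sum.cong refl, subst Bochner_Integration.integral_sum)
       (auto intro!: integrable_real_indicator sum.cong simp: emeasure_eq_measure)
  have "1 / (4 * K) = 2 * c * (S / 2) - c\<^sup>2 * (K * S\<^sup>2)"
    using K S by (simp add: c_def field_simps power2_eq_square)
  also have "\<dots> \<le> 2 * c * expectation X - c\<^sup>2 * expectation (\<lambda>x. (X x)\<^sup>2)"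
    using first second c unfolding EX EX2 by (intro diff_mono mult_left_mono) auto
  also have "\<dots> = expectation (\<lambda>x. 2 * c * X x - c\<^sup>2 * (X x)\<^sup>2)"
    using int int2 by (subst Bochner_Integration.integral_diff) auto
  also have "\<dots> \<le> expectation (indicator (\<Union>n\<in>I. A n))"
  proof (rule integral_mono)
    show "integrable M (\<lambda>x. 2 * c * X x - c\<^sup>2 * (X x)\<^sup>2)"
      using int int2 by auto
    show "integrable M (indicator (\<Union>n\<in>I. A n) :: _ \<Rightarrow> real)"
      using A I by (intro integrable_real_indicator) (auto simp: emeasure_eq_measure)
    fix x assume "x \<in> space M"
    show "2 * c * X x - c\<^sup>2 * (X x)\<^sup>2 \<le> indicator (\<Union>n\<in>I. A n) x"
    proof (cases "x \<in> (\<Union>n\<in>I. A n)")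
      case True
      have "0 \<le> (1 - c * X x)\<^sup>2" by simp
      then show ?thesis using True by (simp add: power2_eq_square algebra_simps)
    next
      case False
      then have "X x = 0" by (auto simp: X_def)
      then show ?thesis by simp
    qed
  qed
  also have "\<dots> = prob (\<Union>n\<in>I. A n)"
    using A I by (simp add: sets.finite_UN Int_absorb2 sets.sets_into_space)
  finally show ?thesis .
qed

section \<open>Blocks, and their occurrences as preimages of cylinders\<close>

definition cf_block :: "(nat \<Rightarrow> nat) \<Rightarrow> nat \<Rightarrow> nat list" where
  "cf_block i m = map i [0..<Suc m]"

lemma length_cf_block [simp]: "length (cf_block i m) = Suc m"
  by (simp add: cf_block_def)

lemma cf_block_nth: "k \<le> m \<Longrightarrow> cf_block i m ! k = i k"
  by (simp add: cf_block_def del: upt_Suc)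

lemma cf_block_pos: "(\<And>n. 1 \<le> i n) \<Longrightarrow> 0 \<notin> set (cf_block i m)"
  unfolding cf_block_def by (metis One_nat_def imageE list.set_map not_one_le_zero)

lemma prod_list_cf_block: "(\<Prod>a\<leftarrow>cf_block i m. f a) = (\<Prod>j\<le>m. f (i j))"
proof -
  have "(\<Prod>j\<le>m. f (i j)) = (\<Prod>j\<in>set [0..<Suc m]. f (i j))"
    by (intro prod.cong) auto
  also have "\<dots> = prod_list (map (\<lambda>j. f (i j)) [0..<Suc m])"
    by (rule prod.distinct_set_conv_list) simp
  finally show ?thesis by (simp add: cf_block_def comp_def del: upt_Suc)
qed

lemma funpow_in_block_iff:
  "x \<in> irr \<Longrightarrow> (gauss_map ^^ n) x \<in> cylinder (cf_block i m) \<longleftrightarrow> (\<forall>k\<le>m. cf_digit x (n + k) = i k)"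
  by (auto simp: cylinder_def cf_digit_add gauss_map_funpow_irr cf_block_nth less_Suc_eq_le)

lemma unit_interval_irr: "x \<in> {0..1} \<Longrightarrow> x \<notin> \<rat> \<Longrightarrow> x \<in> irr"
  by (cases "x = 0 \<or> x = 1") (auto simp: irr_def)

lemma recurrent_block_set_eq:
  "recurrent_block_set i t = {x \<in> irr. \<forall>N. \<exists>n\<ge>N. (gauss_map ^^ n) x \<in> cylinder (cf_block i (t n))}"
proof -
  have "{x \<in> {0..1}. x \<notin> \<rat> \<and> P x} = {x \<in> irr. P x}" for P :: "real \<Rightarrow> bool"
    using unit_interval_irr by (auto simp: irr_def)
  then have "recurrent_block_set i t = {x \<in> irr. \<forall>N. \<exists>n\<ge>N. \<forall>k\<le>t n. cf_digit x (n + k) = i k}"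
    unfolding recurrent_block_set_def INFM_nat_le .
  then show ?thesis
    by (auto simp: funpow_in_block_iff)
qed

lemma recurrent_block_set_borel [measurable]: "recurrent_block_set i t \<in> sets borel"
proof -
  have "recurrent_block_set i t =
      irr \<inter> (\<Inter>N. \<Union>n\<in>{N..}. (gauss_map ^^ n) -` cylinder (cf_block i (t n)))"
    by (auto simp: recurrent_block_set_eq) (meson atLeast_iff)
  also have "\<dots> \<in> sets borel"
    by (intro sets.Int irr_borel sets.countable_INT' sets.countable_UN' funpow_gauss_vimage cylinder_borel)
       auto
  finally show ?thesis .
qed

lemma emeasure_lebesgue_eq_unit:
  assumes "A \<in> sets borel" "A \<subseteq> irr"
  shows "emeasure lebesgue A = ennreal (measure unit_lborel A)"
proof -
  have "irr \<inter> A = A" using assms by auto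
  then show ?thesis
    using emeasure_unit_lborel[OF assms(1)] assms(1) by (simp add: unit.emeasure_eq_measure)
qed

lemma recurrent_block_set_irr: "recurrent_block_set i t \<subseteq> irr"
  by (auto simp: recurrent_block_set_eq)

text \<open>If the first block ends before the second begins, quasi-independence costs 4 and the
  \<open>d - Suc p\<close> idle steps between them cost 2. If they overlap, only the first
  \<open>d\<close> digits of the first block are kept, a cylinder of measure at most 2 (1/2)^d,
  again with a factor 4. Adding the two bounds covers both cases with 8.\<close>

lemma measure_block_overlap:
  assumes i: "\<And>n. 1 \<le> i n" and d: "0 < d"
  shows "measure unit_lborel (cylinder (cf_block i p) \<inter> (gauss_map ^^ d) -` cylinder (cf_block i q)) \<le>
    8 * (measure unit_lborel (cylinder (cf_block i p)) * measure unit_lborel (cylinder (cf_block i q))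
      + (1 / 2) ^ d * measure unit_lborel (cylinder (cf_block i q)))"
proof (cases "p < d")
  case True
  let ?w = "cf_block i p" and ?E = "cylinder (cf_block i q)"
  have "gauss_map ^^ d = (gauss_map ^^ (d - Suc p)) \<circ> (gauss_map ^^ Suc p)"
    using True by (subst funpow_add[symmetric]) simp
  then have "(gauss_map ^^ d) -` ?E = (gauss_map ^^ length ?w) -` ((gauss_map ^^ (d - Suc p)) -` ?E)"
    by (simp add: vimage_comp del: funpow.simps)
  then have "measure unit_lborel (cylinder ?w \<inter> (gauss_map ^^ d) -` ?E) \<le>
      4 * measure unit_lborel (cylinder ?w) * measure unit_lborel ((gauss_map ^^ (d - Suc p)) -` ?E)"
    using measure_cylinder_preimage(2)[of "(gauss_map ^^ (d - Suc p)) -` ?E" ?w] cf_block_pos[of i] i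
    by simp
  also have "\<dots> \<le> 4 * measure unit_lborel (cylinder ?w) * (2 * measure unit_lborel ?E)"
    by (intro mult_left_mono measure_funpow_vimage) auto
  finally show ?thesis by (simp add: add_increasing2)
next
  case False
  let ?w = "cf_block i p" and ?E = "cylinder (cf_block i q)" and ?v = "take d (cf_block i p)"
  have len: "length ?v = d" using False by simp
  have v: "0 \<notin> set ?v"
    using cf_block_pos[of i p] i by (meson in_set_takeD)
  have "cylinder ?w \<subseteq> cylinder ?v"
    by (auto simp: cylinder_def)
  then have "measure unit_lborel (cylinder ?w \<inter> (gauss_map ^^ d) -` ?E) \<le>
      measure unit_lborel (cylinder ?v \<inter> (gauss_map ^^ length ?v) -` ?E)"
    unfolding len by (intro unit.finite_measure_mono) auto
  also have "\<dots> \<le> 4 * measure unit_lborel (cylinder ?v) * measure unit_lborel ?E"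
    by (rule measure_cylinder_preimage(2)) (use v in auto)
  also have "\<dots> \<le> 4 * (2 * (1 / 2) ^ d) * measure unit_lborel ?E"
    using measure_cylinder_le_power[OF v] unfolding len by (intro mult_left_mono mult_right_mono) auto
  finally show ?thesis by (simp add: add_increasing)
qed

lemma sum_half_power_le: "(\<Sum>n\<in>{N..<M}. if n \<le> m then (1 / 2 :: real) ^ (m - n) else 0) \<le> 2"
proof -
  have "(\<Sum>n\<in>{N..<M}. if n \<le> m then (1 / 2 :: real) ^ (m - n) else 0)
      = (\<Sum>n\<in>{N..<M} \<inter> {..m}. (1 / 2 :: real) ^ (m - n))"
    by (simp add: sum.inter_restrict)
  also have "\<dots> \<le> (\<Sum>n\<le>m. (1 / 2 :: real) ^ (m - n))"
    by (intro sum_mono2) auto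
  also have "\<dots> = (\<Sum>n\<le>m. (1 / 2 :: real) ^ n)"
    by (rule sum.nat_diff_reindex[of _ "Suc m", simplified lessThan_Suc_atMost, simplified])
  also have "\<dots> \<le> 2"
    by (simp add: sum_gp0)
  finally show ?thesis .
qed

text \<open>The second moment method on a finite window where the sum \<open>S\<close> of the
  cylinder measures is at least 1. The overlap terms form geometric series that contribute 2
  \<open>S\<close> for each order of the pair, so the second moment is at most 16 (S^2 + 4 S) \<le>
  80 S^2, and 320 = 4 * 80. The constant is the same for all \<open>N\<close>, \<open>i\<close> and
  \<open>t\<close>.\<close>

lemma measure_recurrent_tail:
  fixes i t :: "nat \<Rightarrow> nat"
  assumes i: "\<And>n. 1 \<le> i n"
    and div: "\<not> summable (\<lambda>n. measure unit_lborel (cylinder (cf_block i (t n))))"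
  shows "1 / 320 \<le> measure unit_lborel (\<Union>n\<in>{N..}. (gauss_map ^^ n) -` cylinder (cf_block i (t n)))"
proof -
  define P where "P n = cylinder (cf_block i (t n))" for n
  define A where "A n = (gauss_map ^^ n) -` P n" for n
  define a where "a n = measure unit_lborel (P n)" for n
  have [measurable]: "P n \<in> sets borel" "A n \<in> sets borel" for n
    by (simp_all add: P_def A_def funpow_gauss_vimage)
  have a0: "0 \<le> a n" for n by (simp add: a_def)
  have A_up: "measure unit_lborel (A n) \<le> 2 * a n" and A_lo: "a n / 2 \<le> measure unit_lborel (A n)" for n
    unfolding A_def a_def by (rule measure_funpow_vimage; simp)+
  obtain M where M: "1 \<le> (\<Sum>n\<in>{N..<M}. a n)"
  proof (rule ccontr)
    assume "\<not> thesis"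
    then have less: "(\<Sum>n\<in>{N..<M}. a n) < 1" for M
      using that by (meson linorder_not_less)
    have "summable (\<lambda>k. a (k + N))"
    proof (rule bounded_imp_summable)
      fix n
      have "(\<Sum>k\<le>n. a (k + N)) = (\<Sum>n\<in>{N..<N + Suc n}. a n)"
        by (rule sum.reindex_bij_witness[of _ "\<lambda>n. n - N" "\<lambda>k. k + N"]) auto
      then show "(\<Sum>k\<le>n. a (k + N)) \<le> 1" using less[of "N + Suc n"] by simp
    qed (rule a0)
    then have "summable a" by (simp add: summable_iff_shift)
    then show False using div by (simp add: a_def[abs_def] P_def)
  qed
  define I where "I = {N..<M}"
  define S where "S = (\<Sum>n\<in>I. a n)"
  define e where "e n m = (if n \<le> m then (1 / 2 :: real) ^ (m - n) else 0)" for n m :: nat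
  have S: "1 \<le> S" using M by (simp add: S_def I_def)
  have lt: "measure unit_lborel (A n \<inter> A m) \<le> 16 * (a n * a m + e n m * a m)" if "n < m" for n m
  proof -
    define d where "d = m - n"
    have "gauss_map ^^ m = (gauss_map ^^ d) \<circ> (gauss_map ^^ n)"
      using that by (subst funpow_add[symmetric]) (simp add: d_def)
    then have "A n \<inter> A m = (gauss_map ^^ n) -` (P n \<inter> (gauss_map ^^ d) -` P m)"
      by (auto simp: A_def)
    then have "measure unit_lborel (A n \<inter> A m) \<le> 2 * measure unit_lborel (P n \<inter> (gauss_map ^^ d) -` P m)"
      by (simp only:) (rule measure_funpow_vimage, simp add: funpow_gauss_vimage)
    also have "\<dots> \<le> 2 * (8 * (a n * a m + (1 / 2) ^ d * a m))"
      unfolding P_def a_def using that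
      by (intro mult_left_mono measure_block_overlap i) (auto simp: d_def)
    finally show ?thesis using that by (simp add: e_def d_def)
  qed
  \<comment> \<open>Both \<open>e\<close> terms are present so that one bound serves either order of
    n and m; on the diagonal \<open>e m m = 1\<close> pays for the measure of \<open>A m\<close>
    itself.\<close>
  have all: "measure unit_lborel (A n \<inter> A m) \<le> 16 * (a n * a m + e n m * a m + e m n * a n)" for n m
  proof (cases n m rule: linorder_cases)
    case less
    then show ?thesis using lt[OF less] by (simp add: e_def)
  next
    case equal
    have "0 \<le> a m * a m" by simp
    moreover have "e m m = 1" by (simp add: e_def)
    ultimately show ?thesis
      using A_up[of m] a0[of m] unfolding equal Int_absorb by (simp only: mult_1 distrib_left)
  next
    case greater
    then show ?thesis using lt[OF greater] by (simp add: e_def Int_commute mult.commute)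
  qed
  have "(\<Sum>n\<in>I. \<Sum>m\<in>I. measure unit_lborel (A n \<inter> A m)) \<le>
      (\<Sum>n\<in>I. \<Sum>m\<in>I. 16 * (a n * a m + e n m * a m + e m n * a n))"
    by (intro sum_mono all)
  also have "\<dots> = 16 * (S * S + (\<Sum>n\<in>I. \<Sum>m\<in>I. e n m * a m) + (\<Sum>n\<in>I. \<Sum>m\<in>I. e m n * a n))"
  proof -
    have "S * S = (\<Sum>n\<in>I. \<Sum>m\<in>I. a n * a m)"
      by (simp add: S_def sum_product)
    then show ?thesis
      by (simp only: sum.distrib sum_distrib_left[symmetric])
  qed
  also have "(\<Sum>n\<in>I. \<Sum>m\<in>I. e n m * a m) = (\<Sum>n\<in>I. \<Sum>m\<in>I. e m n * a n)"
    by (rule sum.swap)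
  also have "(\<Sum>n\<in>I. \<Sum>m\<in>I. e m n * a n) = (\<Sum>n\<in>I. (\<Sum>m\<in>I. e m n) * a n)"
    by (simp add: sum_distrib_right)
  also have "16 * (S * S + (\<Sum>n\<in>I. (\<Sum>m\<in>I. e m n) * a n) + (\<Sum>n\<in>I. (\<Sum>m\<in>I. e m n) * a n)) \<le>
      16 * (S * S + (\<Sum>n\<in>I. 2 * a n) + (\<Sum>n\<in>I. 2 * a n))"
    unfolding e_def I_def by (intro mult_left_mono add_mono sum_mono mult_right_mono sum_half_power_le a0) (use S in simp_all)
  also have "\<dots> = 16 * (S * S + 4 * S)"
    by (simp add: S_def sum_distrib_left[symmetric])
  also have "\<dots> \<le> 80 * S\<^sup>2"
    using mult_left_mono[OF S, of S] S by (simp add: power2_eq_square)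
  finally have second: "(\<Sum>n\<in>I. \<Sum>m\<in>I. measure unit_lborel (A n \<inter> A m)) \<le> 80 * S\<^sup>2" .
  have "S / 2 \<le> (\<Sum>n\<in>I. measure unit_lborel (A n))"
    unfolding S_def sum_divide_distrib by (intro sum_mono A_lo)
  then have "1 / (4 * 80) \<le> measure unit_lborel (\<Union>n\<in>I. A n)"
    using S second by (intro unit.prob_UN_ge_second_moment[where S = S]) (auto simp: I_def)
  also have "\<dots> \<le> measure unit_lborel (\<Union>n\<in>{N..}. A n)"
    by (intro unit.finite_measure_mono) (auto simp: I_def intro!: sets.countable_UN')
  finally show ?thesis by (simp add: A_def P_def)
qed

lemma measure_recurrent_ge:
  fixes i t :: "nat \<Rightarrow> nat"
  assumes i: "\<And>n. 1 \<le> i n"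
    and div: "\<not> summable (\<lambda>n. measure unit_lborel (cylinder (cf_block i (t n))))"
  shows "1 / 320 \<le> measure unit_lborel (recurrent_block_set i t)"
proof -
  define V where "V N = (\<Union>n\<in>{N..}. (gauss_map ^^ n) -` cylinder (cf_block i (t n)))" for N
  have V [measurable]: "V N \<in> sets borel" for N
    unfolding V_def by (intro sets.countable_UN') (auto simp: funpow_gauss_vimage)
  have "(\<lambda>N. measure unit_lborel (V N)) \<longlonglongrightarrow> measure unit_lborel (\<Inter>N. V N)"
    by (intro unit.finite_Lim_measure_decseq) (auto simp: decseq_def V_def intro: order_trans)
  then have "1 / 320 \<le> measure unit_lborel (\<Inter>N. V N)"
    by (rule LIMSEQ_le_const) (use measure_recurrent_tail[OF assms] in \<open>auto simp: V_def\<close>)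
  also have "measure unit_lborel (\<Inter>N. V N) = measure unit_lborel (recurrent_block_set i t)"
    by (rule measure_eq_AE, use AE_irr in eventually_elim)
       (auto simp: recurrent_block_set_eq V_def intro!: sets.countable_INT')
  finally show ?thesis .
qed

text \<open>Position \<open>n\<close> of the tail is position \<open>n + k\<close> of
  \<open>x\<close>, whence the shifted lengths. Divergence of the series survives this shift, so
  these sets have a common lower bound on their measures.\<close>

lemma recurrent_block_set_shift:
  assumes "x \<in> irr" "(gauss_map ^^ k) x \<in> recurrent_block_set i (\<lambda>n. t (n + k))"
  shows "x \<in> recurrent_block_set i t"
proof -
  have "\<exists>n\<ge>N. (gauss_map ^^ n) x \<in> cylinder (cf_block i (t n))" for N
  proof -
    obtain n where "n \<ge> N" "(gauss_map ^^ n) ((gauss_map ^^ k) x) \<in> cylinder (cf_block i (t (n + k)))"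
      using assms(2) by (auto simp: recurrent_block_set_eq)
    then show ?thesis
      by (intro exI[of _ "n + k"]) (simp add: funpow_add)
  qed
  then show ?thesis using assms(1) by (auto simp: recurrent_block_set_eq)
qed

lemma recurrent_full_measure:
  assumes i: "\<And>n. 1 \<le> i n"
    and div: "\<not> summable (\<lambda>n. 1 / (\<Prod>j\<le>t n. (real (i j) + 1)\<^sup>2))"
  shows "emeasure lebesgue (recurrent_block_set i t) = 1"
proof -
  have "\<not> summable (\<lambda>n. measure unit_lborel (cylinder (cf_block i (t n))))"
  proof
    assume "summable (\<lambda>n. measure unit_lborel (cylinder (cf_block i (t n))))"
    then have "summable (\<lambda>n. 1 / (\<Prod>j\<le>t n. (real (i j) + 1)\<^sup>2))"
    proof (rule summable_comparison_test_ev[OF always_eventually, rotated], intro allI)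
      fix n
      have "1 / (\<Prod>j\<le>t n. (real (i j) + 1)\<^sup>2) \<le> measure unit_lborel (cylinder (cf_block i (t n)))"
        using measure_cylinder_ge_prod[OF cf_block_pos[of i "t n"]] i
        by (simp add: prod_list_cf_block prod_power_distrib)
      moreover have "0 \<le> 1 / (\<Prod>j\<le>t n. (real (i j) + 1)\<^sup>2)"
        by (auto intro!: prod_nonneg)
      ultimately show "norm (1 / (\<Prod>j\<le>t n. (real (i j) + 1)\<^sup>2)) \<le> measure unit_lborel (cylinder (cf_block i (t n)))"
        by simp
    qed
    then show False using div by simp
  qed
  then have div': "\<not> summable (\<lambda>n. measure unit_lborel (cylinder (cf_block i (t (n + k)))))" for k
    by (subst summable_iff_shift)
  have "measure unit_lborel (recurrent_block_set i t) = 1"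
  proof (rule eventually_positive_full)
    show "1 / 320 \<le> measure unit_lborel (recurrent_block_set i (\<lambda>n. t (n + k)))" for k
      by (rule measure_recurrent_ge[OF i div'])
  qed (auto intro: recurrent_block_set_shift)
  then show ?thesis
    by (subst emeasure_lebesgue_eq_unit) (auto intro: subsetD[OF recurrent_block_set_irr])
qed

lemma recurrent_null:
  assumes i: "\<And>n. 1 \<le> i n"
    and conv: "summable (\<lambda>n. 1 / (\<Prod>j\<le>t n. (real (i j))\<^sup>2))"
  shows "recurrent_block_set i t \<in> null_sets lebesgue"
proof -
  define A where "A n = (gauss_map ^^ n) -` cylinder (cf_block i (t n))" for n
  have [measurable]: "A n \<in> sets borel" for n
    by (simp add: A_def funpow_gauss_vimage)
  have le: "measure unit_lborel (A n) \<le> 2 * (1 / (\<Prod>j\<le>t n. (real (i j))\<^sup>2))" for n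
  proof -
    have "measure unit_lborel (A n) \<le> 2 * measure unit_lborel (cylinder (cf_block i (t n)))"
      unfolding A_def by (rule measure_funpow_vimage) simp
    also have "measure unit_lborel (cylinder (cf_block i (t n))) \<le> 1 / (\<Prod>j\<le>t n. (real (i j))\<^sup>2)"
      using measure_cylinder_le_prod[OF cf_block_pos[of i "t n"]] i
      by (simp add: prod_list_cf_block prod_power_distrib)
    finally show ?thesis by simp
  qed
  have "summable (\<lambda>n. measure unit_lborel (A n))"
    by (rule summable_comparison_test'[OF summable_mult[OF conv, of 2], of 0]) (use le in auto)
  then have "AE x in unit_lborel. eventually (\<lambda>n. x \<in> space unit_lborel - A n) sequentially"
    by (intro borel_cantelli_AE1) (auto simp: unit.emeasure_eq_measure)
  then have "AE x in unit_lborel. x \<notin> recurrent_block_set i t"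
  proof eventually_elim
    case (elim x)
    then obtain N where "\<And>n. n \<ge> N \<Longrightarrow> x \<notin> A n"
      by (auto simp: eventually_sequentially)
    then show ?case by (auto simp: recurrent_block_set_eq A_def)
  qed
  then have "measure unit_lborel (recurrent_block_set i t) = 0"
    by (subst unit.prob_eq_0) auto
  then have "emeasure lebesgue (recurrent_block_set i t) = 0"
    by (subst emeasure_lebesgue_eq_unit) (auto intro: subsetD[OF recurrent_block_set_irr])
  then show ?thesis by (auto simp: null_sets_def)
qed

section \<open>The Lyapunov exponent of the Gauss map\<close>

lemma nn_integral_unit_has_integral:
  assumes "f \<in> borel_measurable borel" "\<And>x. x \<in> {0..1} \<Longrightarrow> 0 \<le> f x" "(f has_integral I) {0..1}"
  shows "(\<integral>\<^sup>+x. ennreal (f x) \<partial>unit_lborel) = ennreal I"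
  using assms by (subst nn_integral_unit_lborel) (auto intro!: nn_integral_has_integral_lebesgue')

lemma emeasure_gauss_measure_UNIV: "emeasure gauss_measure UNIV = ennreal (ln 2)"
proof -
  have "((\<lambda>x. 1 / (1 + x)) has_integral (ln (1 + 1) - ln (1 + 0))) {0..1::real}"
    by (intro fundamental_theorem_of_calculus_interior)
       (auto intro!: continuous_intros derivative_eq_intros
         simp flip: has_real_derivative_iff_has_vector_derivative)
  then have "(\<integral>\<^sup>+x. ennreal (1 / (1 + x)) \<partial>unit_lborel) = ennreal (ln 2)"
    by (intro nn_integral_unit_has_integral) auto
  then show ?thesis
    using nn_integral_gauss_measure[of "\<lambda>_. 1"] by simp
qed

interpretation gauss: finite_measure gauss_measure
  by standard (simp add: emeasure_gauss_measure_UNIV)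

lemma measure_gauss_measure_UNIV: "measure gauss_measure UNIV = ln 2"
  by (simp add: measure_def emeasure_gauss_measure_UNIV)

lemma AE_gauss_measure: "AE x in unit_lborel. P x \<Longrightarrow> AE x in gauss_measure. P x"
  unfolding gauss_measure_def by (subst AE_density) (auto elim: eventually_mono)

lemma distr_gauss_measure: "distr gauss_measure borel (gauss_map ^^ n) = gauss_measure"
proof (rule measure_eqI)
  fix A assume "A \<in> sets (distr gauss_measure borel (gauss_map ^^ n))"
  then have [measurable]: "A \<in> sets borel" by simp
  have "emeasure (distr gauss_measure borel (gauss_map ^^ n)) A = (\<integral>\<^sup>+x. indicator A ((gauss_map ^^ n) x) \<partial>gauss_measure)"
    by (subst emeasure_distr)
       (auto simp: indicator_vimage[unfolded comp_def, symmetric] nn_integral_indicator funpow_gauss_vimage)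
  also have "\<dots> = emeasure gauss_measure A"
    by (subst gauss_measure_invariant_funpow) auto
  finally show "emeasure (distr gauss_measure borel (gauss_map ^^ n)) A = emeasure gauss_measure A" .
qed simp

lemma integral_gauss_funpow:
  fixes g :: "real \<Rightarrow> real"
  assumes [measurable]: "g \<in> borel_measurable borel"
  shows "(\<integral>x. g ((gauss_map ^^ n) x) \<partial>gauss_measure) = (\<integral>x. g x \<partial>gauss_measure)"
  using integral_distr[of "gauss_map ^^ n" gauss_measure borel g] by (simp add: distr_gauss_measure)

section \<open>Birkhoff sums along Gauss orbits\<close>

definition birkhoff_sum :: "(real \<Rightarrow> real) \<Rightarrow> nat \<Rightarrow> real \<Rightarrow> real" where
  "birkhoff_sum g n x = (\<Sum>k<n. g ((gauss_map ^^ k) x))"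

lemma birkhoff_sum_add:
  "birkhoff_sum g (m + n) x = birkhoff_sum g m x + birkhoff_sum g n ((gauss_map ^^ m) x)"
proof (induction n)
  case (Suc n)
  have "(gauss_map ^^ (m + n)) x = (gauss_map ^^ n) ((gauss_map ^^ m) x)"
    by (simp add: add.commute[of m] funpow_add)
  then show ?case using Suc by (simp add: birkhoff_sum_def)
qed (simp add: birkhoff_sum_def)

lemma birkhoff_sum_measurable [measurable]:
  "g \<in> borel_measurable borel \<Longrightarrow> birkhoff_sum g n \<in> borel_measurable borel"
  unfolding birkhoff_sum_def[abs_def]
  by (intro borel_measurable_sum measurable_compose[OF funpow_gauss_measurable])

lemma birkhoff_sum_le: "(\<And>x. g x \<le> B) \<Longrightarrow> birkhoff_sum g n x \<le> real n * B"
  unfolding birkhoff_sum_def using sum_bounded_above[of "{..<n}" "\<lambda>k. g ((gauss_map ^^ k) x)" B] by simp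

lemma birkhoff_sum_mono: "(\<And>x. g x \<le> h x) \<Longrightarrow> birkhoff_sum g n x \<le> birkhoff_sum h n x"
  unfolding birkhoff_sum_def by (intro sum_mono)

text \<open>
  The Katznelson--Weiss argument: an orbit segment is cut into pieces of length at most \<open>M\<close> with
  average at most \<open>c\<close>, after \<open>g\<close> has been set to zero where no such piece starts.
\<close>

lemma integral_le_of_recurring_averages:
  assumes g [measurable]: "g \<in> borel_measurable borel" and g0: "\<And>x. 0 \<le> g x" and gB: "\<And>x. g x \<le> B"
    and c: "0 \<le> c"
    and ex: "AE x in gauss_measure. \<exists>n\<ge>1. birkhoff_sum g n x \<le> c * real n"
  shows "(\<integral>x. g x \<partial>gauss_measure) \<le> c * ln 2"
proof -
  have B: "0 \<le> B" using g0[of 0] gB[of 0] by linarith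
  define D where "D M = {x \<in> space borel. \<forall>n\<in>{1..M}. c * real n < birkhoff_sum g n x}" for M
  have [measurable]: "D M \<in> sets borel" for M
    unfolding D_def by measurable
  define h where "h M x = (if x \<in> D M then 0 else g x)" for M x
  have [measurable]: "h M \<in> borel_measurable borel" for M
    unfolding h_def[abs_def] by measurable
  have h0: "0 \<le> h M x" and hg: "h M x \<le> g x" and hB: "h M x \<le> B" for M x
    using g0[of x] gB[of x] B by (auto simp: h_def)
  have int_h: "integrable gauss_measure (h M)" for M
    by (rule gauss.integrable_const_bound[of _ B]) (auto simp: h0 hB abs_of_nonneg)
  have int_g: "integrable gauss_measure g"
    by (rule gauss.integrable_const_bound[of _ B]) (auto simp: g0 gB abs_of_nonneg)
  \<comment> \<open>The term \<open>real M * B\<close> pays for the last segment, which may be too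
    short to contain a piece with small average. At points of \<open>D M\<close> the induction
    advances by one step for free.\<close>
  have bound: "birkhoff_sum (h M) L x \<le> c * real L + real M * B" if M: "1 \<le> M" for M L x
  proof (induction L arbitrary: x rule: less_induct)
    case (less L)
    consider "L \<le> M" | "M < L" "x \<in> D M" | "M < L" "x \<notin> D M" by linarith
    then show ?case
    proof cases
      case 1
      have "birkhoff_sum (h M) L x \<le> real L * B" by (rule birkhoff_sum_le[OF hB])
      also have "\<dots> \<le> real M * B" using 1 B by (intro mult_right_mono) auto
      finally show ?thesis using c by (simp add: add_increasing)
    next
      case 2
      then have "birkhoff_sum (h M) L x = birkhoff_sum (h M) (L - 1) (gauss_map x)"
        using birkhoff_sum_add[of "h M" 1 "L - 1" x] M by (simp add: birkhoff_sum_def h_def)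
      also have "\<dots> \<le> c * real (L - 1) + real M * B"
        using 2 M by (intro less) auto
      also have "\<dots> \<le> c * real L + real M * B"
        using c by (intro add_mono mult_left_mono) auto
      finally show ?thesis .
    next
      case 3
      then obtain n where n: "1 \<le> n" "n \<le> M" "birkhoff_sum g n x \<le> c * real n"
        by (auto simp: D_def not_less)
      have "birkhoff_sum (h M) L x = birkhoff_sum (h M) n x + birkhoff_sum (h M) (L - n) ((gauss_map ^^ n) x)"
        using birkhoff_sum_add[of "h M" n "L - n" x] n 3 by simp
      also have "\<dots> \<le> c * real n + (c * real (L - n) + real M * B)"
        using n 3 M order_trans[OF birkhoff_sum_mono[of "h M" g n x, OF hg] n(3)]
        by (intro add_mono less) auto
      also have "\<dots> = c * real L + real M * B"
        using n 3 by (simp add: of_nat_diff algebra_simps)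
      finally show ?thesis .
    qed
  qed
  \<comment> \<open>By invariance the integral of \<open>birkhoff_sum (h M) L\<close> is L times
    that of \<open>h M\<close>; after division by L the boundary term of \<open>bound\<close>
    vanishes in the limit.\<close>
  have int_le: "(\<integral>x. h M x \<partial>gauss_measure) \<le> c * ln 2" if M: "1 \<le> M" for M
  proof -
    have "(\<lambda>L. c * ln 2 + real M * B * ln 2 / real L) \<longlonglongrightarrow> c * ln 2 + 0"
      by (intro tendsto_add tendsto_const real_tendsto_divide_at_top[OF tendsto_const] filterlim_real_sequentially)
    then have "(\<lambda>L. c * ln 2 + real M * B * ln 2 / real L) \<longlonglongrightarrow> c * ln 2"
      by simp
    then show ?thesis
    proof (rule LIMSEQ_le_const)
      show "\<exists>N. \<forall>L\<ge>N. (\<integral>x. h M x \<partial>gauss_measure) \<le> c * ln 2 + real M * B * ln 2 / real L"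
      proof (intro exI[of _ 1] allI impI)
        fix L :: nat assume L: "1 \<le> L"
        have int: "integrable gauss_measure (\<lambda>x. h M ((gauss_map ^^ k) x))" for k
          by (rule gauss.integrable_const_bound[of _ B]) (auto simp: h0 hB abs_of_nonneg)
        have "real L * (\<integral>x. h M x \<partial>gauss_measure) = (\<Sum>k<L. \<integral>x. h M ((gauss_map ^^ k) x) \<partial>gauss_measure)"
          by (simp add: integral_gauss_funpow)
        also have "\<dots> = (\<integral>x. birkhoff_sum (h M) L x \<partial>gauss_measure)"
          unfolding birkhoff_sum_def using int by (intro Bochner_Integration.integral_sum[symmetric])
        also have "\<dots> \<le> (\<integral>x. c * real L + real M * B \<partial>gauss_measure)"
          using int bound[OF M] by (intro integral_mono) (auto simp: birkhoff_sum_def[abs_def])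
        also have "\<dots> = (c * real L + real M * B) * ln 2"
          by (simp add: measure_gauss_measure_UNIV)
        finally show "(\<integral>x. h M x \<partial>gauss_measure) \<le> c * ln 2 + real M * B * ln 2 / real L"
          using L by (simp add: field_simps)
      qed
    qed
  qed
  have le: "(\<integral>x. g x \<partial>gauss_measure) \<le> c * ln 2 + B * measure gauss_measure (D M)" if M: "1 \<le> M" for M
  proof -
    have ind: "integrable gauss_measure (\<lambda>x. B * indicator (D M) x)"
      by (intro integrable_mult_right integrable_real_indicator) (auto simp: gauss.emeasure_eq_measure)
    have "g x \<le> h M x + B * indicator (D M) x" for x
      using gB[of x] unfolding h_def by (cases "x \<in> D M") auto
    then have "(\<integral>x. g x \<partial>gauss_measure) \<le> (\<integral>x. h M x + B * indicator (D M) x \<partial>gauss_measure)"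
      by (rule integral_mono[OF int_g Bochner_Integration.integrable_add[OF int_h ind]])
    also have "\<dots> = (\<integral>x. h M x \<partial>gauss_measure) + B * measure gauss_measure (D M)"
      using int_h ind by (subst Bochner_Integration.integral_add) auto
    finally show ?thesis using int_le[OF M] by linarith
  qed
  \<comment> \<open>By \<open>ex\<close> the sets \<open>D M\<close> decrease to a null set, so the
    part of \<open>g\<close> that \<open>h M\<close> discards tends to 0.\<close>
  have "(\<lambda>M. measure gauss_measure (D M)) \<longlonglongrightarrow> measure gauss_measure (\<Inter>M. D M)"
    by (intro gauss.finite_Lim_measure_decseq) (auto simp: decseq_def D_def)
  also have "measure gauss_measure (\<Inter>M. D M) = measure gauss_measure {}"
  proof (rule measure_eq_AE, use ex in eventually_elim)
    case (elim x)
    then obtain n where "1 \<le> n" "birkhoff_sum g n x \<le> c * real n" by auto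
    then have "x \<notin> D n" by (auto simp: D_def not_less intro!: bexI[of _ n])
    then show ?case by auto
  qed auto
  finally have "(\<lambda>M. c * ln 2 + B * measure gauss_measure (D M)) \<longlonglongrightarrow> c * ln 2 + B * 0"
    by (intro tendsto_intros) simp
  then have "(\<lambda>M. c * ln 2 + B * measure gauss_measure (D M)) \<longlonglongrightarrow> c * ln 2"
    by simp
  then show ?thesis
    by (rule LIMSEQ_le_const) (intro exI[of _ 1] allI impI le)
qed

text \<open>A point whose orbit visits the exceptional set \<open>E\<close> has some average at most
  \<open>b\<close>, since the slack \<open>b - a\<close> absorbs the steps before the visit. Were
  \<open>E\<close> of positive measure, the zero-one law would give such an average almost
  everywhere, and then the integral of \<open>g\<close> would be at most
  \<open>b * ln 2\<close>.\<close>

lemma birkhoff_sum_lower: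
  assumes g [measurable]: "g \<in> borel_measurable borel" and g0: "\<And>x. 0 \<le> g x" and gB: "\<And>x. g x \<le> B"
    and a: "0 \<le> a" and less: "a * ln 2 < (\<integral>x. g x \<partial>gauss_measure)"
  shows "AE x in unit_lborel. \<exists>N. \<forall>n\<ge>N. a * real n \<le> birkhoff_sum g n x"
proof -
  let ?I = "\<integral>x. g x \<partial>gauss_measure"
  define E where "E = {x \<in> space borel. \<forall>N. \<exists>n\<in>{N..}. birkhoff_sum g n x < a * real n}"
  have E [measurable]: "E \<in> sets borel"
    unfolding E_def by measurable
  have "a < ?I / ln 2"
    using less by (subst pos_less_divide_eq) auto
  then obtain b where b: "a < b" "b < ?I / ln 2"
    using dense by blast
  then have b2: "b * ln 2 < ?I"
    by (subst (asm) pos_less_divide_eq) auto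
  define W where "W = {x \<in> space borel. \<exists>n\<in>{1..}. birkhoff_sum g n x \<le> b * real n}"
  have W [measurable]: "W \<in> sets borel"
    unfolding W_def by measurable
  have "measure unit_lborel E = 0"
  proof (rule ccontr)
    assume "measure unit_lborel E \<noteq> 0"
    then have pos: "0 < measure unit_lborel E" by (simp add: zero_less_measure_iff)
    have "measure unit_lborel W = 1"
    proof (rule eventually_positive_full[OF W pos, of "\<lambda>_. E"])
      fix k x assume "x \<in> irr" "(gauss_map ^^ k) x \<in> E"
      \<comment> \<open>From time \<open>N\<close> on, the slack \<open>b - a\<close> outweighs the
        at most \<open>real k * B\<close> gathered before the visit.\<close>
      obtain N where N: "real k * B / (b - a) \<le> real N"
        using real_arch_simple by blast
      have "\<exists>n\<in>{max 1 N..}. birkhoff_sum g n ((gauss_map ^^ k) x) < a * real n"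
        using \<open>(gauss_map ^^ k) x \<in> E\<close> unfolding E_def by blast
      then obtain n where n: "max 1 N \<le> n" "birkhoff_sum g n ((gauss_map ^^ k) x) < a * real n"
        by auto
      have "real k * B \<le> (b - a) * real n"
      proof -
        have "real k * B \<le> real N * (b - a)"
          using N b(1) by (simp add: pos_divide_le_eq)
        also have "\<dots> \<le> real n * (b - a)"
          using n(1) b(1) by (intro mult_right_mono) auto
        finally show ?thesis by (simp only: mult.commute)
      qed
      moreover have "birkhoff_sum g k x \<le> real k * B" by (rule birkhoff_sum_le[OF gB])
      ultimately have "birkhoff_sum g (k + n) x \<le> b * real n"
        using n(2) unfolding birkhoff_sum_add left_diff_distrib by linarith
      also have "\<dots> \<le> b * real (k + n)"
        using a b(1) by (intro mult_left_mono) auto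
      finally show "x \<in> W" using n unfolding W_def by (simp, intro bexI[of _ "k + n"]) auto
    qed auto
    then have "AE x in unit_lborel. x \<in> W" using unit.prob_eq_1[of W] W by simp
    then have "AE x in gauss_measure. x \<in> W" by (rule AE_gauss_measure)
    then have "AE x in gauss_measure. \<exists>n\<ge>1. birkhoff_sum g n x \<le> b * real n"
    proof eventually_elim
      case (elim x)
      then show ?case unfolding W_def by blast
    qed
    then have "?I \<le> b * ln 2"
      using a b(1) by (intro integral_le_of_recurring_averages[OF g g0 gB]) simp_all
    then show False using b2 by linarith
  qed
  then have "AE x in unit_lborel. x \<notin> E" by (subst (asm) unit.prob_eq_0) auto
  then show ?thesis
    by eventually_elim (auto simp: E_def not_less)
qed

section \<open>The integral of the logarithm against the Gauss density\<close>

lemma has_integral_power_ln: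
  "((\<lambda>x. x ^ n * (- ln x)) has_integral 1 / (real n + 1)\<^sup>2) {0..1::real}"
proof -
  \<comment> \<open>The usual antiderivative, arranged so that the logarithm occurs only in
    \<open>x * ln x\<close>, which is continuous on the closed interval with value 0 at 0.\<close>
  define F where "F x = x ^ n * (x / (real n + 1)\<^sup>2 - x * ln x / (real n + 1))" for x :: real
  have cont: "continuous_on {0..1} (\<lambda>x::real. x * ln x)"
  proof (rule continuous_on_eq_continuous_within[THEN iffD2], rule ballI)
    fix x :: real assume x: "x \<in> {0..1}"
    show "continuous (at x within {0..1}) (\<lambda>x. x * ln x)"
    proof (cases "x = 0")
      case True
      have "((\<lambda>x::real. x * ln x) \<longlongrightarrow> 0) (at_right 0)" by real_asymp
      moreover have "at (0::real) within {0..1} = at_right 0"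
        by (rule at_within_Icc_at_right) simp
      ultimately show ?thesis using True by (simp add: continuous_within)
    next
      case False
      then show ?thesis using x by (intro continuous_intros) auto
    qed
  qed
  have "((\<lambda>x. x ^ n * (- ln x)) has_integral (F 1 - F 0)) {0..1}"
  proof (rule fundamental_theorem_of_calculus_interior)
    show "continuous_on {0..1} F"
      unfolding F_def by (intro continuous_intros cont) auto
    fix x :: real assume x: "x \<in> {0<..<1}"
    have "(F has_real_derivative (x ^ n * (- ln x))) (at x)"
    proof -
      have eq: "F = (\<lambda>x. x ^ Suc n / (real n + 1)\<^sup>2 - x ^ Suc n * ln x / (real n + 1))"
        by (auto simp: F_def fun_eq_iff algebra_simps)
      have pow: "((\<lambda>x. x ^ Suc n) has_real_derivative (real n + 1) * x ^ n) (at x)"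
        using DERIV_pow[of "Suc n" x] by (simp add: add.commute)
      have ln: "(ln has_real_derivative 1 / x) (at x)"
        using x by (auto intro!: derivative_eq_intros)
      have "(F has_real_derivative ((real n + 1) * x ^ n / (real n + 1)\<^sup>2
          - ((real n + 1) * x ^ n * ln x + 1 / x * x ^ Suc n) / (real n + 1))) (at x)"
        unfolding eq by (intro DERIV_diff DERIV_cdivide DERIV_mult pow ln)
      also have "(real n + 1) * x ^ n / (real n + 1)\<^sup>2
          - ((real n + 1) * x ^ n * ln x + 1 / x * x ^ Suc n) / (real n + 1) = x ^ n * (- ln x)"
      proof -
        define m where "m = real n + 1"
        have "0 < m" by (simp add: m_def)
        then have "m * x ^ n / m\<^sup>2 - (m * x ^ n * ln x + x ^ n) / m = x ^ n * (- ln x)"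
          by (simp add: field_simps power2_eq_square)
        then show ?thesis using x by (simp add: m_def)
      qed
      finally show ?thesis .
    qed
    then show "(F has_vector_derivative (x ^ n * (- ln x))) (at x)"
      by (simp add: has_real_derivative_iff_has_vector_derivative)
  qed simp
  then show ?thesis by (simp add: F_def)
qed

text \<open>The Basel series in pairs, minus twice its even terms. The even terms make up a quarter
  of pi^2/6, so half of it remains.\<close>

lemma sums_alternating_inverse_squares:
  "(\<lambda>k. 1 / (2 * real k + 1)\<^sup>2 - 1 / (2 * real k + 2)\<^sup>2) sums (pi\<^sup>2 / 12)"
proof -
  let ?f = "\<lambda>n. 1 / (real n + 1)\<^sup>2"
  have s: "?f sums (pi\<^sup>2 / 6)"
    using inverse_squares_sums by (simp add: add.commute)
  have "(\<lambda>k. \<Sum>n\<in>{k * 2..<k * 2 + 2}. ?f n) sums (pi\<^sup>2 / 6)"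
    by (rule sums_group[OF s]) simp
  moreover have "(\<Sum>n\<in>{k * 2..<k * 2 + 2}. ?f n) = 1 / (2 * real k + 1)\<^sup>2 + 1 / (2 * real k + 2)\<^sup>2" for k
    by (simp add: numeral_2_eq_2 algebra_simps)
  ultimately have "(\<lambda>k. 1 / (2 * real k + 1)\<^sup>2 + 1 / (2 * real k + 2)\<^sup>2) sums (pi\<^sup>2 / 6)"
    by simp
  moreover have "(\<lambda>k. 1 / 2 * ?f k) sums (1 / 2 * (pi\<^sup>2 / 6))"
    by (rule sums_mult[OF s])
  ultimately have "(\<lambda>k. 1 / (2 * real k + 1)\<^sup>2 + 1 / (2 * real k + 2)\<^sup>2 - 1 / 2 * ?f k) sums
      (pi\<^sup>2 / 6 - 1 / 2 * (pi\<^sup>2 / 6))"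
    by (rule sums_diff)
  moreover have "1 / 2 * ?f k = 2 * (1 / (2 * real k + 2)\<^sup>2)" for k
  proof -
    have "(2 * real k + 2)\<^sup>2 = 4 * (real k + 1)\<^sup>2"
      by (simp add: power2_eq_square algebra_simps)
    then show ?thesis by simp
  qed
  ultimately show ?thesis by (simp add: algebra_simps)
qed

text \<open>1 / (1 + x) is expanded into its alternating geometric series and consecutive terms are
  paired. The paired terms \<open>?u k\<close> are nonnegative on the unit interval, so monotone
  convergence exchanges sum and integral.\<close>

lemma nn_integral_gauss_neg_ln:
  "(\<integral>\<^sup>+x. ennreal (- ln x) \<partial>gauss_measure) = ennreal (pi\<^sup>2 / 12)"
proof -
  let ?u = "\<lambda>k x. x ^ (2 * k) * (- ln x) - x ^ (2 * k + 1) * (- ln x)"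
  have u0: "0 \<le> ?u k x" if "x \<in> {0..1}" for k and x :: real
  proof -
    have "?u k x = x ^ (2 * k) * (1 - x) * (- ln x)" by (simp add: algebra_simps)
    moreover have "ln x \<le> 0" using that by (cases "x = 0") auto
    ultimately show ?thesis using that by (simp add: mult_nonneg_nonpos)
  qed
  have int: "(\<integral>\<^sup>+x. ennreal (?u k x) \<partial>unit_lborel) = ennreal (1 / (2 * real k + 1)\<^sup>2 - 1 / (2 * real k + 2)\<^sup>2)" for k
  proof (rule nn_integral_unit_has_integral)
    have "(?u k has_integral (1 / (real (2 * k) + 1)\<^sup>2 - 1 / (real (2 * k + 1) + 1)\<^sup>2)) {0..1}"
      by (intro has_integral_diff has_integral_power_ln)
    then show "(?u k has_integral (1 / (2 * real k + 1)\<^sup>2 - 1 / (2 * real k + 2)\<^sup>2)) {0..1}"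
      by (simp add: add.commute)
  qed (use u0 in auto)
  have sums: "(\<lambda>k. ?u k x) sums (1 / (1 + x) * (- ln x))" if "x \<in> irr" for x
  proof -
    have x: "0 < x" "x < 1" using that by (auto simp: irr_def)
    have "x * x < 1 * 1" using x by (intro mult_strict_mono) auto
    then have "x\<^sup>2 < 1" by (simp add: power2_eq_square)
    then have "(\<lambda>k. (x\<^sup>2) ^ k) sums (1 / (1 - x\<^sup>2))"
      using x by (intro geometric_sums) auto
    then have "(\<lambda>k. (1 - x) * (- ln x) * (x\<^sup>2) ^ k) sums ((1 - x) * (- ln x) * (1 / (1 - x\<^sup>2)))"
      by (rule sums_mult)
    moreover have "(1 - x) * (- ln x) * (x\<^sup>2) ^ k = ?u k x" for k
      by (simp add: power_mult[symmetric] algebra_simps)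
    moreover have "(1 - x) * (- ln x) * (1 / (1 - x\<^sup>2)) = 1 / (1 + x) * (- ln x)"
    proof -
      have "1 - x\<^sup>2 = (1 - x) * (1 + x)" by (simp add: power2_eq_square algebra_simps)
      then show ?thesis using x by simp
    qed
    ultimately show ?thesis by simp
  qed
  have "(\<integral>\<^sup>+x. ennreal (- ln x) \<partial>gauss_measure) = (\<integral>\<^sup>+x. (\<Sum>k. ennreal (?u k x)) \<partial>unit_lborel)"
  proof (subst nn_integral_gauss_measure, simp, rule nn_integral_cong_AE, use AE_irr in eventually_elim)
    case (elim x)
    have "ennreal (1 / (1 + x)) * ennreal (- ln x) = ennreal (1 / (1 + x) * (- ln x))"
      using elim by (intro ennreal_mult[symmetric]) (auto simp: irr_def)
    then show ?case
      using suminf_ennreal_eq[OF u0[OF irr_unit[OF elim]] sums[OF elim]] by simp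
  qed
  also have "\<dots> = (\<Sum>k. \<integral>\<^sup>+x. ennreal (?u k x) \<partial>unit_lborel)"
    by (rule nn_integral_suminf) measurable
  also have "\<dots> = (\<Sum>k. ennreal (1 / (2 * real k + 1)\<^sup>2 - 1 / (2 * real k + 2)\<^sup>2))"
    by (simp only: int)
  also have "\<dots> = ennreal (pi\<^sup>2 / 12)"
  proof (rule suminf_ennreal_eq[OF _ sums_alternating_inverse_squares])
    show "0 \<le> 1 / (2 * real k + 1)\<^sup>2 - 1 / (2 * real k + 2)\<^sup>2" for k
      by (simp add: frac_le power_mono)
  qed
  finally show ?thesis .
qed

text \<open>The Birkhoff estimate is stated for bounded functions, so -ln is cut off at
  \<open>B\<close>, and by monotone convergence little of its integral is lost. A minorant of -ln is
  enough to bound denominators from below.\<close>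

lemma truncated_integral_gauss:
  assumes "r < pi\<^sup>2 / 12"
  shows "\<exists>B\<ge>0. r < (\<integral>x. min (max 0 (- ln x)) B \<partial>gauss_measure)"
proof (rule ccontr)
  assume neg: "\<not> ?thesis"
  let ?g = "\<lambda>B x. min (max 0 (- ln x)) B"
  have int: "integrable gauss_measure (?g (real B))" for B :: nat
    by (rule gauss.integrable_const_bound[of _ "real B"]) auto
  have "incseq (\<lambda>B x. ennreal (?g (real B) x))"
    by (auto simp: incseq_def le_fun_def intro!: ennreal_leI min.mono)
  then have "(\<integral>\<^sup>+x. (SUP B. ennreal (?g (real B) x)) \<partial>gauss_measure) =
      (SUP B. \<integral>\<^sup>+x. ennreal (?g (real B) x) \<partial>gauss_measure)"
    by (rule nn_integral_monotone_convergence_SUP) measurable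
  also have "(\<lambda>x. SUP B. ennreal (?g (real B) x)) = (\<lambda>x. ennreal (- ln x))"
  proof
    fix x :: real
    show "(SUP B. ennreal (?g (real B) x)) = ennreal (- ln x)"
    proof (rule antisym)
      show "(SUP B. ennreal (?g (real B) x)) \<le> ennreal (- ln x)"
        by (intro SUP_least) (auto simp: min_def max_def intro!: ennreal_leI)
      obtain B where "- ln x \<le> real B" using real_arch_simple by blast
      then have "ennreal (- ln x) \<le> ennreal (?g (real B) x)"
        by (auto simp: min_def max_def ennreal_neg)
      then show "ennreal (- ln x) \<le> (SUP B. ennreal (?g (real B) x))"
        by (rule SUP_upper2[OF UNIV_I])
    qed
  qed
  finally have "ennreal (pi\<^sup>2 / 12) = (SUP B. \<integral>\<^sup>+x. ennreal (?g (real B) x) \<partial>gauss_measure)"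
    by (simp add: nn_integral_gauss_neg_ln)
  also have "\<dots> \<le> ennreal r"
  proof (rule SUP_least)
    fix B :: nat
    have "(\<integral>\<^sup>+x. ennreal (?g (real B) x) \<partial>gauss_measure) = ennreal (\<integral>x. ?g (real B) x \<partial>gauss_measure)"
      by (rule nn_integral_eq_integral[OF int]) auto
    also have "\<dots> \<le> ennreal r"
      using neg by (intro ennreal_leI) (auto simp: not_less)
    finally show "(\<integral>\<^sup>+x. ennreal (?g (real B) x) \<partial>gauss_measure) \<le> ennreal r" .
  qed
  finally show False using assms
    by (cases "0 \<le> r") (auto simp: ennreal_le_iff ennreal_neg)
qed

text \<open>The first n orbit points multiply to the reciprocal of the denominator at the tail. Thus
  averages of -ln are growth rates of denominators.\<close>

lemma birkhoff_sum_neg_ln: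
  "x \<in> irr \<Longrightarrow> birkhoff_sum (\<lambda>y. - ln y) n x = ln (cf_den (cf_prefix x n) ((gauss_map ^^ n) x))"
proof (induction n arbitrary: x)
  case (Suc n)
  let ?y = "gauss_map x"
  have y: "?y \<in> irr" by (rule gauss_map_irr[OF Suc.prems])
  have x: "x = 1 / (real (cf_digit x 0) + ?y)" by (rule gauss_map_eq[OF Suc.prems])
  have den: "1 \<le> cf_den (cf_prefix ?y n) ((gauss_map ^^ n) ?y)"
    by (intro cf_den_pos cf_prefix_pos y irr_unit gauss_map_funpow_irr)
  have "cf_den (cf_prefix x (Suc n)) ((gauss_map ^^ Suc n) x) =
      (real (cf_digit x 0) + ?y) * cf_den (cf_prefix ?y n) ((gauss_map ^^ n) ?y)"
    using cf_map_prefix[OF y, of n] by (simp add: cf_prefix_Suc funpow_Suc_right del: funpow.simps)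
  also have "ln \<dots> = ln (real (cf_digit x 0) + ?y) + ln (cf_den (cf_prefix ?y n) ((gauss_map ^^ n) ?y))"
    using den y by (intro ln_mult_pos) (auto simp: irr_def)
  also have "ln (real (cf_digit x 0) + ?y) = - ln x"
    using y by (subst (3) x) (auto simp: irr_def ln_div)
  finally show ?case
    using Suc.IH[OF y] birkhoff_sum_add[of "\<lambda>y. - ln y" 1 n x] by (simp add: birkhoff_sum_def)
qed (simp add: birkhoff_sum_def)

text \<open>Almost every point satisfies the bound from some time on. The sets \<open>V N\<close>,
  on which this time is at most \<open>N\<close>, cover almost everything, so one of them has
  positive measure and serves as \<open>G\<close>.\<close>

lemma denominators_grow:
  assumes \<beta>: "0 \<le> \<beta>" "\<beta> < pi\<^sup>2 / (12 * ln 2)"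
  shows "\<exists>N G. G \<in> sets borel \<and> G \<subseteq> irr \<and> 0 < measure unit_lborel G \<and>
    (\<forall>x\<in>G. \<forall>n\<ge>N. exp (\<beta> * real n) \<le> cf_den (cf_prefix x n) ((gauss_map ^^ n) x))"
proof -
  have "\<beta> * ln 2 < pi\<^sup>2 / 12"
    using \<beta>(2) by (simp add: field_simps)
  then obtain B where B: "0 \<le> B" "\<beta> * ln 2 < (\<integral>x. min (max 0 (- ln x)) B \<partial>gauss_measure)"
    using truncated_integral_gauss by blast
  define g where "g x = min (max 0 (- ln x)) B" for x :: real
  have g [measurable]: "g \<in> borel_measurable borel"
    unfolding g_def[abs_def] by measurable
  have AE: "AE x in unit_lborel. \<exists>N. \<forall>n\<ge>N. \<beta> * real n \<le> birkhoff_sum g n x"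
    by (rule birkhoff_sum_lower[of _ B]) (use B \<beta> in \<open>auto simp: g_def[abs_def]\<close>)
  define V where "V N = irr \<inter> {x \<in> space borel. \<forall>n\<in>{N..}. \<beta> * real n \<le> birkhoff_sum g n x}" for N
  have V: "V N \<in> sets borel" for N
    unfolding V_def by measurable
  have "\<exists>N. measure unit_lborel (V N) \<noteq> 0"
  proof (rule ccontr)
    assume "\<nexists>N. measure unit_lborel (V N) \<noteq> 0"
    then have "AE x in unit_lborel. x \<notin> V N" for N
      using unit.prob_eq_0[of "V N"] V by auto
    then have "AE x in unit_lborel. \<forall>N. x \<notin> V N"
      by (simp add: AE_all_countable)
    then have "AE x in unit_lborel. False"
      using AE AE_irr by eventually_elim (auto simp: V_def)
    then show False by simp
  qed
  then obtain N where N: "0 < measure unit_lborel (V N)"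
    by (auto simp: zero_less_measure_iff)
  have "exp (\<beta> * real n) \<le> cf_den (cf_prefix x n) ((gauss_map ^^ n) x)" if x: "x \<in> V N" and n: "N \<le> n" for x n
  proof -
    have irr: "x \<in> irr" using x by (simp add: V_def)
    have "\<beta> * real n \<le> birkhoff_sum g n x" using x n by (simp add: V_def)
    also have "\<dots> \<le> birkhoff_sum (\<lambda>y. - ln y) n x"
      unfolding birkhoff_sum_def
    proof (rule sum_mono)
      fix k
      have "(gauss_map ^^ k) x \<in> irr" by (rule gauss_map_funpow_irr[OF irr])
      then have "ln ((gauss_map ^^ k) x) \<le> 0" by (auto simp: irr_def)
      then show "g ((gauss_map ^^ k) x) \<le> - ln ((gauss_map ^^ k) x)" by (simp add: g_def)
    qed
    also have "\<dots> = ln (cf_den (cf_prefix x n) ((gauss_map ^^ n) x))"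
      by (rule birkhoff_sum_neg_ln[OF irr])
    finally have le: "\<beta> * real n \<le> ln (cf_den (cf_prefix x n) ((gauss_map ^^ n) x))" .
    have "1 \<le> cf_den (cf_prefix x n) ((gauss_map ^^ n) x)"
      by (intro cf_den_pos cf_prefix_pos irr irr_unit gauss_map_funpow_irr)
    then show ?thesis using le by (simp add: ln_ge_iff)
  qed
  then show ?thesis using V[of N] N by (intro exI[of _ N] exI[of _ "V N"]) (auto simp: V_def)
qed

section \<open>Points with prescribed digits\<close>

lemma continuous_on_cf_map: "0 \<notin> set w \<Longrightarrow> continuous_on {0..1} (cf_map w)"
proof (induction w)
  case (Cons a w)
  have "continuous_on {0..1} (\<lambda>y. 1 / (real a + cf_map w y))"
  proof (intro continuous_intros ballI)
    show "continuous_on {0..1} (cf_map w)" using Cons by auto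
    fix y :: real assume "y \<in> {0..1}"
    then show "real a + cf_map w y \<noteq> 0"
      using cf_map_unit[of w y] Cons.prems by auto
  qed
  then show ?case by simp
next
  case Nil
  show ?case by (simp add: continuous_on_id)
qed

text \<open>On fractions the Gauss map is a division step of the Euclidean algorithm: p/q goes to (q
  mod p)/p, and the denominators decrease until 0 is reached.\<close>

lemma rational_orbit_exits:
  fixes p q :: nat
  assumes "0 < p" "p < q"
  shows "\<exists>n. (gauss_map ^^ n) (real p / real q) \<notin> {0<..<1}"
  using assms
proof (induction q arbitrary: p rule: less_induct)
  case (less q)
  have "\<lfloor>real q / real p\<rfloor> = int (q div p)"
    by (rule floor_divide_of_nat_eq)
  moreover have "real q = real (q div p) * real p + real (q mod p)"
    by (metis div_mult_mod_eq of_nat_add of_nat_mult)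
  ultimately have step: "gauss_map (real p / real q) = real (q mod p) / real p"
    using less.prems by (simp add: gauss_map_def field_simps)
  show ?case
  proof (cases "q mod p = 0")
    case True
    then show ?thesis using step by (intro exI[of _ 1]) simp
  next
    case False
    then obtain n where "(gauss_map ^^ n) (real (q mod p) / real p) \<notin> {0<..<1}"
      using less.IH[of p "q mod p"] less.prems by auto
    then show ?thesis
      using step by (intro exI[of _ "Suc n"]) (simp add: funpow_Suc_right del: funpow.simps)
  qed
qed

lemma irr_of_orbit:
  assumes "\<And>n. (gauss_map ^^ n) x \<in> {0<..<1}"
  shows "x \<in> irr"
proof -
  have x: "0 < x" "x < 1" using assms[of 0] by auto
  have "x \<notin> \<rat>"
  proof
    assume "x \<in> \<rat>"
    then obtain p q :: nat where "q \<noteq> 0" "\<bar>x\<bar> = real p / real q"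
      by (rule Rats_abs_nat_div_natE)
    then have eq: "x = real p / real q" using x by simp
    then have p: "real p = x * real q" using \<open>q \<noteq> 0\<close> by simp
    have "0 < x * real q" "x * real q < 1 * real q"
      using x \<open>q \<noteq> 0\<close> by (intro mult_pos_pos mult_strict_right_mono; simp)+
    then have "0 < p" "p < q" unfolding p[symmetric] by simp_all
    then show False using rational_orbit_exits assms eq by blast
  qed
  then show ?thesis using x by (simp add: irr_def)
qed

text \<open>Compactness yields a point in all the nested images of the closed interval. It is
  irrational because its orbit never leaves the open interval.\<close>

lemma ex_cf_digits:
  assumes d: "\<And>n. 1 \<le> d n"
  shows "\<exists>x\<in>irr. \<forall>n. cf_digit x n = d n"
proof -
  define w where "w s n = map (\<lambda>k. d (s + k)) [0..<n]" for s n
  \<comment> \<open>\<open>P s x\<close> expresses that x has the expansion with digits d s, d (s +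
    1), ... without presupposing irrationality; removing a digit leads from \<open>P s\<close> to
    \<open>P (Suc s)\<close>.\<close>
  define P where "P s x \<longleftrightarrow> (\<forall>n. x \<in> cf_map (w s n) ` {0..1})" for s x
  have "d k \<noteq> 0" for k
    using d[of k] by simp
  then have w0: "0 \<notin> set (w s n)" for s n
    unfolding w_def by (metis (no_types, lifting) imageE list.set_map)
  have w_Suc: "w s (Suc n) = d s # w (Suc s) n" for s n
    by (rule nth_equalityI) (auto simp: w_def nth_Cons simp del: upt_Suc split: nat.split)
  have "\<Inter> (range (\<lambda>n. cf_map (w 0 n) ` {0..1})) \<noteq> {}"
  proof (rule compact_nest)
    show "compact (cf_map (w 0 n) ` {0..1})" for n
      by (intro compact_continuous_image continuous_on_cf_map w0 compact_Icc)
    fix m n :: nat assume "m \<le> n"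
    then have "w 0 n = w 0 m @ w m (n - m)"
      by (intro nth_equalityI) (auto simp: w_def nth_append)
    then show "cf_map (w 0 n) ` {0..1} \<subseteq> cf_map (w 0 m) ` {0..1}"
      using cf_map_unit[OF w0[of m "n - m"]] by (auto simp: cf_map_append)
  qed auto
  then obtain x where x: "P 0 x" by (auto simp: P_def)
  have unit: "z \<in> {0..1}" if "P s z" for s z
    using that[unfolded P_def, rule_format, of 0] by (simp add: w_def)
  have form: "\<exists>z. y = 1 / (real (d s) + z) \<and> P (Suc s) z" if Py: "P s y" for s y
  proof (intro exI conjI)
    let ?z = "1 / y - real (d s)"
    have z: "\<exists>z \<in> cf_map (w (Suc s) n) ` {0..1}. y = 1 / (real (d s) + z)" for n
      using Py[unfolded P_def, rule_format, of "Suc n"] by (auto simp: w_Suc)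
    have "z = ?z" if "y = 1 / (real (d s) + z)" for z
      using that by simp
    then show "P (Suc s) ?z" unfolding P_def using z by metis
    show "y = 1 / (real (d s) + ?z)" by simp
  qed
  \<comment> \<open>The images of closed intervals only give \<open>y \<in> {0..1}\<close>.
    Unfolding a second digit shows that the tail z is strictly positive, which excludes y =
    1.\<close>
  have open_unit: "y \<in> {0<..<1}" if Py: "P s y" for s y
  proof -
    obtain z where z: "y = 1 / (real (d s) + z)" "P (Suc s) z" using form[OF Py] by auto
    obtain z' where z': "z = 1 / (real (d (Suc s)) + z')" "P (Suc (Suc s)) z'" using form[OF z(2)] by auto
    have "0 < real (d (Suc s)) + z'" using unit[OF z'(2)] d[of "Suc s"] by auto
    then have "0 < z" using z' by simp
    then have "1 < real (d s) + z" using d[of s] by linarith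
    then show ?thesis using z by simp
  qed
  have step: "P (Suc s) (gauss_map y) \<and> cf_digit y 0 = d s" if Py: "P s y" for s y
  proof -
    obtain z where z: "y = 1 / (real (d s) + z)" "P (Suc s) z" using form[OF Py] by auto
    then show ?thesis using gauss_branch[of "d s" z] d[of s] open_unit[OF z(2)] by auto
  qed
  have orbit: "P n ((gauss_map ^^ n) x)" for n
    by (induction n) (use x step in auto)
  have "x \<in> irr"
    by (rule irr_of_orbit) (use open_unit[OF orbit] in auto)
  moreover have "cf_digit x n = d n" for n
    using step[OF orbit[of n]] cf_digit_add[of x n 0] by simp
  ultimately show ?thesis by blast
qed

section \<open>Inserting blocks of digits\<close>

lemma cf_digit_0_bounds:
  assumes "x \<in> irr"
  shows "1 / (real (cf_digit x 0) + 1) \<le> x" "x \<le> 1 / real (cf_digit x 0)"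
  using cf_digit_0_iff[of x "cf_digit x 0"] cf_digit_pos[OF assms, of 0] assms by (auto simp: irr_def)

text \<open>A point is near 1 only if its first digit is 1; then 1 - x = y / (1 + y) for the next
  iterate y, whose size is governed by the second digit of x.\<close>

lemma one_minus_ge:
  assumes x: "x \<in> irr"
  shows "1 / (4 * real (cf_digit x 1)) \<le> 1 - x"
proof -
  let ?y = "gauss_map x"
  have y: "?y \<in> irr" by (rule gauss_map_irr[OF x])
  have eq: "x = 1 / (real (cf_digit x 0) + ?y)" by (rule gauss_map_eq[OF x])
  have d1: "cf_digit x 1 = cf_digit ?y 0" using cf_digit_add[of x 1 0] by simp
  have d1_pos: "1 \<le> real (cf_digit x 1)" using cf_digit_pos[OF x, of 1] by simp
  show ?thesis
  proof (cases "cf_digit x 0 = 1")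
    case True
    have y01: "0 < ?y" "?y < 1" using y by (auto simp: irr_def)
    have "1 / (4 * real (cf_digit x 1)) \<le> 1 / (2 * (real (cf_digit x 1) + 1))"
      using d1_pos by (intro divide_left_mono) auto
    also have "\<dots> = 1 / (real (cf_digit ?y 0) + 1) / 2"
      by (simp add: d1[simplified])
    also have "\<dots> \<le> ?y / 2"
      by (intro divide_right_mono cf_digit_0_bounds(1)[OF y]) simp
    also have "\<dots> \<le> ?y / (1 + ?y)"
      using y01 by (intro divide_left_mono) auto
    also have "\<dots> = 1 - 1 / (1 + ?y)"
      using y01 by (simp add: field_simps)
    also have "\<dots> = 1 - x"
      using eq True by simp
    finally show ?thesis .
  next
    case False
    then have "2 \<le> cf_digit x 0" using cf_digit_pos[OF x, of 0] by simp
    then have "1 / real (cf_digit x 0) \<le> 1 / 2" by (intro divide_left_mono) auto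
    then have "x \<le> 1 / 2" using cf_digit_0_bounds(2)[OF x] by linarith
    moreover have "1 / (4 * real (cf_digit x 1)) \<le> 1 / 4"
      using d1_pos by (intro divide_left_mono) auto
    ultimately show ?thesis by linarith
  qed
qed

lemma one_minus_le:
  assumes x: "x \<in> irr" and "cf_digit x 0 = 1"
  shows "1 - x \<le> 1 / real (cf_digit x 1)"
proof -
  let ?y = "gauss_map x"
  have y: "?y \<in> irr" by (rule gauss_map_irr[OF x])
  have y01: "0 < ?y" "?y < 1" using y by (auto simp: irr_def)
  have "1 - x = 1 - 1 / (1 + ?y)" using gauss_map_eq[OF x] assms(2) by simp
  also have "\<dots> = ?y / (1 + ?y)" using y01 by (simp add: field_simps)
  also have "\<dots> \<le> ?y / 1" using y01 by (intro divide_left_mono) auto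
  also have "\<dots> \<le> 1 / real (cf_digit x 1)"
    using cf_digit_0_bounds(2)[OF y] cf_digit_add[of x 1 0] by simp
  finally show ?thesis .
qed

text \<open>
  \<open>\<theta>\<close> is a tail of a point and \<open>\<tau>\<close> the corresponding tail after the insertion of a block that starts
  with \<open>p, q\<close>; the comparison constant only depends on these two digits.
\<close>

lemma tail_comparison:
  fixes p q :: nat
  assumes \<theta>: "\<theta> \<in> irr" and \<tau>: "\<tau> \<in> irr" and p: "1 \<le> p" and q: "1 \<le> q"
    and digits: "cf_digit \<tau> 0 = cf_digit \<theta> 0 \<and> (cf_digit \<tau> 1 = cf_digit \<theta> 1 \<or> cf_digit \<tau> 1 = p) \<or>
      cf_digit \<tau> 0 = p \<and> cf_digit \<tau> 1 = q"
  shows "\<theta> \<le> 4 * real (p + q) * \<tau>" "1 - \<theta> \<le> 4 * real (p + q) * (1 - \<tau>)"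
proof -
  let ?M = "4 * real (p + q)"
  have \<theta>01: "0 < \<theta>" "\<theta> < 1" and \<tau>01: "0 < \<tau>" "\<tau> < 1" using \<theta> \<tau> by (auto simp: irr_def)
  have M: "8 \<le> ?M" using p q by simp
  have first: "\<theta> \<le> ?M * \<tau>" if "cf_digit \<tau> 0 = cf_digit \<theta> 0"
  proof -
    let ?a = "real (cf_digit \<theta> 0)"
    have a: "1 \<le> ?a" using cf_digit_pos[OF \<theta>, of 0] by simp
    have "\<theta> \<le> 1 / ?a" by (rule cf_digit_0_bounds(2)[OF \<theta>])
    also have "\<dots> \<le> 2 * (1 / (?a + 1))" using a by (simp add: field_simps)
    also have "\<dots> \<le> 2 * \<tau>" using cf_digit_0_bounds(1)[OF \<tau>] that by simp
    also have "\<dots> \<le> ?M * \<tau>" using M \<tau>01 by (intro mult_right_mono) auto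
    finally show ?thesis .
  qed
  \<comment> \<open>Applied with r = p or r = q, a digit of the inserted block: the side of \<tau>
    is then at least 1 / (4 r), while the side of \<theta> is at most 1.\<close>
  have block: "1 \<le> ?M * z" if "r \<le> p + q" "1 \<le> r" "1 / (4 * real r) \<le> z" for r :: nat and z
  proof -
    have "1 \<le> ?M * (1 / (4 * real r))"
      using that by (simp add: field_simps)
    also have "\<dots> \<le> ?M * z" using that M by (intro mult_left_mono) auto
    finally show ?thesis .
  qed
  have "1 / (4 * real p) \<le> \<tau>" if "cf_digit \<tau> 0 = p"
  proof -
    have "1 / (4 * real p) \<le> 1 / (real p + 1)" using p by (intro divide_left_mono) auto
    then show ?thesis using cf_digit_0_bounds(1)[OF \<tau>] that by simp
  qed
  then show "\<theta> \<le> ?M * \<tau>"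
    using digits first block[of p \<tau>] p \<theta>01 by fastforce
  have second: "1 - \<theta> \<le> ?M * (1 - \<tau>)" if r: "cf_digit \<tau> 1 = r" "r \<le> p + q" "1 \<le> r" for r
    using block[of r "1 - \<tau>"] one_minus_ge[OF \<tau>] r \<theta>01 by simp
  have third: "1 - \<theta> \<le> ?M * (1 - \<tau>)" if eq: "cf_digit \<tau> 0 = cf_digit \<theta> 0" "cf_digit \<tau> 1 = cf_digit \<theta> 1"
  proof (cases "cf_digit \<theta> 0 = 1")
    case True
    have "1 - \<theta> \<le> 1 / real (cf_digit \<theta> 1)" by (rule one_minus_le[OF \<theta> True])
    also have "\<dots> = 4 * (1 / (4 * real (cf_digit \<tau> 1)))" using eq by simp
    also have "\<dots> \<le> 4 * (1 - \<tau>)" using one_minus_ge[OF \<tau>] by (intro mult_left_mono) auto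
    also have "\<dots> \<le> ?M * (1 - \<tau>)" using M \<tau>01 by (intro mult_right_mono) auto
    finally show ?thesis .
  next
    case False
    then have "2 \<le> cf_digit \<tau> 0" using eq cf_digit_pos[OF \<tau>, of 0] by simp
    then have "1 / real (cf_digit \<tau> 0) \<le> 1 / 2" by (intro divide_left_mono) auto
    then have "1 / 2 \<le> 1 - \<tau>" using cf_digit_0_bounds(2)[OF \<tau>] by linarith
    then have "8 * (1 / 2) \<le> ?M * (1 - \<tau>)" using M by (intro mult_mono) auto
    then show ?thesis using \<theta>01 by simp
  qed
  show "1 - \<theta> \<le> ?M * (1 - \<tau>)"
    using digits second[of p] second[of q] third p q by auto
qed

text \<open>For a < b the difference has numerator (b - a - 1) + \<theta>' + (1 - \<theta>). If b =
  a + 1 only the last two summands remain and both may be tiny, so the tails must be comparable at 0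
  and at 1. The 4 bounds the ratio of the denominators, each of whose two factors changes by at most
  2.\<close>

lemma branch_comparison:
  fixes a b :: nat and \<theta> \<theta>' \<tau> \<tau>' M :: real
  assumes ab: "1 \<le> a" "1 \<le> b" "a \<noteq> b"
    and unit: "\<theta> \<in> {0<..<1}" "\<theta>' \<in> {0<..<1}" "\<tau> \<in> {0<..<1}" "\<tau>' \<in> {0<..<1}"
    and M: "1 \<le> M" and cmp: "\<theta> \<le> M * \<tau>" "\<theta>' \<le> M * \<tau>'" "1 - \<theta> \<le> M * (1 - \<tau>)" "1 - \<theta>' \<le> M * (1 - \<tau>')"
  shows "\<bar>1 / (a + \<theta>) - 1 / (b + \<theta>')\<bar> \<le> 4 * M * \<bar>1 / (a + \<tau>) - 1 / (b + \<tau>')\<bar>"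
  using assms
proof (induction a b arbitrary: \<theta> \<theta>' \<tau> \<tau>' rule: linorder_wlog)
  case (sym a b)
  then have "\<bar>1 / (b + \<theta>') - 1 / (a + \<theta>)\<bar> \<le> 4 * M * \<bar>1 / (b + \<tau>') - 1 / (a + \<tau>)\<bar>"
    by (intro sym) auto
  then show ?case by (simp add: abs_minus_commute)
next
  case (le a b)
  then have ab: "real a + 1 \<le> real b" "1 \<le> real a" by auto
  have diff: "\<bar>1 / (a + x) - 1 / (b + y)\<bar> = ((real b - real a - 1) + y + (1 - x)) / ((a + x) * (b + y))"
    if "x \<in> {0<..<1}" "y \<in> {0<..<1}" for x y :: real
  proof -
    have pos: "0 < a + x" "0 < b + y" using that ab by auto
    then have "1 / (a + x) - 1 / (b + y) = ((real b - real a - 1) + y + (1 - x)) / ((a + x) * (b + y))"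
      by (simp add: field_simps)
    moreover have "0 \<le> ((real b - real a - 1) + y + (1 - x)) / ((a + x) * (b + y))"
      using that ab pos by (intro divide_nonneg_nonneg) auto
    ultimately show ?thesis by (metis abs_of_nonneg)
  qed
  define num where "num x y = (real b - real a - 1) + y + (1 - x)" for x y :: real
  have num0: "0 \<le> num \<tau> \<tau>'" using le ab by (auto simp: num_def)
  have gap: "1 * (real b - real a - 1) \<le> M * (real b - real a - 1)"
    using ab le by (intro mult_right_mono) auto
  have "num \<theta> \<theta>' \<le> M * (real b - real a - 1) + M * \<tau>' + M * (1 - \<tau>)"
    unfolding num_def using gap le by (intro add_mono) simp_all
  also have "\<dots> = M * num \<tau> \<tau>'"
    by (simp add: num_def algebra_simps)
  finally have num: "num \<theta> \<theta>' \<le> M * num \<tau> \<tau>'" .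
  have den: "(a + \<tau>) * (b + \<tau>') \<le> 4 * ((a + \<theta>) * (b + \<theta>'))"
  proof -
    have "(a + \<tau>) * (b + \<tau>') \<le> (2 * (a + \<theta>)) * (2 * (b + \<theta>'))"
      using le ab by (intro mult_mono) auto
    moreover have "(2 * x) * (2 * y) = 4 * (x * y)" for x y :: real by simp
    ultimately show ?thesis by metis
  qed
  have pos: "0 < (a + \<tau>) * (b + \<tau>')" "0 < (a + \<theta>) * (b + \<theta>')"
    using le ab by auto
  have "num \<theta> \<theta>' / ((a + \<theta>) * (b + \<theta>')) \<le> M * num \<tau> \<tau>' / ((a + \<theta>) * (b + \<theta>'))"
    using num pos by (intro divide_right_mono) auto
  also have "\<dots> = 4 * (M * num \<tau> \<tau>') / (4 * ((a + \<theta>) * (b + \<theta>')))" by simp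
  also have "\<dots> \<le> 4 * (M * num \<tau> \<tau>') / ((a + \<tau>) * (b + \<tau>'))"
    using den pos num0 le by (intro divide_left_mono mult_nonneg_nonneg) auto
  finally show ?case
    using le unfolding num_def by (simp add: diff mult.assoc)
qed

section \<open>The insertion map and its distance estimate\<close>

fun insert_blocks :: "(nat \<Rightarrow> nat list) \<Rightarrow> (nat \<Rightarrow> nat) \<Rightarrow> (nat \<Rightarrow> nat) \<Rightarrow> nat \<Rightarrow> nat list" where
  "insert_blocks b m d 0 = []"
| "insert_blocks b m d (Suc k) = insert_blocks b m d k @ map d [m k..<m (Suc k)] @ b k"

text \<open>The common first digits \<open>p\<close>, \<open>q\<close> of all blocks make the
  constant of \<open>tail_comparison\<close> independent of \<open>k\<close>. Block
  \<open>b k\<close> comes after the first \<open>m (Suc k)\<close> free digits, so stage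
  \<open>k\<close> contains \<open>m k\<close> free digits and the blocks with index below
  \<open>k\<close>.\<close>

locale block_insertion =
  fixes b :: "nat \<Rightarrow> nat list" and m :: "nat \<Rightarrow> nat" and p q :: nat
  assumes m0: "m 0 = 0" and m_Suc: "\<And>k. m k < m (Suc k)"
    and b_pos: "\<And>k. 0 \<notin> set (b k)"
    and b_length: "\<And>k. 2 \<le> length (b k)"
    and b_first: "\<And>k. b k ! 0 = p" "\<And>k. b k ! 1 = q"
begin

abbreviation ins :: "real \<Rightarrow> nat \<Rightarrow> nat list" where
  "ins y k \<equiv> insert_blocks b m (cf_digit y) k"

lemma strict_mono_m: "strict_mono m"
  using m_Suc by (rule strict_mono_Suc_iff[THEN iffD2, rule_format])

lemma p_pos: "1 \<le> p" and q_pos: "1 \<le> q"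
proof -
  have "0 < length (b 0)" "1 < length (b 0)" using b_length[of 0] by auto
  then have "p \<in> set (b 0)" "q \<in> set (b 0)"
    using b_first[of 0] nth_mem[of 0 "b 0"] nth_mem[of 1 "b 0"] by metis+
  then have "p \<noteq> 0" "q \<noteq> 0" using b_pos[of 0] by metis+
  then show "1 \<le> p" "1 \<le> q" by simp_all
qed

lemma length_ins_ge: "k \<le> length (ins y k)"
proof (induction k)
  case (Suc k)
  then show ?case using m_Suc[of k] by simp
qed simp

lemma ins_cong:
  assumes "cf_prefix y (m k) = cf_prefix y' (m k)"
  shows "ins y k = ins y' k"
  using assms
proof (induction k)
  case (Suc k)
  have eq: "cf_digit y j = cf_digit y' j" if "j < m (Suc k)" for j
    using Suc.prems that by (metis cf_prefix_nth)
  then have "cf_prefix y (m k) = cf_prefix y' (m k)"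
    using m_Suc[of k] by (intro nth_equalityI) auto
  then show ?case using Suc.IH eq by simp
qed simp

lemma ins_pos: "y \<in> irr \<Longrightarrow> 0 \<notin> set (ins y k)"
proof (induction k)
  case (Suc k)
  have "0 \<notin> set (map (cf_digit y) [m k..<m (Suc k)])"
    using cf_digit_pos[OF Suc.prems] by (metis One_nat_def imageE list.set_map not_one_le_zero)
  then show ?case using Suc b_pos by auto
qed simp

lemma ins_prefix: "k \<le> l \<Longrightarrow> \<exists>w. ins y l = ins y k @ w"
proof (induction l)
  case (Suc l)
  then show ?case by (cases "k = Suc l") auto
qed simp

lemma ex_inserted:
  assumes "y \<in> irr"
  shows "\<exists>x\<in>irr. \<forall>k. cf_prefix x (length (ins y k)) = ins y k"
proof -
  \<comment> \<open>By \<open>length_ins_ge\<close> stage \<open>Suc j\<close> is long enough to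
    have a digit at index j, and later stages only extend it.\<close>
  define d where "d j = ins y (Suc j) ! j" for j
  have nth: "ins y k ! j = d j" if "j < length (ins y k)" for j k
  proof (cases "k \<le> Suc j")
    case True
    then obtain w where "ins y (Suc j) = ins y k @ w" using ins_prefix by blast
    then show ?thesis using that by (simp add: d_def nth_append del: insert_blocks.simps)
  next
    case False
    then obtain w where w: "ins y k = ins y (Suc j) @ w" using ins_prefix[of "Suc j" k y] by auto
    have "j < length (ins y (Suc j))" using length_ins_ge[of "Suc j" y] by linarith
    then show ?thesis using w by (simp add: d_def nth_append del: insert_blocks.simps)
  qed
  have "1 \<le> d j" for j
  proof -
    have "j < length (ins y (Suc j))" using length_ins_ge[of "Suc j" y] by linarith
    then have "d j \<in> set (ins y (Suc j))" unfolding d_def by (rule nth_mem)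
    then have "d j \<noteq> 0" using ins_pos[OF assms, of "Suc j"] by metis
    then show ?thesis by simp
  qed
  then obtain x where x: "x \<in> irr" "\<And>n. cf_digit x n = d n" using ex_cf_digits by blast
  have "cf_prefix x (length (ins y k)) = ins y k" for k
    by (rule nth_equalityI) (auto simp: x nth)
  then show ?thesis using x by blast
qed

definition inserted :: "real \<Rightarrow> real" where
  "inserted y = (SOME x. x \<in> irr \<and> (\<forall>k. cf_prefix x (length (ins y k)) = ins y k))"

lemma inserted:
  assumes "y \<in> irr"
  shows "inserted y \<in> irr" "cf_prefix (inserted y) (length (ins y k)) = ins y k"
  using someI_ex[OF ex_inserted[OF assms, unfolded Bex_def]] unfolding inserted_def by auto

lemma inserted_free_digit:
  assumes y: "y \<in> irr" and r: "m k + r < m (Suc k)"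
  shows "cf_digit (inserted y) (length (ins y k) + r) = cf_digit y (m k + r)"
proof -
  have "cf_digit (inserted y) (length (ins y k) + r) = ins y (Suc k) ! (length (ins y k) + r)"
    using cf_prefix_nth[of "length (ins y k) + r" "length (ins y (Suc k))" "inserted y"] r
    by (simp add: inserted(2)[OF y] del: insert_blocks.simps) simp
  moreover have "r < m (Suc k) - m k" using r by simp
  ultimately show ?thesis by (simp add: nth_append)
qed

lemma inserted_block_digit:
  assumes y: "y \<in> irr" and r: "r < length (b k)"
  shows "cf_digit (inserted y) (length (ins y k) + (m (Suc k) - m k) + r) = b k ! r"
proof -
  have "cf_digit (inserted y) (length (ins y k) + (m (Suc k) - m k) + r) =
      ins y (Suc k) ! (length (ins y k) + (m (Suc k) - m k) + r)"
    using cf_prefix_nth[of "length (ins y k) + (m (Suc k) - m k) + r" "length (ins y (Suc k))" "inserted y"] r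
    by (simp add: inserted(2)[OF y] del: insert_blocks.simps) simp
  then show ?thesis using r by (simp add: nth_append)
qed

text \<open>A block contributes at most \<open>D k\<close>, and the changed argument behind the free
  digits before it costs 2 by \<open>cf_den_distortion\<close>; this is the recursion of
  \<open>E\<close>. The arguments \<open>v\<close> and \<open>v'\<close> are unrelated because the
  two words continue differently.\<close>

lemma ins_den_le:
  assumes y: "y \<in> irr" and D: "\<And>k v. v \<in> {0..1} \<Longrightarrow> cf_den (b k) v \<le> D k"
    and E0: "E 0 = 1" and E_Suc: "\<And>k. E (Suc k) = 2 * E k * D k"
    and v: "v \<in> {0..1}" "v' \<in> {0..1}"
  shows "0 \<le> E k \<and> cf_den (ins y k) v \<le> E k * cf_den (cf_prefix y (m k)) v'"
  using v
proof (induction k arbitrary: v v')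
  case 0
  then show ?case by (simp add: m0 E0)
next
  case (Suc k)
  let ?S = "map (cf_digit y) [m k..<m (Suc k)]"
  have S: "0 \<notin> set ?S"
    using cf_digit_pos[OF y] by (metis One_nat_def imageE list.set_map not_one_le_zero)
  have D1: "1 \<le> D k"
    using D[of 0 k] cf_den_pos[OF b_pos[of k], of 0] by simp
  have pre: "cf_prefix y (m (Suc k)) = cf_prefix y (m k) @ ?S"
    using m_Suc[of k] by (intro nth_equalityI) (auto simp: nth_append)
  have bv: "cf_map (b k) v \<in> {0..1}" by (rule cf_map_unit[OF b_pos Suc.prems(1)])
  have Sbv: "cf_map ?S (cf_map (b k) v) \<in> {0..1}" by (rule cf_map_unit[OF S bv])
  have Sv: "cf_map ?S v' \<in> {0..1}" by (rule cf_map_unit[OF S Suc.prems(2)])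
  note IH = Suc.IH[OF Sbv Sv]
  have pos: "0 \<le> cf_den (cf_prefix y (m k)) (cf_map ?S v')" "0 \<le> cf_den ?S (cf_map (b k) v)"
    "0 \<le> cf_den ?S v'" "0 \<le> cf_den (b k) v"
    using cf_den_pos[OF cf_prefix_pos[OF y] Sv, of "m k"] cf_den_pos[OF S bv] cf_den_pos[OF S Suc.prems(2)]
      cf_den_pos[OF b_pos Suc.prems(1), of k] by linarith+
  have "cf_den (ins y (Suc k)) v =
      cf_den (ins y k) (cf_map ?S (cf_map (b k) v)) * (cf_den ?S (cf_map (b k) v) * cf_den (b k) v)"
    by (simp add: cf_den_append cf_map_append)
  also have "\<dots> \<le> (E k * cf_den (cf_prefix y (m k)) (cf_map ?S v')) * ((2 * cf_den ?S v') * D k)"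
    using IH pos D1 D[OF Suc.prems(1), of k] cf_den_distortion[OF S bv Suc.prems(2)]
    by (intro mult_mono mult_nonneg_nonneg) auto
  also have "\<dots> = E (Suc k) * cf_den (cf_prefix y (m (Suc k))) v'"
    unfolding pre by (simp add: cf_den_append E_Suc)
  finally show ?case using IH D1 by (auto simp: E_Suc)
qed

text \<open>Let j be the first index where the digits differ and k the number of blocks inserted
  before it. \<open>cf_map_diff\<close> expresses both distances by tails and denominators behind
  the common prefixes. The tails cost 4 * 4 (p + q) by \<open>branch_comparison\<close>, the two
  denominators (2 \<open>E k\<close>)^2, which makes 64 (p + q)
  \<open>(E k)\<^sup>2\<close>.\<close>

lemma inserted_distance:
  assumes y: "y \<in> irr" "y' \<in> irr" "y \<noteq> y'"
    and D: "\<And>k v. v \<in> {0..1} \<Longrightarrow> cf_den (b k) v \<le> D k"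
    and E0: "E 0 = 1" and E_Suc: "\<And>k. E (Suc k) = 2 * E k * D k"
  shows "\<exists>k. \<bar>y - y'\<bar> \<le> 64 * real (p + q) * (E k)\<^sup>2 * \<bar>inserted y - inserted y'\<bar> \<and>
    \<bar>y - y'\<bar> \<le> 1 / (cf_den (cf_prefix y (m k)) ((gauss_map ^^ m k) y) * cf_den (cf_prefix y' (m k)) ((gauss_map ^^ m k) y'))"
proof -
  have "\<exists>j. cf_digit y j \<noteq> cf_digit y' j"
  proof (rule ccontr)
    assume "\<nexists>j. cf_digit y j \<noteq> cf_digit y' j"
    then have le: "\<bar>y - y'\<bar> \<le> 2 * (1 / 2) ^ n" for n
      by (intro cf_prefix_eq_imp_close y) (simp add: cf_prefix_def)
    have "(\<lambda>n. 2 * (1 / 2 :: real) ^ n) \<longlonglongrightarrow> 2 * 0"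
      by (intro tendsto_mult_left LIMSEQ_realpow_zero) auto
    then have "\<bar>y - y'\<bar> \<le> 2 * 0" by (rule LIMSEQ_le_const) (use le in blast)
    then show False using y by simp
  qed
  then obtain j where j: "cf_digit y j \<noteq> cf_digit y' j" and least: "\<And>i. i < j \<Longrightarrow> cf_digit y i = cf_digit y' i"
    using exists_least_iff[of "\<lambda>j. cf_digit y j \<noteq> cf_digit y' j"] by blast
  obtain k where k: "m k \<le> j" "j < m (Suc k)"
  proof -
    have "\<exists>n. j < m n"
      using strict_mono_imp_increasing[OF strict_mono_m, of "Suc j"] by (auto intro!: exI[of _ "Suc j"])
    then obtain n where n: "j < m n" "\<And>i. i < n \<Longrightarrow> \<not> j < m i"
      using exists_least_iff[of "\<lambda>n. j < m n"] by blast
    then show ?thesis using that[of "n - 1"] n(2)[of "n - 1"] m0 by (cases n) (auto simp: not_less)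
  qed
  let ?x = "inserted y" and ?x' = "inserted y'"
  let ?S = "map (cf_digit y) [m k..<j]"
  let ?w = "ins y k @ ?S" and ?pre = "cf_prefix y j"
  define l where "l = length (ins y k)"
  define N where "N = l + (j - m k)"
  have pre_k: "cf_prefix y (m k) = cf_prefix y' (m k)"
    using k least by (intro nth_equalityI) auto
  have ins_eq: "ins y' k = ins y k" by (rule ins_cong[OF pre_k[symmetric]])
  have prefix: "cf_prefix (inserted z) N = ?w" if z: "z \<in> irr" and same: "\<And>i. i < j \<Longrightarrow> cf_digit z i = cf_digit y i"
    and insz: "ins z k = ins y k" for z
  proof (rule nth_equalityI)
    fix i assume "i < length (cf_prefix (inserted z) N)"
    then have i: "i < N" by simp
    show "cf_prefix (inserted z) N ! i = ?w ! i"
    proof (cases "i < l")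
      case True
      have "cf_digit (inserted z) i = ins z k ! i"
        using inserted(2)[OF z, of k] True insz by (metis cf_prefix_nth l_def)
      then show ?thesis using i True insz by (simp add: nth_append l_def)
    next
      case False
      then obtain r where r: "i = l + r" by (metis le_Suc_ex not_less)
      have r': "m k + r < j" using r i k by (simp add: N_def)
      have "cf_digit (inserted z) i = cf_digit z (m k + r)"
        using inserted_free_digit[OF z, of k r] r r' k insz by (simp add: l_def)
      then show ?thesis using i r r' same[OF r'] by (simp add: nth_append l_def)
    qed
  qed (simp add: N_def l_def)
  have wx: "cf_prefix ?x N = ?w" "cf_prefix ?x' N = ?w"
    using prefix[OF y(1)] prefix[OF y(2)] least ins_eq by auto
  have prey: "cf_prefix y' j = ?pre"
    using least by (intro nth_equalityI) auto
  \<comment> \<open>\<open>u z\<close> is the tail of \<open>z\<close> from the first differing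
    digit on, \<open>v z\<close> the tail of the image from the same digit on, which has moved to
    index \<open>N\<close>.\<close>
  define u where "u z = (gauss_map ^^ j) z" for z
  define v where "v z = (gauss_map ^^ N) (inserted z)" for z
  have u: "u z \<in> irr" and v: "v z \<in> irr" if "z \<in> irr" for z
    using gauss_map_funpow_irr inserted(1) that by (auto simp: u_def v_def)
  have dig_u: "cf_digit (u z) r = cf_digit z (j + r)" for z r
    by (simp add: u_def cf_digit_add)
  have free: "cf_digit (v z) r = cf_digit (u z) r" if z: "z \<in> irr" "ins z k = ins y k" and r: "j + r < m (Suc k)" for z r
  proof -
    have "cf_digit (v z) r = cf_digit (inserted z) (length (ins z k) + (j - m k + r))"
      using z by (simp add: v_def N_def l_def cf_digit_add[symmetric] add.assoc)
    also have "\<dots> = cf_digit z (m k + (j - m k + r))"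
      using r k by (intro inserted_free_digit z) auto
    finally show ?thesis using k by (simp add: dig_u)
  qed
  have block: "cf_digit (v z) r = b k ! s" if z: "z \<in> irr" "ins z k = ins y k" and r: "j + r = m (Suc k) + s" "s < length (b k)" for z r s
  proof -
    have "N + r = length (ins z k) + (m (Suc k) - m k) + s"
      using z(2) r k unfolding N_def l_def by simp
    then have "cf_digit (v z) r = cf_digit (inserted z) (length (ins z k) + (m (Suc k) - m k) + s)"
      by (simp add: v_def cf_digit_add[symmetric])
    also have "\<dots> = b k ! s"
      by (intro inserted_block_digit z r)
    finally show ?thesis .
  qed
  let ?M = "4 * real (p + q)"
  have cmp: "gauss_map (u z) \<le> ?M * gauss_map (v z)" "1 - gauss_map (u z) \<le> ?M * (1 - gauss_map (v z))"
    if z: "z \<in> irr" "ins z k = ins y k" for z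
  proof -
    have shift: "cf_digit (gauss_map t) r = cf_digit t (Suc r)" for t r
      by (simp add: cf_digit_Suc)
    have b0: "b k ! 0 = p" "b k ! 1 = q" "0 < length (b k)" "1 < length (b k)"
      using b_first[of k] b_length[of k] by auto
    have digits: "cf_digit (v z) 1 = cf_digit (u z) 1 \<and> (cf_digit (v z) 2 = cf_digit (u z) 2 \<or> cf_digit (v z) 2 = p) \<or>
        cf_digit (v z) 1 = p \<and> cf_digit (v z) 2 = q"
    proof -
      \<comment> \<open>The two digits behind the differing one are both free, or the second opens
        the next block, or both belong to it.\<close>
      consider "j + 2 < m (Suc k)" | "j + 2 = m (Suc k)" | "j + 1 = m (Suc k)" using k by linarith
      then show ?thesis
      proof cases
        case 1
        then show ?thesis using free[OF z, of 1] free[OF z, of 2] by simp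
      next
        case 2
        then show ?thesis using free[OF z, of 1] block[OF z, of 2 0] b0 by simp
      next
        case 3
        then show ?thesis using block[OF z, of 1 0] block[OF z, of 2 1] b0 by simp
      qed
    qed
    show "gauss_map (u z) \<le> ?M * gauss_map (v z)" "1 - gauss_map (u z) \<le> ?M * (1 - gauss_map (v z))"
      by (rule tail_comparison[OF gauss_map_irr[OF u[OF z(1)]] gauss_map_irr[OF v[OF z(1)]] p_pos q_pos],
          use digits in \<open>simp add: shift numeral_2_eq_2\<close>)+
  qed
  have u_eq: "u z = 1 / (real (cf_digit z j) + gauss_map (u z))" if "z \<in> irr" for z
    using gauss_map_eq[OF u[OF that]] by (simp add: dig_u)
  have v_eq: "v z = 1 / (real (cf_digit z j) + gauss_map (v z))" if "z \<in> irr" "ins z k = ins y k" for z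
    using gauss_map_eq[OF v[OF that(1)]] free[OF that, of 0] k by (simp add: dig_u)
  have unit_open: "gauss_map z \<in> {0<..<1}" if "z \<in> irr" for z
    using gauss_map_irr[OF that] by (simp add: irr_def)
  have "\<bar>1 / (real (cf_digit y j) + gauss_map (u y)) - 1 / (real (cf_digit y' j) + gauss_map (u y'))\<bar> \<le>
      4 * ?M * \<bar>1 / (real (cf_digit y j) + gauss_map (v y)) - 1 / (real (cf_digit y' j) + gauss_map (v y'))\<bar>"
    using p_pos j by (intro branch_comparison unit_open u v y cmp ins_eq refl cf_digit_pos) auto
  then have uv: "\<bar>u y - u y'\<bar> \<le> 4 * ?M * \<bar>v y - v y'\<bar>"
    using u_eq[OF y(1)] u_eq[OF y(2)] v_eq[OF y(1) refl] v_eq[OF y(2) ins_eq] by simp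
  have w0: "0 \<notin> set ?w"
    using cf_prefix_pos[OF inserted(1)[OF y(1)], of N] wx by simp
  have S0: "0 \<notin> set ?S" using w0 by simp
  have pre0: "0 \<notin> set ?pre" by (rule cf_prefix_pos[OF y(1)])
  have dy: "\<bar>y - y'\<bar> = \<bar>u y - u y'\<bar> / (cf_den ?pre (u y) * cf_den ?pre (u y'))"
    using cf_map_diff[OF pre0 irr_unit[OF u[OF y(1)]] irr_unit[OF u[OF y(2)]]]
      cf_map_prefix[OF y(1), of j] cf_map_prefix[OF y(2), of j] prey by (simp add: u_def)
  have dx: "\<bar>?x - ?x'\<bar> = \<bar>v y - v y'\<bar> / (cf_den ?w (v y) * cf_den ?w (v y'))"
    using cf_map_diff[OF w0 irr_unit[OF v[OF y(1)]] irr_unit[OF v[OF y(2)]]]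
      cf_map_prefix[OF inserted(1)[OF y(1)], of N] cf_map_prefix[OF inserted(1)[OF y(2)], of N] wx
    by (simp add: v_def)
  have pre_split: "?pre = cf_prefix y (m k) @ ?S"
    using k by (intro nth_equalityI) (auto simp: nth_append)
  have E: "0 \<le> E k" using ins_den_le[OF y(1) D E0 E_Suc, of 0 0 k] by simp
  have den: "cf_den ?w (v z) \<le> 2 * E k * cf_den ?pre (u z)" if "z \<in> irr" for z
  proof -
    note uz = irr_unit[OF u[OF that]] and vz = irr_unit[OF v[OF that]]
    have "cf_den ?w (v z) = cf_den (ins y k) (cf_map ?S (v z)) * cf_den ?S (v z)"
      by (simp add: cf_den_append)
    also have "\<dots> \<le> (E k * cf_den (cf_prefix y (m k)) (cf_map ?S (u z))) * (2 * cf_den ?S (u z))"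
      using ins_den_le[OF y(1) D E0 E_Suc cf_map_unit[OF S0 vz] cf_map_unit[OF S0 uz], of k]
        cf_den_pos[OF cf_prefix_pos[OF y(1)] cf_map_unit[OF S0 uz], of "m k"]
        cf_den_distortion[OF S0 vz uz] cf_den_pos[OF S0 vz] E
      by (intro mult_mono mult_nonneg_nonneg) auto
    also have "\<dots> = 2 * E k * cf_den ?pre (u z)"
      unfolding pre_split by (simp add: cf_den_append)
    finally show ?thesis .
  qed
  have pos: "1 \<le> cf_den ?pre (u z)" "1 \<le> cf_den ?w (v z)" if "z \<in> irr" for z
    using cf_den_pos[OF pre0 irr_unit[OF u[OF that]]] cf_den_pos[OF w0 irr_unit[OF v[OF that]]] by auto
  define P where "P = cf_den ?pre (u y) * cf_den ?pre (u y')"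
  define W where "W = cf_den ?w (v y) * cf_den ?w (v y')"
  have PW: "0 < P" "0 < W"
    using pos[OF y(1)] pos[OF y(2)] by (auto simp: P_def W_def)
  have "W \<le> (2 * E k * cf_den ?pre (u y)) * (2 * E k * cf_den ?pre (u y'))"
    unfolding W_def using den[OF y(1)] den[OF y(2)] pos[OF y(1)] pos[OF y(2)] E by (intro mult_mono) auto
  also have "\<dots> = 4 * (E k)\<^sup>2 * P"
    by (simp add: P_def power2_eq_square)
  finally have WP: "W \<le> 4 * (E k)\<^sup>2 * P" .
  have "\<bar>y - y'\<bar> \<le> 4 * ?M * \<bar>v y - v y'\<bar> / P"
    unfolding dy P_def[symmetric] using uv PW by (intro divide_right_mono) auto
  also have "\<bar>v y - v y'\<bar> = W * \<bar>?x - ?x'\<bar>"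
    unfolding dx W_def[symmetric] using PW by simp
  also have "4 * ?M * (W * \<bar>?x - ?x'\<bar>) / P \<le> 4 * ?M * ((4 * (E k)\<^sup>2 * P) * \<bar>?x - ?x'\<bar>) / P"
    using WP PW by (intro divide_right_mono mult_left_mono mult_right_mono) auto
  also have "\<dots> = 64 * real (p + q) * (E k)\<^sup>2 * \<bar>?x - ?x'\<bar>"
    using PW by simp
  finally have A: "\<bar>y - y'\<bar> \<le> 64 * real (p + q) * (E k)\<^sup>2 * \<bar>?x - ?x'\<bar>" .
  \<comment> \<open>The second estimate uses only the common prefix of length \<open>m k\<close>,
    because the size of \<open>E k\<close> will be measured against \<open>m k\<close>.\<close>
  let ?pk = "cf_prefix y (m k)"
  define t where "t z = (gauss_map ^^ m k) z" for z
  have t: "t z \<in> {0..1}" if "z \<in> irr" for z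
    unfolding t_def by (rule irr_unit[OF gauss_map_funpow_irr[OF that]])
  have pk0: "0 \<notin> set ?pk" by (rule cf_prefix_pos[OF y(1)])
  have "\<bar>y - y'\<bar> = \<bar>t y - t y'\<bar> / (cf_den ?pk (t y) * cf_den ?pk (t y'))"
    using cf_map_diff[OF pk0 t[OF y(1)] t[OF y(2)]]
      cf_map_prefix[OF y(1), of "m k"] cf_map_prefix[OF y(2), of "m k"] pre_k by (simp add: t_def)
  also have "\<dots> \<le> 1 / (cf_den ?pk (t y) * cf_den ?pk (t y'))"
    using t[OF y(1)] t[OF y(2)] cf_den_pos[OF pk0 t[OF y(1)]] cf_den_pos[OF pk0 t[OF y(2)]]
    by (intro divide_right_mono mult_nonneg_nonneg) auto
  finally have "\<bar>y - y'\<bar> \<le> 1 / (cf_den ?pk (t y) * cf_den (cf_prefix y' (m k)) (t y'))"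
    using pre_k by simp
  with A show ?thesis unfolding t_def by blast
qed

end

section \<open>The Hausdorff dimension of the recurrent set\<close>

text \<open>
  A mass distribution principle: \<open>f\<close> has an \<open>s\<close>-Hoelder inverse, so it transports Lebesgue measure
  on \<open>G\<close> to a measure that gives a set of diameter \<open>r\<close> at most a multiple of \<open>r powr s\<close>.
\<close>

lemma hausdorff_measure_nonzero:
  fixes f :: "real \<Rightarrow> real"
  assumes G [measurable]: "G \<in> sets borel" and pos: "0 < measure unit_lborel G"
    and W: "f ` G \<subseteq> W" and s: "0 < s" and C: "0 < C"
    and holder: "\<And>y y'. y \<in> G \<Longrightarrow> y' \<in> G \<Longrightarrow> \<bar>y - y'\<bar> powr (1 / s) \<le> C * \<bar>f y - f y'\<bar>"
  shows "hausdorff_measure s W \<noteq> 0"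
proof -
  define K where "K = 2 * C powr s"
  define g where "g = measure unit_lborel G"
  have K: "0 < K" using C by (simp add: K_def)
  \<comment> \<open>\<open>f\<close> is arbitrary, so its preimages may fail to be measurable; each
    is enclosed in an interval around one of its points. For diameter r the radius is (C r)^s, which
    accounts for \<open>K\<close>.\<close>
  have piece: "\<exists>V. V \<in> sets borel \<and> G \<inter> f -` U \<subseteq> V \<and> emeasure unit_lborel V \<le> ennreal K * diam_powr s U"
    if U: "bounded U" for U
  proof (cases "G \<inter> f -` U = {}")
    case True
    then show ?thesis by (intro exI[of _ "{}"]) auto
  next
    case False
    then obtain y0 where y0: "y0 \<in> G" "f y0 \<in> U" by auto
    let ?D = "diameter U"
    define \<rho> where "\<rho> = (C * ?D) powr s"
    have D: "0 \<le> ?D" by (rule diameter_ge_0[OF U])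
    have "\<bar>y - y0\<bar> \<le> \<rho>" if y: "y \<in> G" "f y \<in> U" for y
    proof -
      have "\<bar>y - y0\<bar> powr (1 / s) \<le> C * \<bar>f y - f y0\<bar>" by (rule holder[OF y(1) y0(1)])
      also have "\<dots> \<le> C * ?D"
        using diameter_bounded_bound[OF U y(2) y0(2)] C by (intro mult_left_mono) (auto simp: dist_real_def)
      finally have "(\<bar>y - y0\<bar> powr (1 / s)) powr s \<le> (C * ?D) powr s"
        using s by (intro powr_mono2) auto
      then show ?thesis using s by (simp add: powr_powr \<rho>_def)
    qed
    then have "G \<inter> f -` U \<subseteq> {y0 - \<rho>..y0 + \<rho>}" by (force simp: abs_le_iff)
    moreover have "emeasure unit_lborel {y0 - \<rho>..y0 + \<rho>} \<le> ennreal K * diam_powr s U"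
    proof -
      have "emeasure unit_lborel {y0 - \<rho>..y0 + \<rho>} \<le> ennreal (2 * \<rho>)"
        using emeasure_unit_interval[of "y0 - \<rho>" "y0 + \<rho>"] by (simp add: \<rho>_def)
      also have "2 * \<rho> = K * ?D powr s"
        using C D by (simp add: \<rho>_def K_def powr_mult)
      also have "ennreal \<dots> = ennreal K * diam_powr s U"
        using y0 s K by (auto simp: diam_powr_def ennreal_mult)
      finally show ?thesis .
    qed
    ultimately show ?thesis by (intro exI[of _ "{y0 - \<rho>..y0 + \<rho>}"]) auto
  qed
  have "ennreal (g / K) \<le> hausdorff_premeasure s 1 W"
    unfolding hausdorff_premeasure_def
  proof (rule Inf_greatest, safe)
    fix U :: "nat \<Rightarrow> real set"
    assume cover: "W \<subseteq> (\<Union>k. U k)" and "\<forall>k. bounded (U k) \<and> diameter (U k) \<le> 1"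
    then have "\<forall>k. \<exists>V. V \<in> sets borel \<and> G \<inter> f -` U k \<subseteq> V \<and>
        emeasure unit_lborel V \<le> ennreal K * diam_powr s (U k)"
      using piece by blast
    then obtain V where V: "\<And>k. V k \<in> sets borel" "\<And>k. G \<inter> f -` U k \<subseteq> V k"
      "\<And>k. emeasure unit_lborel (V k) \<le> ennreal K * diam_powr s (U k)"
      by metis
    have "G \<subseteq> (\<Union>k. V k)"
    proof
      fix y assume y: "y \<in> G"
      then obtain k where "f y \<in> U k" using cover W by blast
      then show "y \<in> (\<Union>k. V k)" using V(2)[of k] y by blast
    qed
    then have "emeasure unit_lborel G \<le> emeasure unit_lborel (\<Union>k. V k)"
      using V(1) by (intro emeasure_mono) auto
    also have "\<dots> \<le> (\<Sum>k. emeasure unit_lborel (V k))"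
      using V(1) by (intro emeasure_subadditive_countably) auto
    also have "\<dots> \<le> (\<Sum>k. ennreal K * diam_powr s (U k))"
      by (intro suminf_le V(3)) auto
    also have "\<dots> = ennreal K * (\<Sum>k. diam_powr s (U k))"
      by simp
    finally have le: "ennreal g \<le> ennreal K * (\<Sum>k. diam_powr s (U k))"
      by (simp add: g_def unit.emeasure_eq_measure)
    show "ennreal (g / K) \<le> (\<Sum>k. diam_powr s (U k))"
    proof (cases "\<Sum>k. diam_powr s (U k)" rule: ennreal_cases)
      case (real r)
      then have "g \<le> K * r" using le K by (simp add: ennreal_mult[symmetric] ennreal_le_iff)
      then have "g / K \<le> r" using K by (simp add: divide_le_eq mult.commute)
      then show ?thesis using real by (simp add: ennreal_leI)
    qed simp
  qed
  also have "\<dots> \<le> hausdorff_measure s W"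
    unfolding hausdorff_measure_def by (rule SUP_upper) simp
  finally show ?thesis
    using pos K by (auto simp: g_def)
qed

text \<open>
  \<open>m k\<close> counts the free digits before the \<open>k\<close>-th block, \<open>l k\<close> all digits up to the end of the block
  before it, and \<open>E k\<close> bounds the factor by which the inserted blocks enlarge the denominators.
\<close>

lemma ex_block_positions:
  fixes T :: "nat \<Rightarrow> nat" and D :: "nat \<Rightarrow> real"
  assumes \<alpha>: "0 < \<alpha>" "\<alpha> < \<kappa>" and D0: "\<And>n. 0 \<le> D n"
    and D: "\<And>n. n \<ge> n0 \<Longrightarrow> D n \<le> exp (\<alpha> * real n)"
  shows "\<exists>m l E. m 0 = 0 \<and> l 0 = 0 \<and> E 0 = 1 \<and> (\<forall>k. m k < m (Suc k) \<and> N \<le> m (Suc k) \<and>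
    l (Suc k) = l k + (m (Suc k) - m k) + Suc (T (l k + (m (Suc k) - m k))) \<and>
    E (Suc k) = 2 * E k * D (l k + (m (Suc k) - m k)) \<and> 0 \<le> E k \<and> E k \<le> exp (\<kappa> * real (m k)))"
proof -
  define P :: "nat \<Rightarrow> nat \<times> nat \<times> real \<Rightarrow> bool" where
    "P k = (\<lambda>(m, l, E). 0 \<le> E \<and> E \<le> exp (\<kappa> * real m) \<and> (k = 0 \<longrightarrow> m = 0 \<and> l = 0 \<and> E = 1))" for k
  define Q :: "nat \<Rightarrow> nat \<times> nat \<times> real \<Rightarrow> nat \<times> nat \<times> real \<Rightarrow> bool" where
    "Q k = (\<lambda>(m, l, E) (m', l', E'). m < m' \<and> N \<le> m' \<and>
      l' = l + (m' - m) + Suc (T (l + (m' - m))) \<and> E' = 2 * E * D (l + (m' - m)))" for k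
  have "\<exists>f. \<forall>k. P k (f k) \<and> Q k (f k) (f (Suc k))"
  proof (rule dependent_nat_choice)
    show "\<exists>z. P 0 z" by (rule exI[of _ "(0, 0, 1)"]) (simp add: P_def)
    fix z k assume "P k z"
    obtain m l E where z: "z = (m, l, E)" by (cases z) auto
    have E: "0 \<le> E" using \<open>P k z\<close> by (simp add: P_def z)
    \<comment> \<open>With E and l already fixed, a large m' makes exp ((\<kappa> - \<alpha>) m')
      exceed 2 E exp (\<alpha> l), the cost of all that came before; \<open>r\<close> achieves this
      through 1 + x \<le> exp x. The summand \<open>n0\<close> in m' makes the bound on
      \<open>D\<close> applicable.\<close>
    obtain r where r: "2 * E * exp (\<alpha> * real l) / (\<kappa> - \<alpha>) \<le> real r"
      using real_arch_simple by blast
    define m' where "m' = Suc (m + N + n0 + r)"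
    let ?n = "l + (m' - m)"
    have "2 * E * exp (\<alpha> * real l) \<le> real r * (\<kappa> - \<alpha>)"
      using r \<alpha> by (simp add: pos_divide_le_eq)
    also have "\<dots> \<le> real m' * (\<kappa> - \<alpha>)"
      using \<alpha> by (intro mult_right_mono) (auto simp: m'_def)
    also have "\<dots> \<le> exp ((\<kappa> - \<alpha>) * real m')"
      unfolding mult.commute[of "real m'"] using exp_ge_add_one_self[of "(\<kappa> - \<alpha>) * real m'"] by linarith
    finally have big: "2 * E * exp (\<alpha> * real l) \<le> exp ((\<kappa> - \<alpha>) * real m')" .
    have "2 * E * D ?n \<le> 2 * E * exp (\<alpha> * real ?n)"
      using E by (intro mult_left_mono D) (auto simp: m'_def)
    also have "\<dots> \<le> 2 * E * exp (\<alpha> * (real l + real m'))"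
      using E \<alpha> by (intro mult_left_mono) (auto simp: m'_def)
    also have "\<dots> = 2 * E * exp (\<alpha> * real l) * exp (\<alpha> * real m')"
      by (simp add: distrib_left exp_add)
    also have "\<dots> \<le> exp ((\<kappa> - \<alpha>) * real m') * exp (\<alpha> * real m')"
      using big by (intro mult_right_mono) auto
    also have "\<dots> = exp (\<kappa> * real m')"
      by (simp add: exp_add[symmetric] left_diff_distrib)
    finally have "2 * E * D ?n \<le> exp (\<kappa> * real m')" .
    moreover have "0 \<le> 2 * E * D ?n" using E D0 by simp
    ultimately have "P (Suc k) (m', ?n + Suc (T ?n), 2 * E * D ?n)"
      by (simp add: P_def)
    moreover have "Q k z (m', ?n + Suc (T ?n), 2 * E * D ?n)"
      by (simp add: Q_def z m'_def)
    ultimately show "\<exists>z'. P (Suc k) z' \<and> Q k z z'" by blast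
  qed
  then obtain f where f: "\<And>k. P k (f k)" "\<And>k. Q k (f k) (f (Suc k))" by blast
  define m where "m k = fst (f k)" for k
  define l where "l k = fst (snd (f k))" for k
  define E where "E k = snd (snd (f k))" for k
  have f_eq: "f k = (m k, l k, E k)" for k by (simp add: m_def l_def E_def)
  show ?thesis
    by (rule exI[of _ m], rule exI[of _ l], rule exI[of _ E])
       (use f(1)[of 0] f in \<open>simp add: f_eq P_def Q_def\<close>)
qed

text \<open>With \<gamma> = 1/s - 1 the power |y - y'|^(1/s) splits into |y - y'|, at most a
  constant times E^2 times the distance of the images, and |y - y'|^\<gamma>, at most exp (-2
  \<beta> \<gamma> m). Since \<alpha> < \<beta> \<gamma>, positions exist with E \<le> exp (\<beta>
  \<gamma> m), and the two factors cancel.\<close>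

lemma hausdorff_measure_recurrent_nonzero:
  fixes i t :: "nat \<Rightarrow> nat"
  assumes i: "\<And>n. 1 \<le> i n" and s: "0 < s"
    and \<beta>: "0 \<le> \<beta>" "\<beta> < pi\<^sup>2 / (12 * ln 2)"
    and \<alpha>: "0 < \<alpha>" "\<alpha> < \<beta> * (1 / s - 1)"
    and ev: "eventually (\<lambda>n. (\<Prod>j\<le>max (t n) 1. real (i j) + 1) \<le> exp (\<alpha> * real n)) sequentially"
  shows "hausdorff_measure s (recurrent_block_set i t) \<noteq> 0"
proof -
  define \<gamma> where "\<gamma> = 1 / s - 1"
  \<comment> \<open>Blocks get at least two digits so that all of them begin with
    \<open>i 0\<close>, \<open>i 1\<close>; a longer block still contains the required one.\<close>
  define T where "T n = max (t n) 1" for n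
  define D where "D n = (\<Prod>j\<le>T n. real (i j) + 1)" for n
  have "0 < \<beta> * \<gamma>" using \<alpha> unfolding \<gamma>_def by linarith
  then have \<gamma>: "0 < \<gamma>" using \<beta>(1) by (auto simp: zero_less_mult_iff)
  have D0: "0 \<le> D n" for n by (auto simp: D_def intro!: prod_nonneg)
  obtain n0 where n0: "\<And>n. n \<ge> n0 \<Longrightarrow> D n \<le> exp (\<alpha> * real n)"
    using ev by (auto simp: eventually_sequentially D_def T_def)
  obtain N G where G: "G \<in> sets borel" "G \<subseteq> irr" "0 < measure unit_lborel G"
    and grow: "\<And>x n. x \<in> G \<Longrightarrow> N \<le> n \<Longrightarrow> exp (\<beta> * real n) \<le> cf_den (cf_prefix x n) ((gauss_map ^^ n) x)"
    using denominators_grow[OF \<beta>] by blast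
  obtain m l E where mlE: "m 0 = 0" "l 0 = 0" "E 0 = 1"
    and m: "\<And>k. m k < m (Suc k)" "\<And>k. N \<le> m (Suc k)"
    and l: "\<And>k. l (Suc k) = l k + (m (Suc k) - m k) + Suc (T (l k + (m (Suc k) - m k)))"
    and E: "\<And>k. E (Suc k) = 2 * E k * D (l k + (m (Suc k) - m k))" "\<And>k. 0 \<le> E k"
      "\<And>k. E k \<le> exp (\<beta> * \<gamma> * real (m k))"
    using ex_block_positions[of \<alpha> "\<beta> * \<gamma>" D n0 N T, OF \<alpha>(1) \<alpha>(2)[folded \<gamma>_def] D0 n0] by blast
  define pos where "pos k = l k + (m (Suc k) - m k)" for k
  define b where "b k = cf_block i (T (pos k))" for k
  interpret block_insertion b m "i 0" "i 1"
  proof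
    show "m 0 = 0" "m k < m (Suc k)" for k using mlE m by auto
    show "0 \<notin> set (b k)" for k unfolding b_def by (rule cf_block_pos[OF i])
    show "2 \<le> length (b k)" for k by (simp add: b_def T_def)
    show "b k ! 0 = i 0" "b k ! 1 = i 1" for k by (simp_all add: b_def cf_block_nth T_def)
  qed
  have len: "length (ins y k) = l k" for y k
    by (induction k) (auto simp: mlE l b_def pos_def)
  have recur: "inserted y \<in> recurrent_block_set i t" if y: "y \<in> irr" for y
  proof -
    have "\<exists>n\<ge>M. (gauss_map ^^ n) (inserted y) \<in> cylinder (cf_block i (t n))" for M
    proof (intro exI conjI)
      show "M \<le> pos M" using length_ins_ge[of M y] by (simp add: pos_def len)
      have "cf_digit (inserted y) (pos M + r) = i r" if "r \<le> t (pos M)" for r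
      proof -
        have r: "r \<le> T (pos M)" using that by (simp add: T_def)
        then have "cf_digit (inserted y) (pos M + r) = b M ! r"
          using inserted_block_digit[OF y, of r M] by (simp add: b_def len pos_def)
        then show ?thesis using r by (simp add: b_def cf_block_nth)
      qed
      then show "(gauss_map ^^ pos M) (inserted y) \<in> cylinder (cf_block i (t (pos M)))"
        by (simp add: funpow_in_block_iff[OF inserted(1)[OF y]])
    qed
    then show ?thesis using inserted(1)[OF y] by (auto simp: recurrent_block_set_eq)
  qed
  let ?C = "64 * real (i 0 + i 1)"
  have holder: "\<bar>y - y'\<bar> powr (1 / s) \<le> ?C * \<bar>inserted y - inserted y'\<bar>" if y: "y \<in> G" "y' \<in> G" for y y'
  proof (cases "y = y'")
    case True
    then show ?thesis using s by simp
  next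
    case False
    have irr: "y \<in> irr" "y' \<in> irr" using y G(2) by auto
    have bD: "cf_den (b k) v \<le> D (pos k)" if "v \<in> {0..1}" for k v
      using cf_den_le_prod[OF cf_block_pos[of i "T (pos k)", OF i] that]
      by (simp add: b_def D_def prod_list_cf_block)
    obtain k where k: "\<bar>y - y'\<bar> \<le> ?C * (E k)\<^sup>2 * \<bar>inserted y - inserted y'\<bar>"
      "\<bar>y - y'\<bar> \<le> 1 / (cf_den (cf_prefix y (m k)) ((gauss_map ^^ m k) y) * cf_den (cf_prefix y' (m k)) ((gauss_map ^^ m k) y'))"
      using inserted_distance[OF irr False, of "\<lambda>k. D (pos k)" E, OF bD mlE(3)] E(1)
      by (auto simp: pos_def)
    have den: "exp (\<beta> * real (m k)) \<le> cf_den (cf_prefix z (m k)) ((gauss_map ^^ m k) z)" if "z \<in> G" for z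
    \<comment> \<open>Only for k = 0 may \<open>m k\<close> lie below \<open>N\<close>, and there
      the bound is 1 \<le> 1.\<close>
    proof (cases k)
      case 0
      then show ?thesis by (simp add: mlE)
    next
      case (Suc k')
      then show ?thesis using grow[OF that] m(2) by simp
    qed
    define e where "e = exp (\<beta> * real (m k))"
    have e: "0 < e" by (simp add: e_def)
    have "\<bar>y - y'\<bar> \<le> 1 / (e * e)"
      by (rule order_trans[OF k(2)], unfold e_def, intro divide_left_mono mult_mono den y mult_pos_pos)
         (auto intro: order_trans[OF _ den] less_le_trans[OF _ den] y)
    then have "\<bar>y - y'\<bar> powr \<gamma> \<le> (1 / (e * e)) powr \<gamma>"
      using \<gamma> by (intro powr_mono2) auto
    also have "\<dots> = 1 / (exp (\<beta> * \<gamma> * real (m k)))\<^sup>2"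
    proof -
      have "1 / (e * e) = exp (- (2 * \<beta> * real (m k)))"
        by (simp add: e_def exp_minus inverse_eq_divide exp_add[symmetric])
      moreover have "1 / (exp (\<beta> * \<gamma> * real (m k)))\<^sup>2 = exp (- (2 * \<beta> * real (m k)) * \<gamma>)"
        by (simp add: exp_minus inverse_eq_divide exp_double[symmetric] mult_ac)
      ultimately show ?thesis by (simp add: powr_def mult_ac)
    qed
    finally have small: "\<bar>y - y'\<bar> powr \<gamma> \<le> 1 / (exp (\<beta> * \<gamma> * real (m k)))\<^sup>2" .
    have "\<bar>y - y'\<bar> powr (1 / s) = \<bar>y - y'\<bar> * \<bar>y - y'\<bar> powr \<gamma>"
      using False powr_add[of "\<bar>y - y'\<bar>" 1 \<gamma>] by (simp add: \<gamma>_def)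
    also have "\<dots> \<le> (?C * (E k)\<^sup>2 * \<bar>inserted y - inserted y'\<bar>) * (1 / (exp (\<beta> * \<gamma> * real (m k)))\<^sup>2)"
      using k(1) small by (intro mult_mono) auto
    also have "\<dots> = ?C * \<bar>inserted y - inserted y'\<bar> * ((E k)\<^sup>2 / (exp (\<beta> * \<gamma> * real (m k)))\<^sup>2)"
      by simp
    also have "\<dots> \<le> ?C * \<bar>inserted y - inserted y'\<bar> * 1"
    proof (rule mult_left_mono)
      have "(E k)\<^sup>2 \<le> (exp (\<beta> * \<gamma> * real (m k)))\<^sup>2"
        using E(2,3) by (intro power_mono) auto
      then show "(E k)\<^sup>2 / (exp (\<beta> * \<gamma> * real (m k)))\<^sup>2 \<le> 1"
        by (simp add: divide_le_eq_1)
    qed auto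
    finally show ?thesis by simp
  qed
  show ?thesis
  proof (rule hausdorff_measure_nonzero[OF G(1) G(3) _ s _ holder])
    show "inserted ` G \<subseteq> recurrent_block_set i t" using recur G(2) by auto
    show "0 < ?C" using i[of 0] by simp
  qed
qed

text \<open>Some covering set is nonempty and costs 1. This settles the exponent 0 in the infimum
  that defines the dimension, which the Hoelder argument with 1/s does not reach.\<close>

lemma hausdorff_measure_zero_nonzero:
  assumes "W \<noteq> {}"
  shows "hausdorff_measure 0 W \<noteq> 0"
proof -
  have "1 \<le> hausdorff_premeasure 0 1 W"
    unfolding hausdorff_premeasure_def
  proof (rule Inf_greatest, safe)
    fix U :: "nat \<Rightarrow> 'a set"
    assume "W \<subseteq> (\<Union>k. U k)"
    then obtain k where "U k \<noteq> {}" using assms by blast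
    then have "(1::ennreal) = diam_powr 0 (U k)" by (simp add: diam_powr_def)
    also have "\<dots> \<le> (\<Sum>k. diam_powr 0 (U k))"
      using sum_le_suminf[of "\<lambda>k. diam_powr 0 (U k)" "{k}"] by simp
    finally show "1 \<le> (\<Sum>k. diam_powr 0 (U k))" .
  qed
  also have "\<dots> \<le> hausdorff_measure 0 W"
    unfolding hausdorff_measure_def by (rule SUP_upper) simp
  finally show ?thesis by auto
qed

lemma hausdorff_measure_empty: "0 < s \<Longrightarrow> hausdorff_measure s {} = 0"
proof -
  have "hausdorff_premeasure s \<delta> ({} :: 'a set) = 0" if "0 < \<delta>" for \<delta>
  proof -
    have "hausdorff_premeasure s \<delta> ({} :: 'a set) \<le> 0"
      unfolding hausdorff_premeasure_def using that
      by (intro Inf_lower CollectI exI[of _ "\<lambda>_. {}"]) (auto simp: diam_powr_def)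
    then show ?thesis by simp
  qed
  then show "hausdorff_measure s ({} :: 'a set) = 0"
    by (simp add: hausdorff_measure_def)
qed

text \<open>The squares under the logarithm explain 2 \<alpha> against \<alpha>. Passing to
  \<open>max (t n) 1\<close> matters only where \<open>t n = 0\<close>; there the product is the
  constant \<open>c\<close>, which the exponential eventually exceeds.\<close>

lemma eventually_block_bound:
  fixes i t :: "nat \<Rightarrow> nat"
  assumes \<alpha>: "0 < \<alpha>"
    and lim: "limsup (\<lambda>n. ereal (1 / real n * ln (\<Prod>j\<le>t n. (real (i j) + 1)\<^sup>2))) < ereal (2 * \<alpha>)"
  shows "eventually (\<lambda>n. (\<Prod>j\<le>max (t n) 1. real (i j) + 1) \<le> exp (\<alpha> * real n)) sequentially"
proof -
  define c where "c = (real (i 0) + 1) * (real (i 1) + 1)"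
  have "eventually (\<lambda>n. c \<le> exp (\<alpha> * real n)) sequentially"
    using \<alpha> by real_asymp
  with Limsup_lessD[OF lim] eventually_gt_at_top[of 0]
  show ?thesis
  proof eventually_elim
    case (elim n)
    let ?p = "\<Prod>j\<le>t n. real (i j) + 1"
    have p: "0 < ?p" by (intro prod_pos) auto
    have "1 / real n * ln (?p\<^sup>2) < 2 * \<alpha>"
      using elim by (simp add: prod_power_distrib)
    then have "1 / real n * (2 * ln ?p) < 2 * \<alpha>"
      using p by (simp add: ln_realpow)
    then have "ln ?p < \<alpha> * real n"
      using elim by (simp add: field_simps)
    then have "?p \<le> exp (\<alpha> * real n)"
      using p by (metis exp_less_cancel_iff exp_ln less_imp_le)
    moreover have "(\<Prod>j\<le>max (t n) 1. real (i j) + 1) = (if t n = 0 then c else ?p)"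
    proof (cases "t n = 0")
      case False
      then have "max (t n) 1 = t n" by simp
      then show ?thesis using False by simp
    qed (simp add: c_def)
    ultimately show ?case using elim by simp
  qed
qed

lemma hausdorff_dim_recurrent_ge:
  fixes i t :: "nat \<Rightarrow> nat"
  assumes i: "\<And>n. 1 \<le> i n"
  shows "ereal (pi\<^sup>2) / (ereal (pi\<^sup>2) + ereal (6 * ln 2) *
      limsup (\<lambda>n. ereal (1 / real n * ln (\<Prod>j\<le>t n. (real (i j) + 1)\<^sup>2))))
    \<le> hausdorff_dim (recurrent_block_set i t)"
proof -
  let ?f = "\<lambda>n. ereal (1 / real n * ln (\<Prod>j\<le>t n. (real (i j) + 1)\<^sup>2))"
  let ?W = "recurrent_block_set i t"
  let ?R = "ereal (pi\<^sup>2) / (ereal (pi\<^sup>2) + ereal (6 * ln 2) * limsup ?f)"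
  have "0 \<le> ?f n" for n
  proof -
    have "1 \<le> (\<Prod>j\<le>t n. (real (i j) + 1)\<^sup>2)"
      by (intro prod_ge_1) (auto simp: one_le_power)
    then show ?thesis by simp
  qed
  then have L0: "0 \<le> limsup ?f"
    using Limsup_mono[of "\<lambda>_. 0" ?f sequentially] Limsup_const[of sequentially "0 :: ereal"] by simp
  have "?R \<le> hausdorff_dim ?W"
  proof (cases "limsup ?f")
    \<comment> \<open>An infinite limsup makes the claimed bound 0.\<close>
    case PInf
    have "0 \<le> hausdorff_dim ?W"
      unfolding hausdorff_dim_def by (rule Inf_greatest) auto
    moreover have "?R = 0" unfolding PInf by simp
    ultimately show ?thesis by (simp only:)
  next
    case MInf
    then show ?thesis using L0 by (simp only:) simp
  next
    case (real r)
    have r: "0 \<le> r" using L0 unfolding real by simp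
    define d where "d = pi\<^sup>2 / (pi\<^sup>2 + 6 * ln 2 * r)"
    have denom: "0 < pi\<^sup>2 + 6 * ln 2 * r"
      using r by (intro add_pos_nonneg) auto
    have R: "?R = ereal d" unfolding real using denom by (simp add: d_def)
    have d: "0 < d" using denom by (simp add: d_def)
    have nonzero: "hausdorff_measure s ?W \<noteq> 0" if s: "0 < s" "s < d" for s
    proof -
      have "s * (pi\<^sup>2 + 6 * ln 2 * r) < pi\<^sup>2"
        using s denom by (simp add: d_def pos_less_divide_eq)
      then have "6 * ln 2 * r < pi\<^sup>2 * (1 / s - 1)"
        using s by (simp add: field_simps)
      then have "r / 2 < pi\<^sup>2 / (12 * ln 2) * (1 / s - 1)"
        by (simp add: field_simps)
      \<comment> \<open>The inequality s < d has become r/2 < pi^2/(12 ln 2) (1/s - 1). The gap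
        leaves room for \<alpha> above half the limsup, and then for \<beta> below the Lyapunov
        exponent with \<alpha> < \<beta> (1/s - 1).\<close>
      then obtain \<alpha> where \<alpha>: "r / 2 < \<alpha>" "\<alpha> < pi\<^sup>2 / (12 * ln 2) * (1 / s - 1)"
        using dense by blast
      have "0 < pi\<^sup>2 / (12 * ln 2) * (1 / s - 1)" using \<alpha> r by linarith
      then have \<gamma>: "0 < 1 / s - 1"
        by (rule zero_less_mult_pos) simp
      have "\<alpha> / (1 / s - 1) < pi\<^sup>2 / (12 * ln 2)"
        using \<alpha>(2) \<gamma> by (simp only: pos_divide_less_eq)
      then obtain \<beta> where \<beta>: "\<alpha> / (1 / s - 1) < \<beta>" "\<beta> < pi\<^sup>2 / (12 * ln 2)"
        using dense by blast
      have \<alpha>0: "0 < \<alpha>" using \<alpha>(1) r by linarith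
      then have "0 < \<alpha> / (1 / s - 1)" using \<gamma> by (rule divide_pos_pos)
      then have \<beta>0: "0 \<le> \<beta>" using \<beta>(1) by linarith
      have \<alpha>\<beta>: "\<alpha> < \<beta> * (1 / s - 1)" using \<beta>(1) \<gamma> by (simp only: pos_divide_less_eq)
      have "limsup ?f < ereal (2 * \<alpha>)" unfolding real using \<alpha>(1) by simp
      from eventually_block_bound[OF \<alpha>0 this]
      show ?thesis by (rule hausdorff_measure_recurrent_nonzero[OF i s(1) \<beta>0 \<beta>(2) \<alpha>0 \<alpha>\<beta>])
    qed
    \<comment> \<open>The empty set has measure 0 at positive exponents, so the nonzero measure at d
      / 2 provides a point.\<close>
    have "?W \<noteq> {}"
      using nonzero[of "d / 2"] d hausdorff_measure_empty[of "d / 2"] by auto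
    show ?thesis
      unfolding R hausdorff_dim_def
    proof (rule Inf_greatest, safe)
      fix s :: real assume s: "0 \<le> s" "hausdorff_measure s ?W = 0"
      then have "s \<noteq> 0" using hausdorff_measure_zero_nonzero[OF \<open>?W \<noteq> {}\<close>] by auto
      then show "ereal d \<le> ereal s" using nonzero[of s] s by force
    qed
  qed
  then show ?thesis .
qed

theorem theorem1p6:
  fixes x0 :: real and i t :: "nat \<Rightarrow> nat"
  assumes "x0 \<in> {0..1}" and "x0 \<notin> \<rat>"
    and "\<And>n. i n = cf_digit x0 n"
    and "mono t"
  shows "(\<not> summable (\<lambda>n. 1 / (\<Prod>j\<le>t n. (real (i j) + 1)\<^sup>2)) \<longrightarrow>
            emeasure lebesgue (recurrent_block_set i t) = 1) \<and>
         (summable (\<lambda>n. 1 / (\<Prod>j\<le>t n. (real (i j))\<^sup>2)) \<longrightarrow>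
            recurrent_block_set i t \<in> null_sets lebesgue) \<and>
         ((\<lambda>n. ln (real (i n))) \<in> o(\<lambda>n. real n) \<longrightarrow>
            hausdorff_dim (recurrent_block_set i t) \<ge>
              ereal (pi\<^sup>2) / (ereal (pi\<^sup>2) + ereal (6 * ln 2) *
                limsup (\<lambda>n. ereal (1 / real n * ln (\<Prod>j\<le>t n. (real (i j) + 1)\<^sup>2)))))"
proof -
  have "1 \<le> i n" for n
    using cf_digit_pos[OF unit_interval_irr[OF assms(1,2)]] assms(3) by simp
  then show ?thesis
    using recurrent_full_measure[of i t] recurrent_null[of i t] hausdorff_dim_recurrent_ge[of i t] by blast
qed

end
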